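(* Let $\mathcal{C}$ be a prop and $\mathcal{A}$ a sub-prop of $\mathcal{C}$ such that: $\mathcal{C}$ has pushouts and pullbacks; $\mathcal{C}$ has a costable factorisation system $(\mathcal{E},\mathcal{M})$ with every morphism of $\mathcal{M}$ a monomorphism; $\mathcal{A}$ contains $\mathcal{M}$, is stable under pullback, and for every cospan $X\xrightarrow{f}A\xleftarrow{g}Y$ with $f,g\in\mathcal{A}$ the canonical morphism from the pushout (in $\mathcal{C}$) of its pullback span (in $\mathcal{C}$) to $A$ lies in $\mathcal{M}$. Suppose further that the monoidal product $\oplus$ of $\mathcal{C}$ preserves pushouts in $\mathcal{C}$ and pullbacks in $\mathcal{A}$, and that $\mathcal{M}$ is closed under $\oplus$. Then $\mathrm{Span}(\mathcal{A})$, $\mathrm{Cospan}(\mathcal{C})$ and $\mathrm{Corel}(\mathcal{C})$ are props (with monoidal product induced by $\oplus$), and the square \[ \begin{array}{ccc} \mathcal{A}+\mathcal{A}^{op} & \longrightarrow & \mathrm{Span}(\mathcal{A})\\ \downarrow & & \downarrow \Pi\\ \mathrm{Cospan}(\mathcal{C}) & \xrightarrow{\ \Gamma\ } & \mathrm{Corel}(\mathcal{C}) \end{array} \] is a pushout in $\mathbf{PROP}$.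
   Context: A prop is a symmetric strict monoidal category whose objects are the natural numbers with $n\oplus m=n+m$; $\mathbf{PROP}$ is the category of props and identity-on-objects strict symmetric monoidal functors; $\mathcal{A}+\mathcal{A}^{op}$ is the coproduct in $\mathbf{PROP}$ (its morphisms are zigzags of morphisms of $\mathcal{A}$). Composition is written $f;g$ (first $f$ then $g$). A factorisation system $(\mathcal{E},\mathcal{M})$: subcategories containing all isomorphisms, every morphism factors as $e;m$ with $e\in\mathcal{E}$, $m\in\mathcal{M}$, with unique diagonal fill-in; costable: $\mathcal{M}$ is stable under pushout (in any pushout square the morphism opposite to one in $\mathcal{M}$ is in $\mathcal{M}$). $\mathcal{A}$ stable under pullback: in any pullback square in $\mathcal{C}$ the morphism opposite to one in $\mathcal{A}$ is in $\mathcal{A}$. $\oplus$ preserves pushouts in $\mathcal{C}$: for all spans $N\leftarrow Y\to M$ and $N'\leftarrow Y'\to M'$ in $\mathcal{C}$, $(N\oplus N')+_{Y\oplus Y'}(M\oplus M')\cong(N+_YM)\oplus(N'+_{Y'}M')$ (canonically); preserving pullbacks in $\mathcal{A}$ is the analogous condition for cospans in $\mathcal{A}$ and pullbacks computed in $\mathcal{C}$. $\mathcal{M}$ closed under $\oplus$: $f,g\in\mathcal{M}$ implies $f\oplus g\in\mathcal{M}$. $\mathrm{Cospan}(\mathcal{C})$: isomorphism classes of cospans composed by pushout; $\mathrm{Span}(\mathcal{A})$: isomorphism classes of spans with both legs in $\mathcal{A}$ composed by pullback in $\mathcal{C}$. $\mathrm{Corel}(\mathcal{C})$: morphisms $X\to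 Y$ are equivalence classes of cospans $X\xrightarrow{f}N\xleftarrow{g}Y$ under the equivalence relation generated by $(f,g)\sim(f',g')$ whenever there is $m\colon N\to N'$ in $\mathcal{M}$ with $f;m=f'$, $g;m=g'$. The left functor is induced by $f\mapsto(f,\mathrm{id})$, $g^{op}\mapsto(\mathrm{id},g)$ as cospans; the top functor by $f\mapsto(\mathrm{id},f)$, $g^{op}\mapsto(g,\mathrm{id})$ as spans. $\Gamma$ sends a cospan to the corelation it represents; $\Pi$ sends a span in $\mathcal{A}$ to the corelation represented by its pushout cospan in $\mathcal{C}$. *)

theory Defs
  imports Main
begin

section \<open>Props\<close>

text \<open>
  The objects of a prop are the natural numbers, so a prop is given by its arrows alone.
  Composition \<open>f \<Zsemi> g\<close> is in diagrammatic order; \<open>symm m n\<close> is the symmetry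
  \<open>m + n \<rightarrow> n + m\<close>.
\<close>

record 'a prop_data =
  hom :: "nat \<Rightarrow> nat \<Rightarrow> 'a set"
  cmp :: "'a \<Rightarrow> 'a \<Rightarrow> 'a" (infixl "\<Zsemi>\<index>" 70)
  idn :: "nat \<Rightarrow> 'a"
  tensor :: "'a \<Rightarrow> 'a \<Rightarrow> 'a" (infixl "\<oplus>\<index>" 75)
  symm :: "nat \<Rightarrow> nat \<Rightarrow> 'a"

text \<open>
  Of the coherence laws of a symmetry only one hexagon is listed: the other hexagon and
  \<open>symm n 0 = symm 0 n = idn n\<close> follow from it and from \<open>symm_inverse\<close>.
\<close>

locale is_prop =
  fixes P :: "'a prop_data" (structure)
  assumes hom_disjoint: "f \<in> hom P X Y \<Longrightarrow> f \<in> hom P X' Y' \<Longrightarrow> X = X' \<and> Y = Y'"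
    and idn_hom: "idn P X \<in> hom P X X"
    and comp_hom: "f \<in> hom P X Y \<Longrightarrow> g \<in> hom P Y Z \<Longrightarrow> f \<Zsemi> g \<in> hom P X Z"
    and comp_assoc: "f \<in> hom P W X \<Longrightarrow> g \<in> hom P X Y \<Longrightarrow> h \<in> hom P Y Z
          \<Longrightarrow> f \<Zsemi> g \<Zsemi> h = f \<Zsemi> (g \<Zsemi> h)"
    and idn_comp: "f \<in> hom P X Y \<Longrightarrow> idn P X \<Zsemi> f = f"
    and comp_idn: "f \<in> hom P X Y \<Longrightarrow> f \<Zsemi> idn P Y = f"
    and tensor_hom: "f \<in> hom P X Y \<Longrightarrow> f' \<in> hom P X' Y' \<Longrightarrow> f \<oplus> f' \<in> hom P (X + X') (Y + Y')"
    and tensor_idn: "idn P X \<oplus> idn P Y = idn P (X + Y)"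
    and tensor_comp: "f \<in> hom P X Y \<Longrightarrow> g \<in> hom P Y Z \<Longrightarrow> f' \<in> hom P X' Y' \<Longrightarrow> g' \<in> hom P Y' Z'
          \<Longrightarrow> (f \<Zsemi> g) \<oplus> (f' \<Zsemi> g') = (f \<oplus> f') \<Zsemi> (g \<oplus> g')"
    and tensor_assoc: "f \<in> hom P X Y \<Longrightarrow> f' \<in> hom P X' Y' \<Longrightarrow> f'' \<in> hom P X'' Y''
          \<Longrightarrow> f \<oplus> f' \<oplus> f'' = f \<oplus> (f' \<oplus> f'')"
    and idn0_tensor: "f \<in> hom P X Y \<Longrightarrow> idn P 0 \<oplus> f = f"
    and tensor_idn0: "f \<in> hom P X Y \<Longrightarrow> f \<oplus> idn P 0 = f"
    and symm_hom: "symm P X Y \<in> hom P (X + Y) (Y + X)"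
    and symm_natural: "f \<in> hom P X Y \<Longrightarrow> f' \<in> hom P X' Y'
          \<Longrightarrow> (f \<oplus> f') \<Zsemi> symm P Y Y' = symm P X X' \<Zsemi> (f' \<oplus> f)"
    and symm_inverse: "symm P X Y \<Zsemi> symm P Y X = idn P (X + Y)"
    and symm_hexagon: "symm P X (Y + Z) = (symm P X Y \<oplus> idn P Z) \<Zsemi> (idn P Y \<oplus> symm P X Z)"

definition arrows :: "'a prop_data \<Rightarrow> 'a set" where
  "arrows P = (\<Union>X Y. hom P X Y)"

definition dom_of :: "'a prop_data \<Rightarrow> 'a \<Rightarrow> nat" where
  "dom_of P f = (THE X. \<exists>Y. f \<in> hom P X Y)"

definition cod_of :: "'a prop_data \<Rightarrow> 'a \<Rightarrow> nat" where
  "cod_of P f = (THE Y. \<exists>X. f \<in> hom P X Y)"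

definition opposite :: "'a prop_data \<Rightarrow> 'a prop_data" where
  "opposite P = \<lparr>hom = \<lambda>X Y. hom P Y X, cmp = \<lambda>f g. g \<Zsemi>\<^bsub>P\<^esub> f, idn = idn P,
     tensor = tensor P, symm = \<lambda>X Y. symm P Y X\<rparr>"

definition sub_prop :: "'a prop_data \<Rightarrow> 'a set \<Rightarrow> bool" where
  "sub_prop P S \<longleftrightarrow> S \<subseteq> arrows P \<and>
     (\<forall>X. idn P X \<in> S) \<and> (\<forall>X Y. symm P X Y \<in> S) \<and>
     (\<forall>X Y Z. \<forall>f \<in> hom P X Y \<inter> S. \<forall>g \<in> hom P Y Z \<inter> S. f \<Zsemi>\<^bsub>P\<^esub> g \<in> S) \<and>
     (\<forall>f \<in> S. \<forall>g \<in> S. f \<oplus>\<^bsub>P\<^esub> g \<in> S)"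

definition restrict_prop :: "'a prop_data \<Rightarrow> 'a set \<Rightarrow> 'a prop_data" where
  "restrict_prop P S = P\<lparr>hom := \<lambda>X Y. hom P X Y \<inter> S\<rparr>"

text \<open>
  Morphisms of \<open>PROP\<close>.  Only the values on arrows matter; two such functions are equal as
  morphisms iff they agree on \<open>arrows P\<close>.
\<close>

definition prop_morphism :: "'a prop_data \<Rightarrow> 'b prop_data \<Rightarrow> ('a \<Rightarrow> 'b) \<Rightarrow> bool" where
  "prop_morphism P Q F \<longleftrightarrow>
     (\<forall>X Y. \<forall>f \<in> hom P X Y. F f \<in> hom Q X Y) \<and>
     (\<forall>X. F (idn P X) = idn Q X) \<and>
     (\<forall>X Y Z. \<forall>f \<in> hom P X Y. \<forall>g \<in> hom P Y Z. F (f \<Zsemi>\<^bsub>P\<^esub> g) = F f \<Zsemi>\<^bsub>Q\<^esub> F g) \<and>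
     (\<forall>f \<in> arrows P. \<forall>g \<in> arrows P. F (f \<oplus>\<^bsub>P\<^esub> g) = F f \<oplus>\<^bsub>Q\<^esub> F g) \<and>
     (\<forall>X Y. F (symm P X Y) = symm Q X Y)"

text \<open>
  \<open>is_PROP_pushout TYPE('d) P Q R S F G H K\<close>: the square with \<open>F: P \<rightarrow> Q\<close>,
  \<open>G: P \<rightarrow> R\<close>, \<open>H: Q \<rightarrow> S\<close>, \<open>K: R \<rightarrow> S\<close> commutes and is universal among props with
  arrows in the type \<open>'d\<close>.  A type variable cannot be quantified inside a formula; the
  universal property against all props is obtained by leaving \<open>'d\<close> free.
\<close>

definition is_PROP_pushout :: "'d itself \<Rightarrow> 'p prop_data \<Rightarrow> 'q prop_data \<Rightarrow> 'r prop_data \<Rightarrow>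
    's prop_data \<Rightarrow> ('p \<Rightarrow> 'q) \<Rightarrow> ('p \<Rightarrow> 'r) \<Rightarrow> ('q \<Rightarrow> 's) \<Rightarrow> ('r \<Rightarrow> 's) \<Rightarrow> bool" where
  "is_PROP_pushout d P Q R S F G H K \<longleftrightarrow>
     is_prop P \<and> is_prop Q \<and> is_prop R \<and> is_prop S \<and>
     prop_morphism P Q F \<and> prop_morphism P R G \<and> prop_morphism Q S H \<and> prop_morphism R S K \<and>
     (\<forall>x \<in> arrows P. H (F x) = K (G x)) \<and>
     (\<forall>(D :: 'd prop_data) U V.
        is_prop D \<and> prop_morphism Q D U \<and> prop_morphism R D V \<and>
        (\<forall>x \<in> arrows P. U (F x) = V (G x)) \<longrightarrow>
        (\<exists>W. prop_morphism S D W \<and>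
             (\<forall>y \<in> arrows Q. W (H y) = U y) \<and> (\<forall>z \<in> arrows R. W (K z) = V z) \<and>
             (\<forall>W'. prop_morphism S D W' \<and>
                   (\<forall>y \<in> arrows Q. W' (H y) = U y) \<and> (\<forall>z \<in> arrows R. W' (K z) = V z) \<longrightarrow>
                   (\<forall>s \<in> arrows S. W' s = W s))))"


section \<open>Coproducts of props\<close>

text \<open>
  Formal composites and monoidal products of arrows of \<open>A\<close> and of \<open>B\<close>, modulo the congruence
  generated by the laws of a prop and by the requirement that both injections preserve the prop
  structure.  Identities and symmetries need no constructors of their own.  That this is the
  coproduct in \<open>PROP\<close> is proved in \<open>coproduct_universal\<close> below.
\<close>

datatype ('a, 'b) word =
    InA 'a
  | InB 'b
  | Seq "('a, 'b) word" "('a, 'b) word"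
  | Par "('a, 'b) word" "('a, 'b) word"

inductive typed :: "'a prop_data \<Rightarrow> 'b prop_data \<Rightarrow> ('a, 'b) word \<Rightarrow> nat \<Rightarrow> nat \<Rightarrow> bool"
  for A B where
  InA: "a \<in> hom A X Y \<Longrightarrow> typed A B (InA a) X Y"
| InB: "b \<in> hom B X Y \<Longrightarrow> typed A B (InB b) X Y"
| Seq: "typed A B u X Y \<Longrightarrow> typed A B v Y Z \<Longrightarrow> typed A B (Seq u v) X Z"
| Par: "typed A B u X Y \<Longrightarrow> typed A B v X' Y' \<Longrightarrow> typed A B (Par u v) (X + X') (Y + Y')"

inductive word_eq :: "'a prop_data \<Rightarrow> 'b prop_data \<Rightarrow> ('a, 'b) word \<Rightarrow> ('a, 'b) word \<Rightarrow> bool"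
  for A B where
  refl: "typed A B u X Y \<Longrightarrow> word_eq A B u u"
| sym: "word_eq A B u v \<Longrightarrow> word_eq A B v u"
| trans: "word_eq A B u v \<Longrightarrow> word_eq A B v w \<Longrightarrow> word_eq A B u w"
| Seq_cong: "word_eq A B u u' \<Longrightarrow> word_eq A B v v' \<Longrightarrow> typed A B u X Y \<Longrightarrow> typed A B v Y Z
    \<Longrightarrow> word_eq A B (Seq u v) (Seq u' v')"
| Par_cong: "word_eq A B u u' \<Longrightarrow> word_eq A B v v' \<Longrightarrow> word_eq A B (Par u v) (Par u' v')"
| InA_comp: "a \<in> hom A X Y \<Longrightarrow> a' \<in> hom A Y Z
    \<Longrightarrow> word_eq A B (InA (a \<Zsemi>\<^bsub>A\<^esub> a')) (Seq (InA a) (InA a'))"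
| InA_tensor: "a \<in> hom A X Y \<Longrightarrow> a' \<in> hom A X' Y'
    \<Longrightarrow> word_eq A B (InA (a \<oplus>\<^bsub>A\<^esub> a')) (Par (InA a) (InA a'))"
| InB_comp: "b \<in> hom B X Y \<Longrightarrow> b' \<in> hom B Y Z
    \<Longrightarrow> word_eq A B (InB (b \<Zsemi>\<^bsub>B\<^esub> b')) (Seq (InB b) (InB b'))"
| InB_tensor: "b \<in> hom B X Y \<Longrightarrow> b' \<in> hom B X' Y'
    \<Longrightarrow> word_eq A B (InB (b \<oplus>\<^bsub>B\<^esub> b')) (Par (InB b) (InB b'))"
| idn: "word_eq A B (InA (idn A X)) (InB (idn B X))"
| symm: "word_eq A B (InA (symm A X Y)) (InB (symm B X Y))"
| Seq_assoc: "typed A B u W X \<Longrightarrow> typed A B v X Y \<Longrightarrow> typed A B w Y Z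
    \<Longrightarrow> word_eq A B (Seq (Seq u v) w) (Seq u (Seq v w))"
| idn_Seq: "typed A B u X Y \<Longrightarrow> word_eq A B (Seq (InA (idn A X)) u) u"
| Seq_idn: "typed A B u X Y \<Longrightarrow> word_eq A B (Seq u (InA (idn A Y))) u"
| Par_Seq: "typed A B u X Y \<Longrightarrow> typed A B v Y Z \<Longrightarrow> typed A B u' X' Y' \<Longrightarrow> typed A B v' Y' Z'
    \<Longrightarrow> word_eq A B (Par (Seq u v) (Seq u' v')) (Seq (Par u u') (Par v v'))"
| Par_assoc: "typed A B u X Y \<Longrightarrow> typed A B u' X' Y' \<Longrightarrow> typed A B u'' X'' Y''
    \<Longrightarrow> word_eq A B (Par (Par u u') u'') (Par u (Par u' u''))"
| idn0_Par: "typed A B u X Y \<Longrightarrow> word_eq A B (Par (InA (idn A 0)) u) u"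
| Par_idn0: "typed A B u X Y \<Longrightarrow> word_eq A B (Par u (InA (idn A 0))) u"
| symm_natural: "typed A B u X Y \<Longrightarrow> typed A B u' X' Y'
    \<Longrightarrow> word_eq A B (Seq (Par u u') (InA (symm A Y Y'))) (Seq (InA (symm A X X')) (Par u' u))"

definition word_rel :: "'a prop_data \<Rightarrow> 'b prop_data \<Rightarrow> (('a, 'b) word \<times> ('a, 'b) word) set" where
  "word_rel A B = {(u, v). word_eq A B u v}"

definition coproduct :: "'a prop_data \<Rightarrow> 'b prop_data \<Rightarrow> ('a, 'b) word set prop_data" where
  "coproduct A B =
     \<lparr>hom = \<lambda>X Y. {u. typed A B u X Y} // word_rel A B,
      cmp = \<lambda>a b. word_rel A B `` {Seq u v | u v X Y Z. u \<in> a \<and> v \<in> b \<and> typed A B u X Y \<and> typed A B v Y Z},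
      idn = \<lambda>X. word_rel A B `` {InA (idn A X)},
      tensor = \<lambda>a b. word_rel A B `` {Par u v | u v. u \<in> a \<and> v \<in> b},
      symm = \<lambda>X Y. word_rel A B `` {InA (symm A X Y)}\<rparr>"

definition inj_A :: "'a prop_data \<Rightarrow> 'b prop_data \<Rightarrow> 'a \<Rightarrow> ('a, 'b) word set" where
  "inj_A A B a = word_rel A B `` {InA a}"

definition inj_B :: "'a prop_data \<Rightarrow> 'b prop_data \<Rightarrow> 'b \<Rightarrow> ('a, 'b) word set" where
  "inj_B A B b = word_rel A B `` {InB b}"

primrec word_eval :: "'d prop_data \<Rightarrow> ('a \<Rightarrow> 'd) \<Rightarrow> ('b \<Rightarrow> 'd) \<Rightarrow> ('a, 'b) word \<Rightarrow> 'd" where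
  "word_eval D F G (InA a) = F a"
| "word_eval D F G (InB b) = G b"
| "word_eval D F G (Seq u v) = word_eval D F G u \<Zsemi>\<^bsub>D\<^esub> word_eval D F G v"
| "word_eval D F G (Par u v) = word_eval D F G u \<oplus>\<^bsub>D\<^esub> word_eval D F G v"

text \<open>
  The morphism \<open>A + B \<rightarrow> D\<close> induced by \<open>F: A \<rightarrow> D\<close> and \<open>G: B \<rightarrow> D\<close>; all words of
  one class have the same value.
\<close>

definition copair :: "'d prop_data \<Rightarrow> ('a \<Rightarrow> 'd) \<Rightarrow> ('b \<Rightarrow> 'd) \<Rightarrow> ('a, 'b) word set \<Rightarrow> 'd" where
  "copair D F G x = the_elem (word_eval D F G ` x)"


subsection \<open>Universal property\<close>

definition is_PROP_coproduct :: "'d itself \<Rightarrow> 'a prop_data \<Rightarrow> 'b prop_data \<Rightarrow> 'p prop_data \<Rightarrow>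
    ('a \<Rightarrow> 'p) \<Rightarrow> ('b \<Rightarrow> 'p) \<Rightarrow> bool" where
  "is_PROP_coproduct d A B P I J \<longleftrightarrow>
     is_prop A \<and> is_prop B \<and> is_prop P \<and> prop_morphism A P I \<and> prop_morphism B P J \<and>
     (\<forall>(D :: 'd prop_data) F G.
        is_prop D \<and> prop_morphism A D F \<and> prop_morphism B D G \<longrightarrow>
        (\<exists>W. prop_morphism P D W \<and>
             (\<forall>a \<in> arrows A. W (I a) = F a) \<and> (\<forall>b \<in> arrows B. W (J b) = G b) \<and>
             (\<forall>W'. prop_morphism P D W' \<and>
                   (\<forall>a \<in> arrows A. W' (I a) = F a) \<and> (\<forall>b \<in> arrows B. W' (J b) = G b) \<longrightarrow>
                   (\<forall>x \<in> arrows P. W' x = W x))))"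

lemma arrowsI: "f \<in> hom P X Y \<Longrightarrow> f \<in> arrows P"
  by (auto simp: arrows_def)

lemma prop_morphismD:
  assumes "prop_morphism P Q F"
  shows "f \<in> hom P X Y \<Longrightarrow> F f \<in> hom Q X Y"
    and "F (idn P X) = idn Q X"
    and "f \<in> hom P X Y \<Longrightarrow> g \<in> hom P Y Z \<Longrightarrow> F (f \<Zsemi>\<^bsub>P\<^esub> g) = F f \<Zsemi>\<^bsub>Q\<^esub> F g"
    and "f \<in> hom P X Y \<Longrightarrow> f' \<in> hom P X' Y' \<Longrightarrow> F (f \<oplus>\<^bsub>P\<^esub> f') = F f \<oplus>\<^bsub>Q\<^esub> F f'"
    and "F (symm P X Y) = symm Q X Y"
  using assms unfolding prop_morphism_def by (simp_all add: arrowsI)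

inductive_cases typed_InA: "typed A B (InA a) X Y"
inductive_cases typed_InB: "typed A B (InB b) X Y"
inductive_cases typed_Seq: "typed A B (Seq u v) X Y"
inductive_cases typed_Par: "typed A B (Par u v) X Y"

locale two_props = A: is_prop A + B: is_prop B
  for A :: "'a prop_data" and B :: "'b prop_data"
begin

definition "cls u = word_rel A B `` {u}"

lemma typed_unique: "typed A B u X Y \<Longrightarrow> typed A B u X' Y' \<Longrightarrow> X = X' \<and> Y = Y'"
proof (induction arbitrary: X' Y' rule: typed.induct)
  case InA then show ?case by (blast elim: typed_InA dest: A.hom_disjoint)
next
  case InB then show ?case by (blast elim: typed_InB dest: B.hom_disjoint)
next
  case Seq then show ?case by (blast elim: typed_Seq)
next
  case Par then show ?case by (blast elim: typed_Par)
qed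

lemma typed_idn: "typed A B (InA (idn A X)) X X"
  by (intro typed.InA A.idn_hom)

lemma typed_symm: "typed A B (InA (symm A X Y)) (X + Y) (Y + X)"
  by (intro typed.InA A.symm_hom)

lemma word_eq_typed_ex: "word_eq A B u v \<Longrightarrow> \<exists>X Y. typed A B u X Y \<and> typed A B v X Y"
proof (induction rule: word_eq.induct)
  case trans then show ?case using typed_unique by metis
next
  case (Seq_cong u u' v v' X Y Z)
  then show ?case using typed_unique typed.Seq by metis
next
  case (Seq_assoc u W X v Y w Z)
  then show ?case by (meson typed.Seq)
next
  case (idn_Seq u X Y)
  then show ?case by (meson typed.Seq typed_idn)
next
  case (Seq_idn u X Y)
  then show ?case by (meson typed.Seq typed_idn)
next
  case (Par_Seq u X Y v Z u' X' Y' v' Z')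
  then show ?case by (meson typed.Seq typed.Par)
next
  case (Par_assoc u X Y u' X' Y' u'' X'' Y'')
  then have "typed A B (Par (Par u u') u'') (X + X' + X'') (Y + Y' + Y'')"
    and "typed A B (Par u (Par u' u'')) (X + (X' + X'')) (Y + (Y' + Y''))"
    by (blast intro: typed.Par)+
  then show ?case by (metis add.assoc)
next
  case (idn0_Par u X Y)
  then have "typed A B (Par (InA (idn A 0)) u) (0 + X) (0 + Y)"
    by (blast intro: typed.Par typed_idn)
  with idn0_Par show ?case by auto
next
  case (Par_idn0 u X Y)
  then have "typed A B (Par u (InA (idn A 0))) (X + 0) (Y + 0)"
    by (blast intro: typed.Par typed_idn)
  with Par_idn0 show ?case by auto
next
  case (symm_natural u X Y u' X' Y')
  then show ?case by (meson typed.Seq typed.Par typed_symm)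
qed (meson typed.intros A.comp_hom B.comp_hom A.tensor_hom B.tensor_hom A.idn_hom B.idn_hom
      A.symm_hom B.symm_hom)+

lemma word_eq_typed: "word_eq A B u v \<Longrightarrow> typed A B u X Y \<Longrightarrow> typed A B v X Y"
  using word_eq_typed_ex typed_unique by metis

lemma in_cls [simp]: "v \<in> cls u \<longleftrightarrow> word_eq A B u v"
  by (simp add: cls_def word_rel_def)

lemma cls_eq: "word_eq A B u v \<Longrightarrow> cls u = cls v"
  by (blast intro: set_eqI word_eq.sym word_eq.trans iffD1[OF in_cls] iffD2[OF in_cls])

lemma hom_coproduct: "hom (coproduct A B) X Y = {cls u | u. typed A B u X Y}"
  by (auto simp: coproduct_def quotient_def cls_def)

lemma hom_coproductE:
  assumes "x \<in> hom (coproduct A B) X Y"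
  obtains u where "x = cls u" "typed A B u X Y"
  using assms by (auto simp: hom_coproduct)

lemma hom_coproductI: "typed A B u X Y \<Longrightarrow> cls u \<in> hom (coproduct A B) X Y"
  by (auto simp: hom_coproduct)

lemma comp_cls:
  assumes u: "typed A B u X Y" and v: "typed A B v Y Z"
  shows "cls u \<Zsemi>\<^bsub>coproduct A B\<^esub> cls v = cls (Seq u v)" (is "?l = ?r")
proof
  show "?l \<subseteq> ?r"
    using u v word_eq_typed
    by (auto simp: coproduct_def word_rel_def)
      (meson word_eq.trans word_eq.Seq_cong)
  have "Seq u v \<in> {Seq u' v' | u' v' X Y Z. u' \<in> cls u \<and> v' \<in> cls v \<and> typed A B u' X Y \<and> typed A B v' Y Z}"
    unfolding mem_Collect_eq in_cls using u v word_eq.refl by blast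
  then show "?r \<subseteq> ?l" unfolding coproduct_def cls_def[of "_ u v"] prop_data.simps by blast
qed

lemma tensor_cls:
  assumes u: "typed A B u X Y" and v: "typed A B v X' Y'"
  shows "cls u \<oplus>\<^bsub>coproduct A B\<^esub> cls v = cls (Par u v)" (is "?l = ?r")
proof
  show "?l \<subseteq> ?r"
    by (auto simp: coproduct_def word_rel_def) (meson word_eq.trans word_eq.Par_cong)
  have "Par u v \<in> {Par u' v' | u' v'. u' \<in> cls u \<and> v' \<in> cls v}"
    unfolding mem_Collect_eq in_cls using u v word_eq.refl by blast
  then show "?r \<subseteq> ?l" unfolding coproduct_def cls_def[of "_ u v"] prop_data.simps by blast
qed

lemma idn_cls: "idn (coproduct A B) X = cls (InA (idn A X))"
  by (simp add: coproduct_def cls_def)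

lemma symm_cls: "symm (coproduct A B) X Y = cls (InA (symm A X Y))"
  by (simp add: coproduct_def cls_def)

lemmas ty = typed.Seq typed.Par typed_idn typed_symm

lemma InA_comp_eq: "a \<in> hom A X Y \<Longrightarrow> a' \<in> hom A Y Z \<Longrightarrow>
    cls (Seq (InA a) (InA a')) = cls (InA (a \<Zsemi>\<^bsub>A\<^esub> a'))"
  by (rule cls_eq[symmetric], rule word_eq.InA_comp)

lemma InA_tensor_eq: "a \<in> hom A X Y \<Longrightarrow> a' \<in> hom A X' Y' \<Longrightarrow>
    cls (Par (InA a) (InA a')) = cls (InA (a \<oplus>\<^bsub>A\<^esub> a'))"
  by (rule cls_eq[symmetric], rule word_eq.InA_tensor)

lemma InB_comp_eq: "b \<in> hom B X Y \<Longrightarrow> b' \<in> hom B Y Z \<Longrightarrow>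
    cls (Seq (InB b) (InB b')) = cls (InB (b \<Zsemi>\<^bsub>B\<^esub> b'))"
  by (rule cls_eq[symmetric], rule word_eq.InB_comp)

lemma InB_tensor_eq: "b \<in> hom B X Y \<Longrightarrow> b' \<in> hom B X' Y' \<Longrightarrow>
    cls (Par (InB b) (InB b')) = cls (InB (b \<oplus>\<^bsub>B\<^esub> b'))"
  by (rule cls_eq[symmetric], rule word_eq.InB_tensor)

lemma is_prop_coproduct: "is_prop (coproduct A B)"
proof (unfold_locales, goal_cases)
  case (1 x X Y X' Y')
  then obtain u v where "x = cls u" "x = cls v" "typed A B u X Y" "typed A B v X' Y'"
    by (metis hom_coproductE)
  then have "word_eq A B u v" using in_cls word_eq.refl by metis
  then show ?case
    using \<open>typed A B u X Y\<close> \<open>typed A B v X' Y'\<close> word_eq_typed typed_unique by metis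
next
  case (2 X) then show ?case unfolding idn_cls by (intro hom_coproductI ty)
next
  case (3 x X Y y Z) then show ?case
    by (elim hom_coproductE) (simp only: comp_cls hom_coproductI ty)
next
  case (4 x W X y Y z Z)
  then obtain u v w where uvw: "x = cls u" "y = cls v" "z = cls w"
    and t: "typed A B u W X" "typed A B v X Y" "typed A B w Y Z" by (metis hom_coproductE)
  have "cls u \<Zsemi>\<^bsub>coproduct A B\<^esub> cls v \<Zsemi>\<^bsub>coproduct A B\<^esub> cls w = cls (Seq (Seq u v) w)"
    using t by (metis comp_cls typed.Seq)
  also have "\<dots> = cls (Seq u (Seq v w))" using t by (intro cls_eq word_eq.Seq_assoc)
  also have "\<dots> = cls u \<Zsemi>\<^bsub>coproduct A B\<^esub> (cls v \<Zsemi>\<^bsub>coproduct A B\<^esub> cls w)"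
    using t by (metis comp_cls typed.Seq)
  finally show ?case by (simp only: uvw)
next
  case (5 x X Y)
  from 5 obtain u where u: "x = cls u" "typed A B u X Y" by (rule hom_coproductE)
  show ?case unfolding idn_cls u(1)
    unfolding comp_cls[OF typed_idn u(2)] by (rule cls_eq, rule word_eq.idn_Seq, rule u(2))
next
  case (6 x X Y)
  from 6 obtain u where u: "x = cls u" "typed A B u X Y" by (rule hom_coproductE)
  show ?case unfolding idn_cls u(1)
    unfolding comp_cls[OF u(2) typed_idn] by (rule cls_eq, rule word_eq.Seq_idn, rule u(2))
next
  case (7 x X Y x' X' Y')
  then obtain u v where u: "x = cls u" "typed A B u X Y" "x' = cls v" "typed A B v X' Y'"
    by (metis hom_coproductE)
  then show ?case by (metis tensor_cls typed.Par hom_coproductI)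
next
  case (8 X Y)
  show ?case unfolding idn_cls
    by (metis tensor_cls typed_idn InA_tensor_eq A.idn_hom A.tensor_idn)
next
  case (9 x X Y y Z x' X' Y' y' Z')
  then obtain u v u' v' where uv: "x = cls u" "y = cls v" "x' = cls u'" "y' = cls v'"
    and t: "typed A B u X Y" "typed A B v Y Z" "typed A B u' X' Y'" "typed A B v' Y' Z'"
    by (metis hom_coproductE)
  have "(cls u \<Zsemi>\<^bsub>coproduct A B\<^esub> cls v) \<oplus>\<^bsub>coproduct A B\<^esub> (cls u' \<Zsemi>\<^bsub>coproduct A B\<^esub> cls v')
      = cls (Par (Seq u v) (Seq u' v'))"
    using t by (metis comp_cls tensor_cls typed.Seq)
  also have "\<dots> = cls (Seq (Par u u') (Par v v'))" using t by (intro cls_eq word_eq.Par_Seq)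
  also have "\<dots> = (cls u \<oplus>\<^bsub>coproduct A B\<^esub> cls u') \<Zsemi>\<^bsub>coproduct A B\<^esub> (cls v \<oplus>\<^bsub>coproduct A B\<^esub> cls v')"
    using t by (metis comp_cls tensor_cls typed.Par)
  finally show ?case by (simp only: uv)
next
  case (10 x X Y x' X' Y' x'' X'' Y'')
  then obtain u v w where uvw: "x = cls u" "x' = cls v" "x'' = cls w"
    and t: "typed A B u X Y" "typed A B v X' Y'" "typed A B w X'' Y''" by (metis hom_coproductE)
  have "cls u \<oplus>\<^bsub>coproduct A B\<^esub> cls v \<oplus>\<^bsub>coproduct A B\<^esub> cls w = cls (Par (Par u v) w)"
    using t by (metis tensor_cls typed.Par)
  also have "\<dots> = cls (Par u (Par v w))" using t by (intro cls_eq word_eq.Par_assoc)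
  also have "\<dots> = cls u \<oplus>\<^bsub>coproduct A B\<^esub> (cls v \<oplus>\<^bsub>coproduct A B\<^esub> cls w)"
    using t by (metis tensor_cls typed.Par)
  finally show ?case by (simp only: uvw)
next
  case (11 x X Y)
  from 11 obtain u where u: "x = cls u" "typed A B u X Y" by (rule hom_coproductE)
  show ?case unfolding idn_cls u(1)
    unfolding tensor_cls[OF typed_idn u(2)] by (rule cls_eq, rule word_eq.idn0_Par, rule u(2))
next
  case (12 x X Y)
  from 12 obtain u where u: "x = cls u" "typed A B u X Y" by (rule hom_coproductE)
  show ?case unfolding idn_cls u(1)
    unfolding tensor_cls[OF u(2) typed_idn] by (rule cls_eq, rule word_eq.Par_idn0, rule u(2))
next
  case (13 X Y)
  show ?case unfolding symm_cls by (intro hom_coproductI ty)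
next
  case (14 x X Y x' X' Y')
  then obtain u v where u: "x = cls u" "x' = cls v"
    and t: "typed A B u X Y" "typed A B v X' Y'"
    by (metis hom_coproductE)
  have "(cls u \<oplus>\<^bsub>coproduct A B\<^esub> cls v) \<Zsemi>\<^bsub>coproduct A B\<^esub> cls (InA (symm A Y Y'))
      = cls (Seq (Par u v) (InA (symm A Y Y')))"
    using t by (metis comp_cls tensor_cls typed.Par typed_symm)
  also have "\<dots> = cls (Seq (InA (symm A X X')) (Par v u))"
    using t by (intro cls_eq word_eq.symm_natural)
  also have "\<dots> = cls (InA (symm A X X')) \<Zsemi>\<^bsub>coproduct A B\<^esub> (cls v \<oplus>\<^bsub>coproduct A B\<^esub> cls u)"
    using t by (metis comp_cls tensor_cls typed.Par typed_symm)
  finally show ?case by (simp only: u symm_cls)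
next
  case (15 X Y)
  show ?case unfolding symm_cls idn_cls
    by (metis comp_cls typed_symm InA_comp_eq A.symm_hom A.symm_inverse)
next
  case (16 X Y Z)
  have h: "symm A X Y \<oplus>\<^bsub>A\<^esub> idn A Z \<in> hom A (X + Y + Z) (Y + X + Z)"
    "idn A Y \<oplus>\<^bsub>A\<^esub> symm A X Z \<in> hom A (Y + X + Z) (Y + Z + X)"
    using A.tensor_hom[OF A.symm_hom A.idn_hom] A.tensor_hom[OF A.idn_hom A.symm_hom]
    by (auto simp: add.assoc)
  have "cls (InA (symm A X Y)) \<oplus>\<^bsub>coproduct A B\<^esub> cls (InA (idn A Z)) = cls (InA (symm A X Y \<oplus>\<^bsub>A\<^esub> idn A Z))"
    by (metis tensor_cls typed_idn typed_symm InA_tensor_eq A.symm_hom A.idn_hom)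
  moreover have "cls (InA (idn A Y)) \<oplus>\<^bsub>coproduct A B\<^esub> cls (InA (symm A X Z)) = cls (InA (idn A Y \<oplus>\<^bsub>A\<^esub> symm A X Z))"
    by (metis tensor_cls typed_idn typed_symm InA_tensor_eq A.symm_hom A.idn_hom)
  moreover have "cls (InA (symm A X Y \<oplus>\<^bsub>A\<^esub> idn A Z)) \<Zsemi>\<^bsub>coproduct A B\<^esub> cls (InA (idn A Y \<oplus>\<^bsub>A\<^esub> symm A X Z))
      = cls (InA (symm A X (Y + Z)))"
    by (metis h comp_cls typed.InA InA_comp_eq A.symm_hexagon)
  ultimately show ?case unfolding symm_cls idn_cls by simp
qed

lemma prop_morphism_inj_A: "prop_morphism A (coproduct A B) (inj_A A B)"
  unfolding prop_morphism_def inj_A_def cls_def[symmetric] arrows_def symm_cls idn_cls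
proof (intro conjI allI ballI, goal_cases)
  case (1 X Y f) then show ?case by (intro hom_coproductI typed.InA)
next
  case (3 X Y Z f g) then show ?case by (metis comp_cls typed.InA InA_comp_eq)
next
  case (4 f g) then show ?case by (auto simp: tensor_cls[OF typed.InA typed.InA] InA_tensor_eq)
qed simp_all

lemma prop_morphism_inj_B: "prop_morphism B (coproduct A B) (inj_B A B)"
  unfolding prop_morphism_def inj_B_def cls_def[symmetric] arrows_def symm_cls idn_cls
proof (intro conjI allI ballI, goal_cases)
  case (1 X Y f) then show ?case by (intro hom_coproductI typed.InB)
next
  case (2 X) then show ?case by (intro cls_eq word_eq.sym[OF word_eq.idn])
next
  case (3 X Y Z f g) then show ?case by (metis comp_cls typed.InB InB_comp_eq)
next
  case (4 f g) then show ?case by (auto simp: tensor_cls[OF typed.InB typed.InB] InB_tensor_eq)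
next
  case (5 X) then show ?case by (intro cls_eq word_eq.sym[OF word_eq.symm])
qed

context
  fixes D :: "'d prop_data" and F G
  assumes D: "is_prop D" and F: "prop_morphism A D F" and G: "prop_morphism B D G"
begin

interpretation D: is_prop D by (rule D)

lemmas F_hom = prop_morphismD(1)[OF F]
  and F_idn = prop_morphismD(2)[OF F]
  and F_comp = prop_morphismD(3)[OF F]
  and F_tensor = prop_morphismD(4)[OF F]
  and F_symm = prop_morphismD(5)[OF F]

lemmas G_hom = prop_morphismD(1)[OF G]
  and G_idn = prop_morphismD(2)[OF G]
  and G_comp = prop_morphismD(3)[OF G]
  and G_tensor = prop_morphismD(4)[OF G]
  and G_symm = prop_morphismD(5)[OF G]

lemma eval_hom: "typed A B u X Y \<Longrightarrow> word_eval D F G u \<in> hom D X Y"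
  by (induction rule: typed.induct) (auto intro: F_hom G_hom D.comp_hom D.tensor_hom)

lemma eval_eq: "word_eq A B u v \<Longrightarrow> word_eval D F G u = word_eval D F G v"
proof (induction rule: word_eq.induct)
  case (InA_comp a X Y a' Z) then show ?case by (simp add: F_comp)
next
  case (InA_tensor a X Y a' X' Y') then show ?case by (simp add: F_tensor)
next
  case (InB_comp a X Y a' Z) then show ?case by (simp add: G_comp)
next
  case (InB_tensor a X Y a' X' Y') then show ?case by (simp add: G_tensor)
next
  case (Seq_assoc u W X v Y w Z) then show ?case by (simp add: D.comp_assoc[OF eval_hom eval_hom eval_hom])
next
  case (idn_Seq u X Y) then show ?case by (simp add: F_idn D.idn_comp[OF eval_hom])
next
  case (Seq_idn u X Y) then show ?case by (simp add: F_idn D.comp_idn[OF eval_hom])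
next
  case (Par_Seq u X Y v Z u' X' Y' v' Z')
  then show ?case by (simp add: D.tensor_comp[OF eval_hom eval_hom eval_hom eval_hom])
next
  case (Par_assoc u X Y u' X' Y' u'' X'' Y'')
  then show ?case by (simp add: D.tensor_assoc[OF eval_hom eval_hom eval_hom])
next
  case (idn0_Par u X Y) then show ?case by (simp add: F_idn D.idn0_tensor[OF eval_hom])
next
  case (Par_idn0 u X Y) then show ?case by (simp add: F_idn D.tensor_idn0[OF eval_hom])
next
  case (symm_natural u X Y u' X' Y')
  then show ?case by (simp add: F_symm D.symm_natural[OF eval_hom eval_hom])
qed (simp_all add: F_idn G_idn F_symm G_symm)

lemma copair_cls: "typed A B u X Y \<Longrightarrow> copair D F G (cls u) = word_eval D F G u"
proof -
  assume "typed A B u X Y"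
  then have "u \<in> cls u" by (simp add: word_eq.refl)
  moreover have "word_eval D F G v = word_eval D F G u" if "v \<in> cls u" for v
    using that by (simp add: eval_eq)
  ultimately have "word_eval D F G ` cls u = {word_eval D F G u}" by blast
  then show ?thesis by (simp add: copair_def)
qed

lemma prop_morphism_copair: "prop_morphism (coproduct A B) D (copair D F G)"
  unfolding prop_morphism_def
proof (intro conjI allI ballI, goal_cases)
  case (1 X Y f) then show ?case by (metis hom_coproductE copair_cls eval_hom)
next
  case (2 X) then show ?case unfolding idn_cls by (simp only: copair_cls[OF typed_idn] word_eval.simps F_idn)
next
  case (3 X Y Z f g)
  then obtain u v where "f = cls u" "typed A B u X Y" "g = cls v" "typed A B v Y Z"
    by (metis hom_coproductE)
  then show ?case by (metis comp_cls copair_cls typed.Seq word_eval.simps(3))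
next
  case (4 f g)
  then obtain u v X Y X' Y' where "f = cls u" "typed A B u X Y" "g = cls v" "typed A B v X' Y'"
    unfolding arrows_def by (auto elim!: hom_coproductE)
  then show ?case by (metis tensor_cls copair_cls typed.Par word_eval.simps(4))
next
  case (5 X Y) then show ?case unfolding symm_cls by (simp only: copair_cls[OF typed_symm] word_eval.simps F_symm)
qed

lemma copair_inj_A: "a \<in> arrows A \<Longrightarrow> copair D F G (inj_A A B a) = F a"
  unfolding arrows_def inj_A_def cls_def[symmetric] by (auto simp: copair_cls[OF typed.InA])

lemma copair_inj_B: "b \<in> arrows B \<Longrightarrow> copair D F G (inj_B A B b) = G b"
  unfolding arrows_def inj_B_def cls_def[symmetric] by (auto simp: copair_cls[OF typed.InB])

lemma copair_unique:
  assumes W: "prop_morphism (coproduct A B) D W"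
    and WA: "\<And>a. a \<in> arrows A \<Longrightarrow> W (inj_A A B a) = F a"
    and WB: "\<And>b. b \<in> arrows B \<Longrightarrow> W (inj_B A B b) = G b"
    and x: "x \<in> arrows (coproduct A B)"
  shows "W x = copair D F G x"
proof -
  have "W (cls u) = word_eval D F G u" if "typed A B u X Y" for u X Y
    using that
  proof (induction rule: typed.induct)
    case (InA a X Y) then show ?case using WA[of a] by (auto simp: inj_A_def arrows_def cls_def)
  next
    case (InB b X Y) then show ?case using WB[of b] by (auto simp: inj_B_def arrows_def cls_def)
  next
    case (Seq u X Y v Z)
    then have "W (cls u \<Zsemi>\<^bsub>coproduct A B\<^esub> cls v) = W (cls u) \<Zsemi>\<^bsub>D\<^esub> W (cls v)"
      by (intro prop_morphismD(3)[OF W] hom_coproductI)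
    with Seq show ?case by (metis comp_cls word_eval.simps(3))
  next
    case (Par u X Y v X' Y')
    then have "W (cls u \<oplus>\<^bsub>coproduct A B\<^esub> cls v) = W (cls u) \<oplus>\<^bsub>D\<^esub> W (cls v)"
      by (intro prop_morphismD(4)[OF W] hom_coproductI)
    with Par show ?case by (metis tensor_cls word_eval.simps(4))
  qed
  with x show ?thesis unfolding arrows_def by (auto elim!: hom_coproductE simp: copair_cls)
qed

end

end

theorem coproduct_universal:
  assumes "is_prop A" and "is_prop B"
  shows "is_PROP_coproduct TYPE('d) A B (coproduct A B) (inj_A A B) (inj_B A B)"
proof -
  interpret two_props A B using assms by (simp add: two_props_def)
  show ?thesis
    unfolding is_PROP_coproduct_def
  proof (intro conjI allI impI assms is_prop_coproduct prop_morphism_inj_A prop_morphism_inj_B)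
    fix D :: "'d prop_data" and F G
    assume "is_prop D \<and> prop_morphism A D F \<and> prop_morphism B D G"
    then have D: "is_prop D" and F: "prop_morphism A D F" and G: "prop_morphism B D G" by auto
    note hyps = D F G
    show "\<exists>W. prop_morphism (coproduct A B) D W \<and>
             (\<forall>a \<in> arrows A. W (inj_A A B a) = F a) \<and> (\<forall>b \<in> arrows B. W (inj_B A B b) = G b) \<and>
             (\<forall>W'. prop_morphism (coproduct A B) D W' \<and>
                   (\<forall>a \<in> arrows A. W' (inj_A A B a) = F a) \<and> (\<forall>b \<in> arrows B. W' (inj_B A B b) = G b) \<longrightarrow>
                   (\<forall>x \<in> arrows (coproduct A B). W' x = W x))"
      using prop_morphism_copair[OF hyps] copair_inj_A[OF hyps] copair_inj_B[OF hyps]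
        copair_unique[OF hyps]
      by (intro exI[of _ "copair D F G"] conjI ballI allI impI) blast+
  qed
qed


section \<open>Categorical notions inside a prop\<close>

definition isos :: "'a prop_data \<Rightarrow> 'a set" where
  "isos C = {i. \<exists>X Y. i \<in> hom C X Y \<and>
     (\<exists>j \<in> hom C Y X. i \<Zsemi>\<^bsub>C\<^esub> j = idn C X \<and> j \<Zsemi>\<^bsub>C\<^esub> i = idn C Y)}"

definition is_mono :: "'a prop_data \<Rightarrow> 'a \<Rightarrow> bool" where
  "is_mono C m \<longleftrightarrow> (\<exists>X Y. m \<in> hom C X Y \<and>
     (\<forall>W. \<forall>f \<in> hom C W X. \<forall>g \<in> hom C W X. f \<Zsemi>\<^bsub>C\<^esub> m = g \<Zsemi>\<^bsub>C\<^esub> m \<longrightarrow> f = g))"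

text \<open>
  \<open>is_pushout C f g p q\<close>: the cospan \<open>N \<rightarrow>\<^sub>p P \<leftarrow>\<^sub>q M\<close> is a pushout of the span
  \<open>N \<leftarrow>\<^sub>f Y \<rightarrow>\<^sub>g M\<close>, so \<open>p\<close> is opposite to \<open>g\<close> and \<open>q\<close> is opposite to \<open>f\<close>.
  Dually, \<open>is_pullback C f g p q\<close>: the span \<open>(p, q)\<close> is a pullback of the cospan \<open>(f, g)\<close>.
\<close>

definition is_pushout :: "'a prop_data \<Rightarrow> 'a \<Rightarrow> 'a \<Rightarrow> 'a \<Rightarrow> 'a \<Rightarrow> bool" where
  "is_pushout C f g p q \<longleftrightarrow> (\<exists>Y N M P.
     f \<in> hom C Y N \<and> g \<in> hom C Y M \<and> p \<in> hom C N P \<and> q \<in> hom C M P \<and>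
     f \<Zsemi>\<^bsub>C\<^esub> p = g \<Zsemi>\<^bsub>C\<^esub> q \<and>
     (\<forall>Q. \<forall>u \<in> hom C N Q. \<forall>v \<in> hom C M Q. f \<Zsemi>\<^bsub>C\<^esub> u = g \<Zsemi>\<^bsub>C\<^esub> v \<longrightarrow>
        (\<exists>!w. w \<in> hom C P Q \<and> p \<Zsemi>\<^bsub>C\<^esub> w = u \<and> q \<Zsemi>\<^bsub>C\<^esub> w = v)))"

definition is_pullback :: "'a prop_data \<Rightarrow> 'a \<Rightarrow> 'a \<Rightarrow> 'a \<Rightarrow> 'a \<Rightarrow> bool" where
  "is_pullback C f g p q \<longleftrightarrow> (\<exists>Z N M P.
     f \<in> hom C N Z \<and> g \<in> hom C M Z \<and> p \<in> hom C P N \<and> q \<in> hom C P M \<and>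
     p \<Zsemi>\<^bsub>C\<^esub> f = q \<Zsemi>\<^bsub>C\<^esub> g \<and>
     (\<forall>Q. \<forall>u \<in> hom C Q N. \<forall>v \<in> hom C Q M. u \<Zsemi>\<^bsub>C\<^esub> f = v \<Zsemi>\<^bsub>C\<^esub> g \<longrightarrow>
        (\<exists>!w. w \<in> hom C Q P \<and> w \<Zsemi>\<^bsub>C\<^esub> p = u \<and> w \<Zsemi>\<^bsub>C\<^esub> q = v)))"

definition has_pushouts :: "'a prop_data \<Rightarrow> bool" where
  "has_pushouts C \<longleftrightarrow>
     (\<forall>Y N M. \<forall>f \<in> hom C Y N. \<forall>g \<in> hom C Y M. \<exists>p q. is_pushout C f g p q)"

definition has_pullbacks :: "'a prop_data \<Rightarrow> bool" where
  "has_pullbacks C \<longleftrightarrow>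
     (\<forall>Z N M. \<forall>f \<in> hom C N Z. \<forall>g \<in> hom C M Z. \<exists>p q. is_pullback C f g p q)"

definition stable_under_pushout :: "'a prop_data \<Rightarrow> 'a set \<Rightarrow> bool" where
  "stable_under_pushout C S \<longleftrightarrow>
     (\<forall>f g p q. is_pushout C f g p q \<longrightarrow> (f \<in> S \<longrightarrow> q \<in> S) \<and> (g \<in> S \<longrightarrow> p \<in> S))"

definition stable_under_pullback :: "'a prop_data \<Rightarrow> 'a set \<Rightarrow> bool" where
  "stable_under_pullback C S \<longleftrightarrow>
     (\<forall>f g p q. is_pullback C f g p q \<longrightarrow> (f \<in> S \<longrightarrow> q \<in> S) \<and> (g \<in> S \<longrightarrow> p \<in> S))"

definition subcategory_with_isos :: "'a prop_data \<Rightarrow> 'a set \<Rightarrow> bool" where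
  "subcategory_with_isos C S \<longleftrightarrow> S \<subseteq> arrows C \<and> isos C \<subseteq> S \<and>
     (\<forall>X Y Z. \<forall>f \<in> hom C X Y \<inter> S. \<forall>g \<in> hom C Y Z \<inter> S. f \<Zsemi>\<^bsub>C\<^esub> g \<in> S)"

definition factorisation_system :: "'a prop_data \<Rightarrow> 'a set \<Rightarrow> 'a set \<Rightarrow> bool" where
  "factorisation_system C E M \<longleftrightarrow>
     subcategory_with_isos C E \<and> subcategory_with_isos C M \<and>
     (\<forall>X Y. \<forall>f \<in> hom C X Y.
        \<exists>N. \<exists>e \<in> hom C X N \<inter> E. \<exists>m \<in> hom C N Y \<inter> M. f = e \<Zsemi>\<^bsub>C\<^esub> m) \<and>
     (\<forall>X X' Y Y'. \<forall>e \<in> hom C X X' \<inter> E. \<forall>m \<in> hom C Y Y' \<inter> M.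
        \<forall>u \<in> hom C X Y. \<forall>v \<in> hom C X' Y'. u \<Zsemi>\<^bsub>C\<^esub> m = e \<Zsemi>\<^bsub>C\<^esub> v \<longrightarrow>
          (\<exists>!d. d \<in> hom C X' Y \<and> e \<Zsemi>\<^bsub>C\<^esub> d = u \<and> d \<Zsemi>\<^bsub>C\<^esub> m = v))"

definition tensor_preserves_pushouts :: "'a prop_data \<Rightarrow> bool" where
  "tensor_preserves_pushouts C \<longleftrightarrow>
     (\<forall>f g p q f' g' p' q'. is_pushout C f g p q \<and> is_pushout C f' g' p' q' \<longrightarrow>
        is_pushout C (f \<oplus>\<^bsub>C\<^esub> f') (g \<oplus>\<^bsub>C\<^esub> g') (p \<oplus>\<^bsub>C\<^esub> p') (q \<oplus>\<^bsub>C\<^esub> q'))"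

definition tensor_preserves_pullbacks_in :: "'a prop_data \<Rightarrow> 'a set \<Rightarrow> bool" where
  "tensor_preserves_pullbacks_in C A \<longleftrightarrow>
     (\<forall>f \<in> A. \<forall>g \<in> A. \<forall>f' \<in> A. \<forall>g' \<in> A. \<forall>p q p' q'.
        is_pullback C f g p q \<and> is_pullback C f' g' p' q' \<longrightarrow>
        is_pullback C (f \<oplus>\<^bsub>C\<^esub> f') (g \<oplus>\<^bsub>C\<^esub> g') (p \<oplus>\<^bsub>C\<^esub> p') (q \<oplus>\<^bsub>C\<^esub> q'))"


section \<open>Cospans, corelations and spans\<close>

text \<open>A pair \<open>(f, g)\<close> in \<open>cospans C X Y\<close> is the cospan \<open>X \<rightarrow>\<^sub>f N \<leftarrow>\<^sub>g Y\<close>.\<close>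

definition cospans :: "'a prop_data \<Rightarrow> nat \<Rightarrow> nat \<Rightarrow> ('a \<times> 'a) set" where
  "cospans C X Y = (\<Union>N. hom C X N \<times> hom C Y N)"

definition cospan_map :: "'a prop_data \<Rightarrow> 'a set \<Rightarrow> 'a \<times> 'a \<Rightarrow> 'a \<times> 'a \<Rightarrow> bool" where
  "cospan_map C S = (\<lambda>(f, g) (f', g'). \<exists>X Y N N'. f \<in> hom C X N \<and> g \<in> hom C Y N \<and>
     (\<exists>m \<in> hom C N N' \<inter> S. f \<Zsemi>\<^bsub>C\<^esub> m = f' \<and> g \<Zsemi>\<^bsub>C\<^esub> m = g'))"

definition cospan_iso :: "'a prop_data \<Rightarrow> (('a \<times> 'a) \<times> ('a \<times> 'a)) set" where
  "cospan_iso C = {(c, c'). cospan_map C (isos C) c c'}"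

definition corel_equiv :: "'a prop_data \<Rightarrow> 'a set \<Rightarrow> (('a \<times> 'a) \<times> ('a \<times> 'a)) set" where
  "corel_equiv C M = {(c, c'). equivclp (cospan_map C M) c c'}"

text \<open>
  Cospans modulo \<open>r\<close>, composed by pushout and tensored legwise.  An operation on classes is the
  union of the classes of all results on representatives; this is a single class exactly when the
  operation is well defined, and no choice of pushouts is involved.
\<close>

definition cospan_quotient ::
    "'a prop_data \<Rightarrow> (('a \<times> 'a) \<times> ('a \<times> 'a)) set \<Rightarrow> ('a \<times> 'a) set prop_data" where
  "cospan_quotient C r =
     \<lparr>hom = \<lambda>X Y. cospans C X Y // r,
      cmp = \<lambda>a b. r `` {(f \<Zsemi>\<^bsub>C\<^esub> p, k \<Zsemi>\<^bsub>C\<^esub> q) | f g h k p q.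
                          (f, g) \<in> a \<and> (h, k) \<in> b \<and> is_pushout C g h p q},
      idn = \<lambda>X. r `` {(idn C X, idn C X)},
      tensor = \<lambda>a b. r `` {(f \<oplus>\<^bsub>C\<^esub> f', g \<oplus>\<^bsub>C\<^esub> g') | f g f' g'. (f, g) \<in> a \<and> (f', g') \<in> b},
      symm = \<lambda>X Y. r `` {(symm C X Y, idn C (Y + X))}\<rparr>"

definition Cospan :: "'a prop_data \<Rightarrow> ('a \<times> 'a) set prop_data" where
  "Cospan C = cospan_quotient C (cospan_iso C)"

definition Corel :: "'a prop_data \<Rightarrow> 'a set \<Rightarrow> ('a \<times> 'a) set prop_data" where
  "Corel C M = cospan_quotient C (corel_equiv C M)"

text \<open>A pair \<open>(f, g)\<close> in \<open>spans C A X Y\<close> is the span \<open>X \<leftarrow>\<^sub>f N \<rightarrow>\<^sub>g Y\<close>.\<close>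

definition spans :: "'a prop_data \<Rightarrow> 'a set \<Rightarrow> nat \<Rightarrow> nat \<Rightarrow> ('a \<times> 'a) set" where
  "spans C A X Y = (\<Union>N. (hom C N X \<inter> A) \<times> (hom C N Y \<inter> A))"

definition span_iso :: "'a prop_data \<Rightarrow> 'a set \<Rightarrow> (('a \<times> 'a) \<times> ('a \<times> 'a)) set" where
  "span_iso C A = {((f, g), (f', g')). f \<in> A \<and> g \<in> A \<and> f' \<in> A \<and> g' \<in> A \<and>
     (\<exists>X Y N N'. f' \<in> hom C N' X \<and> g' \<in> hom C N' Y \<and>
       (\<exists>i \<in> hom C N N' \<inter> isos C. i \<Zsemi>\<^bsub>C\<^esub> f' = f \<and> i \<Zsemi>\<^bsub>C\<^esub> g' = g))}"

definition Span :: "'a prop_data \<Rightarrow> 'a set \<Rightarrow> ('a \<times> 'a) set prop_data" where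
  "Span C A =
     \<lparr>hom = \<lambda>X Y. spans C A X Y // span_iso C A,
      cmp = \<lambda>a b. span_iso C A `` {(p \<Zsemi>\<^bsub>C\<^esub> f, q \<Zsemi>\<^bsub>C\<^esub> k) | f g h k p q.
                          (f, g) \<in> a \<and> (h, k) \<in> b \<and> is_pullback C g h p q},
      idn = \<lambda>X. span_iso C A `` {(idn C X, idn C X)},
      tensor = \<lambda>a b. span_iso C A `` {(f \<oplus>\<^bsub>C\<^esub> f', g \<oplus>\<^bsub>C\<^esub> g') | f g f' g'. (f, g) \<in> a \<and> (f', g') \<in> b},
      symm = \<lambda>X Y. span_iso C A `` {(idn C (X + Y), symm C X Y)}\<rparr>"

text \<open>
  An arrow \<open>X \<rightarrow> Y\<close> of the opposite of \<open>A\<close> is an arrow \<open>g: Y \<rightarrow> X\<close> of \<open>A\<close>; it goes to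
  the cospan \<open>X \<rightarrow> X \<leftarrow>\<^sub>g Y\<close> and to the span \<open>X \<leftarrow>\<^sub>g Y \<rightarrow> Y\<close>.
\<close>

definition A_plus_Aop :: "'a prop_data \<Rightarrow> 'a set \<Rightarrow> ('a, 'a) word set prop_data" where
  "A_plus_Aop C A = coproduct (restrict_prop C A) (opposite (restrict_prop C A))"

definition to_Cospan :: "'a prop_data \<Rightarrow> ('a, 'a) word set \<Rightarrow> ('a \<times> 'a) set" where
  "to_Cospan C = copair (Cospan C)
     (\<lambda>f. cospan_iso C `` {(f, idn C (cod_of C f))})
     (\<lambda>g. cospan_iso C `` {(idn C (cod_of C g), g)})"

definition to_Span :: "'a prop_data \<Rightarrow> 'a set \<Rightarrow> ('a, 'a) word set \<Rightarrow> ('a \<times> 'a) set" where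
  "to_Span C A = copair (Span C A)
     (\<lambda>f. span_iso C A `` {(idn C (dom_of C f), f)})
     (\<lambda>g. span_iso C A `` {(g, idn C (dom_of C g))})"

definition Gamma_functor :: "'a prop_data \<Rightarrow> 'a set \<Rightarrow> ('a \<times> 'a) set \<Rightarrow> ('a \<times> 'a) set" where
  "Gamma_functor C M c = corel_equiv C M `` c"

definition Pi_functor :: "'a prop_data \<Rightarrow> 'a set \<Rightarrow> ('a \<times> 'a) set \<Rightarrow> ('a \<times> 'a) set" where
  "Pi_functor C M s = corel_equiv C M `` {(p, q) | p q f g. (f, g) \<in> s \<and> is_pushout C f g p q}"

end

theory Submission
  imports Defs
begin

text \<open>
  Write \<open>[f, g]\<close> for the class of a cospan or of a span.  The functor \<open>V\<close> out of
  \<open>Cospan C\<close> given by a cocone factors through \<open>\<Gamma>\<close>: as \<open>m \<in> M\<close> is a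
  monomorphism, its kernel pair is trivial, so \<open>[id, m] ; [m, id]\<close> is an identity in
  \<open>Span A\<close>, and \<open>V\<close> sends the cospan \<open>[m, m] = [m, id] ; [id, m]\<close> to an identity.
  Fullness of \<open>\<Gamma>\<close> makes the factorisation unique, and \<open>\<Pi> [f, g] = [id, f] ; [g, id]\<close>
  makes it compatible with \<open>\<Pi>\<close>.  That \<open>\<Pi>\<close> preserves composition is the identity
  \<open>[id, p] ; [q, id] = [g, id] ; [id, h]\<close> in \<open>Corel C\<close> for a pullback \<open>(p, q)\<close> of
  \<open>(g, h)\<close>: both sides are related by the comparison map, which lies in \<open>M\<close>.  Spans are cospans in
  the opposite prop, so all the prop laws are those of cospans with legs in a sub-prop, modulo a
  congruence.
\<close>

section \<open>Isomorphisms and pushouts in a prop\<close>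

text \<open>Composition and tensor in the quotients collect the results on all representatives and
  for all pushouts, so an operation is well defined once all these results are related. The relation
  for corelations is generated: it is a zigzag of maps in \<open>M\<close>, and an operation can
  only be followed along it one step at a time. Costability lets a step survive composition, because
  the pushout of a map in \<open>M\<close> is again in \<open>M\<close>; closure under
  \<open>\<oplus>\<close> does the same for the tensor. Isomorphism of cospans is the same
  construction with the isomorphisms in place of \<open>M\<close>, so a single congruence argument
  serves all three props. Spans impose one more constraint: their legs stay in \<open>A\<close>
  although the pullbacks are those of \<open>C\<close>, and only pullbacks of cospans in
  \<open>A\<close> are known to be preserved by \<open>\<oplus>\<close>. Hence the class
  \<open>L\<close> of admissible legs, and pushout axioms that speak only of such legs. For
  calculation, every cospan is a forward arrow followed by a backward one, and a genuine pushout is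
  needed only where a backward arrow meets a forward one.\<close>

context is_prop
begin

lemma cod_of_eq: "f \<in> hom P X Y \<Longrightarrow> cod_of P f = Y"
  and dom_of_eq: "f \<in> hom P X Y \<Longrightarrow> dom_of P f = X"
  unfolding cod_of_def dom_of_def using hom_disjoint by blast+

section \<open>Closure properties of isomorphisms\<close>

lemma isosE:
  assumes "i \<in> isos P" and "i \<in> hom P X Y"
  obtains j where "j \<in> hom P Y X" "i \<Zsemi> j = idn P X" "j \<Zsemi> i = idn P Y" "j \<in> isos P"
proof -
  from assms(1) obtain X' Y' j where j: "i \<in> hom P X' Y'" "j \<in> hom P Y' X'"
    "i \<Zsemi> j = idn P X'" "j \<Zsemi> i = idn P Y'"
    unfolding isos_def by blast
  have "X' = X" "Y' = Y" using hom_disjoint[OF j(1) assms(2)] by auto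
  with j that show thesis unfolding isos_def by blast
qed

lemma isosI:
  "i \<in> hom P X Y \<Longrightarrow> j \<in> hom P Y X \<Longrightarrow> i \<Zsemi> j = idn P X \<Longrightarrow> j \<Zsemi> i = idn P Y \<Longrightarrow> i \<in> isos P"
  unfolding isos_def by blast

lemma isos_idn: "idn P X \<in> isos P"
  by (rule isosI[of _ X X "idn P X"]) (auto intro: idn_hom idn_comp)

lemma isos_symm: "symm P X Y \<in> isos P"
  using symm_inverse[of X Y] symm_inverse[of Y X]
  by (intro isosI[of _ "X + Y" "Y + X" "symm P Y X"] symm_hom) auto

lemma isos_tensor:
  assumes "i \<in> isos P" "i \<in> hom P X Y" "i' \<in> isos P" "i' \<in> hom P X' Y'"
  shows "i \<oplus> i' \<in> isos P"
proof -
  obtain j where j: "j \<in> hom P Y X" "i \<Zsemi> j = idn P X" "j \<Zsemi> i = idn P Y"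
    using assms(1,2) by (rule isosE)
  obtain j' where j': "j' \<in> hom P Y' X'" "i' \<Zsemi> j' = idn P X'" "j' \<Zsemi> i' = idn P Y'"
    using assms(3,4) by (rule isosE)
  show ?thesis
  proof (rule isosI)
    show "i \<oplus> i' \<in> hom P (X + X') (Y + Y')" "j \<oplus> j' \<in> hom P (Y + Y') (X + X')"
      using assms j j' by (auto intro: tensor_hom)
    show "(i \<oplus> i') \<Zsemi> (j \<oplus> j') = idn P (X + X')"
      using tensor_comp[OF assms(2) j(1) assms(4) j'(1)] j j' by (simp add: tensor_idn)
    show "(j \<oplus> j') \<Zsemi> (i \<oplus> i') = idn P (Y + Y')"
      using tensor_comp[OF j(1) assms(2) j'(1) assms(4)] j j' by (simp add: tensor_idn)
  qed
qed

lemma isos_comp: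
  assumes i: "i \<in> isos P" "i \<in> hom P X Y" and i': "i' \<in> isos P" "i' \<in> hom P Y Z"
  shows "i \<Zsemi> i' \<in> isos P"
proof -
  obtain j where j: "j \<in> hom P Y X" "i \<Zsemi> j = idn P X" "j \<Zsemi> i = idn P Y" using i by (rule isosE)
  obtain j' where j': "j' \<in> hom P Z Y" "i' \<Zsemi> j' = idn P Y" "j' \<Zsemi> i' = idn P Z" using i' by (rule isosE)
  show ?thesis
  proof (rule isosI)
    show "i \<Zsemi> i' \<in> hom P X Z" "j' \<Zsemi> j \<in> hom P Z X" using i i' j j' by (auto intro: comp_hom)
    have "i \<Zsemi> i' \<Zsemi> (j' \<Zsemi> j) = i \<Zsemi> (i' \<Zsemi> j' \<Zsemi> j)"
      by (simp only: comp_assoc[OF i(2) i'(2) comp_hom[OF j'(1) j(1)]] comp_assoc[OF i'(2) j'(1) j(1)])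
    then show "i \<Zsemi> i' \<Zsemi> (j' \<Zsemi> j) = idn P X" by (simp only: idn_comp[OF j(1)] j j')
    have "j' \<Zsemi> j \<Zsemi> (i \<Zsemi> i') = j' \<Zsemi> (j \<Zsemi> i \<Zsemi> i')"
      by (simp only: comp_assoc[OF j'(1) j(1) comp_hom[OF i(2) i'(2)]] comp_assoc[OF j(1) i(2) i'(2)])
    then show "j' \<Zsemi> j \<Zsemi> (i \<Zsemi> i') = idn P Z" by (simp only: idn_comp[OF i'(2)] j j')
  qed
qed

section \<open>Pushout squares: typing, mediating maps, pasting and uniqueness\<close>

lemma pushoutE:
  assumes "is_pushout P f g p q"
  obtains Y N M Q where "f \<in> hom P Y N" "g \<in> hom P Y M" "p \<in> hom P N Q" "q \<in> hom P M Q"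
    "f \<Zsemi> p = g \<Zsemi> q"
    "\<And>R u v. u \<in> hom P N R \<Longrightarrow> v \<in> hom P M R \<Longrightarrow> f \<Zsemi> u = g \<Zsemi> v
        \<Longrightarrow> \<exists>!w. w \<in> hom P Q R \<and> p \<Zsemi> w = u \<and> q \<Zsemi> w = v"
  using assms unfolding is_pushout_def by (elim exE conjE) (rule that; blast)

lemma pushout_typing:
  assumes "is_pushout P f g p q"
  obtains Y N M Q where "f \<in> hom P Y N" "g \<in> hom P Y M" "p \<in> hom P N Q" "q \<in> hom P M Q"
    "f \<Zsemi> p = g \<Zsemi> q"
  using assms unfolding is_pushout_def by blast

lemma pushoutI:
  assumes "f \<in> hom P Y N" "g \<in> hom P Y M" "p \<in> hom P N Q" "q \<in> hom P M Q" "f \<Zsemi> p = g \<Zsemi> q"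
    and "\<And>R u v. u \<in> hom P N R \<Longrightarrow> v \<in> hom P M R \<Longrightarrow> f \<Zsemi> u = g \<Zsemi> v
        \<Longrightarrow> \<exists>w. w \<in> hom P Q R \<and> p \<Zsemi> w = u \<and> q \<Zsemi> w = v"
    and "\<And>R w w'. w \<in> hom P Q R \<Longrightarrow> w' \<in> hom P Q R \<Longrightarrow> p \<Zsemi> w = p \<Zsemi> w' \<Longrightarrow> q \<Zsemi> w = q \<Zsemi> w'
        \<Longrightarrow> w = w'"
  shows "is_pushout P f g p q"
proof -
  have "\<exists>!w. w \<in> hom P Q R \<and> p \<Zsemi> w = u \<and> q \<Zsemi> w = v"
    if uv: "u \<in> hom P N R" "v \<in> hom P M R" "f \<Zsemi> u = g \<Zsemi> v" for R u v
  proof (rule ex_ex1I)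
    show "\<exists>w. w \<in> hom P Q R \<and> p \<Zsemi> w = u \<and> q \<Zsemi> w = v" using uv by (rule assms(6))
    fix w w'
    assume "w \<in> hom P Q R \<and> p \<Zsemi> w = u \<and> q \<Zsemi> w = v" "w' \<in> hom P Q R \<and> p \<Zsemi> w' = u \<and> q \<Zsemi> w' = v"
    then show "w = w'" by (intro assms(7)[of w R w']) simp_all
  qed
  with assms(1-5) show ?thesis unfolding is_pushout_def by blast
qed

text \<open>The objects of a square are existentially bound in \<open>is_pushout\<close>, so every
  use yields fresh ones; \<open>hom_disjoint\<close> identifies them with those already known for
  the span.\<close>

lemma pushout_hom:
  assumes "is_pushout P f g p q" and "f \<in> hom P Y N" and "g \<in> hom P Y' M"
  obtains Q where "Y' = Y" "p \<in> hom P N Q" "q \<in> hom P M Q" "f \<Zsemi> p = g \<Zsemi> q"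
proof -
  from assms(1) obtain Y1 N1 M1 Q where h: "f \<in> hom P Y1 N1" "g \<in> hom P Y1 M1"
    "p \<in> hom P N1 Q" "q \<in> hom P M1 Q" "f \<Zsemi> p = g \<Zsemi> q"
    by (rule pushout_typing)
  with hom_disjoint[OF h(1) assms(2)] hom_disjoint[OF h(2) assms(3)] show thesis
    by (intro that) auto
qed

text \<open>Counterpart of \<open>pushout_hom\<close> in which the cospan, not the span, fixes the
  objects.\<close>

lemma pushout_univ:
  assumes "is_pushout P f g p q" and pq: "p \<in> hom P N Q" "q \<in> hom P M Q"
  obtains Y where "f \<in> hom P Y N" "g \<in> hom P Y M" "f \<Zsemi> p = g \<Zsemi> q"
    "\<And>R u v. u \<in> hom P N R \<Longrightarrow> v \<in> hom P M R \<Longrightarrow> f \<Zsemi> u = g \<Zsemi> v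
        \<Longrightarrow> \<exists>!w. w \<in> hom P Q R \<and> p \<Zsemi> w = u \<and> q \<Zsemi> w = v"
proof -
  from assms(1) obtain Y N1 M1 Q1 where h: "f \<in> hom P Y N1" "g \<in> hom P Y M1"
    "p \<in> hom P N1 Q1" "q \<in> hom P M1 Q1" "f \<Zsemi> p = g \<Zsemi> q"
    "\<And>R u v. u \<in> hom P N1 R \<Longrightarrow> v \<in> hom P M1 R \<Longrightarrow> f \<Zsemi> u = g \<Zsemi> v
        \<Longrightarrow> \<exists>!w. w \<in> hom P Q1 R \<and> p \<Zsemi> w = u \<and> q \<Zsemi> w = v"
    by (rule pushoutE) (rule that)
  have "N1 = N" "M1 = M" "Q1 = Q" using hom_disjoint[OF h(3) pq(1)] hom_disjoint[OF h(4) pq(2)] by auto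
  with h that show thesis by blast
qed

lemma pushout_lift:
  assumes "is_pushout P f g p q" and "p \<in> hom P N Q" and "q \<in> hom P M Q"
    and "u \<in> hom P N R" and "v \<in> hom P M R" and "f \<Zsemi> u = g \<Zsemi> v"
  obtains w where "w \<in> hom P Q R" "p \<Zsemi> w = u" "q \<Zsemi> w = v"
proof -
  have "\<exists>!w. w \<in> hom P Q R \<and> p \<Zsemi> w = u \<and> q \<Zsemi> w = v"
    using assms(1-3) by (rule pushout_univ) (use assms(4-6) in blast)
  with that show thesis by blast
qed

lemma pushout_joint_epi:
  assumes po: "is_pushout P f g p q" and pq: "p \<in> hom P N Q" "q \<in> hom P M Q"
    and w: "w \<in> hom P Q R" "w' \<in> hom P Q R" "p \<Zsemi> w = p \<Zsemi> w'" "q \<Zsemi> w = q \<Zsemi> w'"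
  shows "w = w'"
proof -
  from po pq obtain Y where h: "f \<in> hom P Y N" "g \<in> hom P Y M" and eq: "f \<Zsemi> p = g \<Zsemi> q"
    and univ: "\<And>R u v. u \<in> hom P N R \<Longrightarrow> v \<in> hom P M R \<Longrightarrow> f \<Zsemi> u = g \<Zsemi> v
        \<Longrightarrow> \<exists>!w. w \<in> hom P Q R \<and> p \<Zsemi> w = u \<and> q \<Zsemi> w = v"
    by (rule pushout_univ) (rule that)
  have "f \<Zsemi> (p \<Zsemi> w) = g \<Zsemi> (q \<Zsemi> w)" using h pq w(1) eq by (simp add: comp_assoc[symmetric])
  from univ[OF comp_hom[OF pq(1) w(1)] comp_hom[OF pq(2) w(1)] this] w show ?thesis by metis
qed

lemma pushout_sym:
  assumes po: "is_pushout P f g p q"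
  shows "is_pushout P g f q p"
proof -
  from po obtain Y N M Q where f: "f \<in> hom P Y N" and g: "g \<in> hom P Y M"
    and p: "p \<in> hom P N Q" and q: "q \<in> hom P M Q" and eq: "f \<Zsemi> p = g \<Zsemi> q"
    by (rule pushout_typing)
  show ?thesis
  proof (rule pushoutI[OF g f q p eq[symmetric]])
    fix R u v assume u: "u \<in> hom P M R" and v: "v \<in> hom P N R" and uv: "g \<Zsemi> u = f \<Zsemi> v"
    from po p q v u uv[symmetric] obtain w
      where "w \<in> hom P Q R" "p \<Zsemi> w = v" "q \<Zsemi> w = u" by (rule pushout_lift)
    then show "\<exists>w. w \<in> hom P Q R \<and> q \<Zsemi> w = u \<and> p \<Zsemi> w = v" by blast
  next
    fix R w w' assume w: "w \<in> hom P Q R" "w' \<in> hom P Q R" "q \<Zsemi> w = q \<Zsemi> w'" "p \<Zsemi> w = p \<Zsemi> w'"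
    show "w = w'" using po p q w(1,2,4,3) by (rule pushout_joint_epi)
  qed
qed

text \<open>The sides \<open>h\<close> and \<open>p\<close> are opposite and invertible: the
  mediating map can only be the inverse of \<open>p\<close> followed by \<open>u\<close>, and
  cancelling \<open>h\<close> gives its equation on \<open>q\<close>. Squares with identities and
  naturality squares of symmetries are all instances.\<close>

lemma pushout_of_isos:
  assumes g: "g \<in> hom P Y N" and h: "h \<in> hom P Y M" "h \<in> isos P"
    and p: "p \<in> hom P N Q" "p \<in> isos P" and q: "q \<in> hom P M Q" and eq: "g \<Zsemi> p = h \<Zsemi> q"
  shows "is_pushout P g h p q"
proof (rule pushoutI[OF g h(1) p(1) q eq])
  obtain h' where h': "h' \<in> hom P M Y" "h \<Zsemi> h' = idn P Y" "h' \<Zsemi> h = idn P M" using h(2,1) by (rule isosE)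
  obtain p' where p': "p' \<in> hom P Q N" "p \<Zsemi> p' = idn P N" "p' \<Zsemi> p = idn P Q" using p(2,1) by (rule isosE)
  fix R u v assume u: "u \<in> hom P N R" and v: "v \<in> hom P M R" and uv: "g \<Zsemi> u = h \<Zsemi> v"
  have p'u: "p' \<Zsemi> u \<in> hom P Q R" using p'(1) u by (rule comp_hom)
  have pu: "p \<Zsemi> (p' \<Zsemi> u) = u"
    by (simp only: comp_assoc[OF p(1) p'(1) u, symmetric] p'(2) idn_comp[OF u])
  have "h \<Zsemi> (q \<Zsemi> (p' \<Zsemi> u)) = g \<Zsemi> (p \<Zsemi> (p' \<Zsemi> u))"
    by (simp only: comp_assoc[OF h(1) q p'u, symmetric] comp_assoc[OF g p(1) p'u, symmetric] eq)
  then have "h \<Zsemi> (q \<Zsemi> (p' \<Zsemi> u)) = h \<Zsemi> v" by (simp only: pu uv)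
  then have "h' \<Zsemi> h \<Zsemi> (q \<Zsemi> (p' \<Zsemi> u)) = h' \<Zsemi> h \<Zsemi> v"
    by (simp only: comp_assoc[OF h'(1) h(1) comp_hom[OF q p'u]] comp_assoc[OF h'(1) h(1) v])
  then have "q \<Zsemi> (p' \<Zsemi> u) = v"
    by (simp only: h'(3) idn_comp[OF comp_hom[OF q p'u]] idn_comp[OF v])
  with pu show "\<exists>w. w \<in> hom P Q R \<and> p \<Zsemi> w = u \<and> q \<Zsemi> w = v"
    using p'u by blast
next
  obtain p' where p': "p' \<in> hom P Q N" "p' \<Zsemi> p = idn P Q" using p(2,1) by (rule isosE)
  fix R w w' assume w: "w \<in> hom P Q R" "w' \<in> hom P Q R" "p \<Zsemi> w = p \<Zsemi> w'"
  then have "p' \<Zsemi> p \<Zsemi> w = p' \<Zsemi> p \<Zsemi> w'" by (simp only: comp_assoc[OF p'(1) p(1)])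
  then show "w = w'" by (simp only: p'(2) idn_comp[OF w(1)] idn_comp[OF w(2)])
qed

lemma pushout_idn: "g \<in> hom P Y N \<Longrightarrow> is_pushout P g (idn P Y) (idn P N) g"
  by (rule pushout_of_isos[of _ Y N _ Y _ N]) (auto intro: idn_hom isos_idn simp: idn_comp comp_idn)

lemma idn_pushout: "g \<in> hom P Y N \<Longrightarrow> is_pushout P (idn P Y) g g (idn P N)"
  by (rule pushout_sym[OF pushout_idn])

text \<open>The two squares share the edge \<open>p\<close>. A cocone on the outer span first
  factors through \<open>Q\<close>, with component \<open>l \<Zsemi> u\<close> on \<open>N\<close>,
  and this factor and \<open>u\<close> form a cocone on the second span.\<close>

lemma pushout_paste:
  assumes po: "is_pushout P k s p q" and po': "is_pushout P l p a b"
  shows "is_pushout P (k \<Zsemi> l) s a (q \<Zsemi> b)"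
proof -
  from po obtain Y N M Q where k: "k \<in> hom P Y N" and s: "s \<in> hom P Y M"
    and p: "p \<in> hom P N Q" and q: "q \<in> hom P M Q" and eq: "k \<Zsemi> p = s \<Zsemi> q"
    by (rule pushout_typing)
  from po' obtain N' R Q' T where l': "l \<in> hom P N' R" and p': "p \<in> hom P N' Q'"
    and "a \<in> hom P R T" "b \<in> hom P Q' T" "l \<Zsemi> a = p \<Zsemi> b"
    by (rule pushout_typing)
  have l: "l \<in> hom P N R" using l' hom_disjoint[OF p p'] by simp
  from po' l p obtain T where a: "a \<in> hom P R T" and b: "b \<in> hom P Q T"
    and eq': "l \<Zsemi> a = p \<Zsemi> b" by (rule pushout_hom)
  show ?thesis
  proof (rule pushoutI[OF comp_hom[OF k l] s a comp_hom[OF q b]])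
    show "k \<Zsemi> l \<Zsemi> a = s \<Zsemi> (q \<Zsemi> b)"
      by (simp only: comp_assoc[OF k l a] eq' comp_assoc[OF k p b, symmetric] eq comp_assoc[OF s q b])
    fix Z u v assume u: "u \<in> hom P R Z" and v: "v \<in> hom P M Z" and uv: "k \<Zsemi> l \<Zsemi> u = s \<Zsemi> v"
    have "k \<Zsemi> (l \<Zsemi> u) = s \<Zsemi> v" using uv by (simp only: comp_assoc[OF k l u])
    from po p q comp_hom[OF l u] v this obtain w
      where w: "w \<in> hom P Q Z" "p \<Zsemi> w = l \<Zsemi> u" "q \<Zsemi> w = v" by (rule pushout_lift)
    from po' a b u w(1) w(2)[symmetric] obtain x
      where x: "x \<in> hom P T Z" "a \<Zsemi> x = u" "b \<Zsemi> x = w" by (rule pushout_lift)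
    then have "q \<Zsemi> b \<Zsemi> x = v" using w(3) by (simp only: comp_assoc[OF q b x(1)])
    with x show "\<exists>w. w \<in> hom P T Z \<and> a \<Zsemi> w = u \<and> q \<Zsemi> b \<Zsemi> w = v" by blast
  next
    fix Z w w' assume w: "w \<in> hom P T Z" "w' \<in> hom P T Z"
      and aw: "a \<Zsemi> w = a \<Zsemi> w'" and qw: "q \<Zsemi> b \<Zsemi> w = q \<Zsemi> b \<Zsemi> w'"
    have "p \<Zsemi> (b \<Zsemi> w) = p \<Zsemi> (b \<Zsemi> w')"
      by (simp only: comp_assoc[OF p b w(1), symmetric] comp_assoc[OF p b w(2), symmetric]
          eq'[symmetric] comp_assoc[OF l a w(1)] comp_assoc[OF l a w(2)] aw)
    moreover have "q \<Zsemi> (b \<Zsemi> w) = q \<Zsemi> (b \<Zsemi> w')"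
      using qw by (simp only: comp_assoc[OF q b w(1)] comp_assoc[OF q b w(2)])
    ultimately have "b \<Zsemi> w = b \<Zsemi> w'"
      by (rule pushout_joint_epi[OF po p q comp_hom[OF b w(1)] comp_hom[OF b w(2)]])
    with aw show "w = w'" by (rule pushout_joint_epi[OF po' a b w])
  qed
qed

text \<open>The square exhibiting \<open>i\<close> as invertible is itself a pushout, and pasting it
  to the given one changes only the source. This makes the pushout of a span independent of the
  representative.\<close>

lemma pushout_iso_source:
  assumes po: "is_pushout P f g p q" and f: "f \<in> hom P Y N" and g: "g \<in> hom P Y K"
    and i: "i \<in> hom P Z Y" "i \<in> isos P"
  shows "is_pushout P (i \<Zsemi> f) (i \<Zsemi> g) p q"
proof -
  have "i \<Zsemi> g \<Zsemi> idn P K = i \<Zsemi> g" using comp_hom[OF i(1) g] by (rule comp_idn)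
  with comp_hom[OF i(1) g] i idn_hom isos_idn g have "is_pushout P (i \<Zsemi> g) i (idn P K) g"
    by (rule pushout_of_isos)
  then have "is_pushout P i (i \<Zsemi> g) g (idn P K)" by (rule pushout_sym)
  from this po have "is_pushout P (i \<Zsemi> f) (i \<Zsemi> g) p (idn P K \<Zsemi> q)" by (rule pushout_paste)
  moreover from po f g obtain Q where "p \<in> hom P N Q" "q \<in> hom P K Q" by (rule pushout_hom)
  ultimately show ?thesis by (simp add: idn_comp)
qed

lemma pushout_unique:
  assumes po: "is_pushout P f g p q" and po': "is_pushout P f g p' q'"
    and p: "p \<in> hom P N Q" and q: "q \<in> hom P M Q"
  obtains i Q' where "i \<in> hom P Q Q'" "i \<in> isos P" "p \<Zsemi> i = p'" "q \<Zsemi> i = q'"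
proof -
  from po p q obtain Y where f: "f \<in> hom P Y N" and g: "g \<in> hom P Y M" and e: "f \<Zsemi> p = g \<Zsemi> q"
    by (rule pushout_univ) (rule that)
  from po' f g obtain Q' where p': "p' \<in> hom P N Q'" and q': "q' \<in> hom P M Q'"
    and e': "f \<Zsemi> p' = g \<Zsemi> q'"
    by (rule pushout_hom)
  from po p q p' q' e' obtain i where i: "i \<in> hom P Q Q'" "p \<Zsemi> i = p'" "q \<Zsemi> i = q'"
    by (rule pushout_lift)
  from po' p' q' p q e obtain j where j: "j \<in> hom P Q' Q" "p' \<Zsemi> j = p" "q' \<Zsemi> j = q"
    by (rule pushout_lift)
  have "i \<Zsemi> j = idn P Q"
  proof (rule pushout_joint_epi[OF po p q comp_hom[OF i(1) j(1)] idn_hom])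
    show "p \<Zsemi> (i \<Zsemi> j) = p \<Zsemi> idn P Q"
      by (simp only: comp_assoc[OF p i(1) j(1), symmetric] i j comp_idn[OF p])
    show "q \<Zsemi> (i \<Zsemi> j) = q \<Zsemi> idn P Q"
      by (simp only: comp_assoc[OF q i(1) j(1), symmetric] i j comp_idn[OF q])
  qed
  moreover have "j \<Zsemi> i = idn P Q'"
  proof (rule pushout_joint_epi[OF po' p' q' comp_hom[OF j(1) i(1)] idn_hom])
    show "p' \<Zsemi> (j \<Zsemi> i) = p' \<Zsemi> idn P Q'"
      by (simp only: comp_assoc[OF p' j(1) i(1), symmetric] i j comp_idn[OF p'])
    show "q' \<Zsemi> (j \<Zsemi> i) = q' \<Zsemi> idn P Q'"
      by (simp only: comp_assoc[OF q' j(1) i(1), symmetric] i j comp_idn[OF q'])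
  qed
  ultimately have "i \<in> isos P" by (rule isosI[OF i(1) j(1)])
  from that[OF i(1) this i(2,3)] show thesis .
qed

text \<open>The inverse of \<open>f\<close> followed by \<open>g\<close>, together with an identity,
  is one pushout of the span. Any other differs from it by an invertible map, and this map is
  \<open>q\<close> itself.\<close>

lemma pushout_isos:
  assumes po: "is_pushout P f g p q" and f: "f \<in> isos P"
  shows "q \<in> isos P"
proof -
  from po obtain Y N M Q where h: "f \<in> hom P Y N" "g \<in> hom P Y M"
    and pq: "p \<in> hom P N Q" "q \<in> hom P M Q"
    and "f \<Zsemi> p = g \<Zsemi> q" by (rule pushout_typing)
  obtain f' where f': "f' \<in> hom P N Y" "f \<Zsemi> f' = idn P Y" using f h(1) by (rule isosE)
  have "g \<Zsemi> idn P M = f \<Zsemi> (f' \<Zsemi> g)"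
    by (simp only: comp_assoc[OF h(1) f'(1) h(2), symmetric] f'(2) idn_comp[OF h(2)] comp_idn[OF h(2)])
  then have "is_pushout P g f (idn P M) (f' \<Zsemi> g)"
    by (rule pushout_of_isos[OF h(2,1) f idn_hom isos_idn comp_hom[OF f'(1) h(2)]])
  then have "is_pushout P f g (f' \<Zsemi> g) (idn P M)" by (rule pushout_sym)
  from pushout_unique[OF this po comp_hom[OF f'(1) h(2)] idn_hom] obtain i Q'
    where i: "i \<in> hom P M Q'" "i \<in> isos P" "idn P M \<Zsemi> i = q" by metis
  have "i = q" using i(3) by (simp only: idn_comp[OF i(1)])
  with i(2) show ?thesis by simp
qed

end


section \<open>Props of cospans\<close>

text \<open>With all arrows as \<open>L\<close> these are the cospans of \<open>P\<close>; over the
  opposite prop with \<open>L = A\<close> they are the spans in \<open>A\<close>.\<close>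

definition leg_cospans :: "'a prop_data \<Rightarrow> 'a set \<Rightarrow> nat \<Rightarrow> nat \<Rightarrow> ('a \<times> 'a) set" where
  "leg_cospans P L X Y = (\<Union>N. (hom P X N \<inter> L) \<times> (hom P Y N \<inter> L))"

text \<open>Only the hom-sets need adapting: the operations act on the members of the given classes,
  and these have legs in \<open>L\<close> already.\<close>

definition leg_cospan_quotient ::
    "'a prop_data \<Rightarrow> 'a set \<Rightarrow> (('a \<times> 'a) \<times> ('a \<times> 'a)) set \<Rightarrow> ('a \<times> 'a) set prop_data" where
  "leg_cospan_quotient P L r = (cospan_quotient P r)\<lparr>hom := \<lambda>X Y. leg_cospans P L X Y // r\<rparr>"

locale pushout_legs = is_prop P for P :: "'a prop_data" (structure) +
  fixes L :: "'a set"
  assumes legs_sub_prop: "sub_prop P L"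
    and legs_isos: "isos P \<subseteq> L"
    and legs_pushout_ex: "f \<in> hom P Y N \<inter> L \<Longrightarrow> g \<in> hom P Y M \<inter> L \<Longrightarrow> \<exists>p q. is_pushout P f g p q"
    and legs_pushout: "is_pushout P f g p q \<Longrightarrow> f \<in> L \<Longrightarrow> g \<in> L \<Longrightarrow> p \<in> L \<and> q \<in> L"
    and legs_tensor_pushout: "is_pushout P f g p q \<Longrightarrow> is_pushout P f' g' p' q'
      \<Longrightarrow> f \<in> L \<Longrightarrow> g \<in> L \<Longrightarrow> f' \<in> L \<Longrightarrow> g' \<in> L
      \<Longrightarrow> is_pushout P (f \<oplus> f') (g \<oplus> g') (p \<oplus> p') (q \<oplus> q')"
begin

lemma legs_idn: "idn P X \<in> L" and legs_symm: "symm P X Y \<in> L"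
  and legs_comp: "f \<in> L \<Longrightarrow> g \<in> L \<Longrightarrow> f \<in> hom P X Y \<Longrightarrow> g \<in> hom P Y Z \<Longrightarrow> f \<Zsemi> g \<in> L"
  and legs_tensor: "f \<in> L \<Longrightarrow> g \<in> L \<Longrightarrow> f \<oplus> g \<in> L"
  using legs_sub_prop unfolding sub_prop_def by blast+

lemma leg_cospansI:
  "f \<in> hom P X N \<Longrightarrow> f \<in> L \<Longrightarrow> g \<in> hom P Y N \<Longrightarrow> g \<in> L \<Longrightarrow> (f, g) \<in> leg_cospans P L X Y"
  unfolding leg_cospans_def by blast

lemma leg_cospansE:
  assumes "(f, g) \<in> leg_cospans P L X Y"
  obtains N where "f \<in> hom P X N" "f \<in> L" "g \<in> hom P Y N" "g \<in> L"
  using assms unfolding leg_cospans_def by blast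

lemma leg_cospans_comp:
  assumes "(f, g) \<in> leg_cospans P L X Y" "(h, k) \<in> leg_cospans P L Y Z" "is_pushout P g h p q"
  shows "(f \<Zsemi> p, k \<Zsemi> q) \<in> leg_cospans P L X Z"
proof -
  from assms(1) obtain N where f: "f \<in> hom P X N" "f \<in> L" "g \<in> hom P Y N" "g \<in> L" by (rule leg_cospansE)
  from assms(2) obtain M where h: "h \<in> hom P Y M" "h \<in> L" "k \<in> hom P Z M" "k \<in> L" by (rule leg_cospansE)
  from assms(3) f(3) h(1) obtain Q where "p \<in> hom P N Q" "q \<in> hom P M Q" by (rule pushout_hom)
  then show ?thesis using f h legs_pushout[OF assms(3)] by (metis leg_cospansI comp_hom legs_comp)
qed

lemma leg_cospans_tensor:
  "(f, g) \<in> leg_cospans P L X Y \<Longrightarrow> (f', g') \<in> leg_cospans P L X' Y'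
    \<Longrightarrow> (f \<oplus> f', g \<oplus> g') \<in> leg_cospans P L (X + X') (Y + Y')"
  by (elim leg_cospansE) (auto intro: leg_cospansI tensor_hom legs_tensor)

lemma leg_cospans_pushout_ex:
  assumes "(f, g) \<in> leg_cospans P L X Y" "(h, k) \<in> leg_cospans P L Y Z"
  obtains p q where "is_pushout P g h p q"
  using assms by (elim leg_cospansE) (metis IntI legs_pushout_ex)

end

text \<open>
  \<open>r\<close> may relate pairs that are not cospans, so that \<open>corel_equiv\<close>, which is reflexive
  everywhere, is an instance.
\<close>

locale cospan_congruence = pushout_legs P L for P :: "'a prop_data" (structure) and L +
  fixes r :: "(('a \<times> 'a) \<times> ('a \<times> 'a)) set"
  assumes r_sym: "c \<in> leg_cospans P L X Y \<Longrightarrow> (c, c') \<in> r \<Longrightarrow> (c', c) \<in> r"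
    and r_trans: "c \<in> leg_cospans P L X Y \<Longrightarrow> (c, c') \<in> r \<Longrightarrow> (c', c'') \<in> r \<Longrightarrow> (c, c'') \<in> r"
    and r_refl: "c \<in> leg_cospans P L X Y \<Longrightarrow> (c, c) \<in> r"
    and r_closed: "c \<in> leg_cospans P L X Y \<Longrightarrow> (c, c') \<in> r \<Longrightarrow> c' \<in> leg_cospans P L X Y"
    and r_swap: "(f, g) \<in> leg_cospans P L X Y \<Longrightarrow> ((f, g), (f', g')) \<in> r \<Longrightarrow> ((g, f), (g', f')) \<in> r"
    and r_comp: "(f, g) \<in> leg_cospans P L X Y \<Longrightarrow> ((f, g), (f', g')) \<in> r
      \<Longrightarrow> (h, k) \<in> leg_cospans P L Y Z \<Longrightarrow> is_pushout P g h p q \<Longrightarrow> is_pushout P g' h p' q'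
      \<Longrightarrow> ((f \<Zsemi> p, k \<Zsemi> q), (f' \<Zsemi> p', k \<Zsemi> q')) \<in> r"
    and r_tensor: "(f, g) \<in> leg_cospans P L X Y \<Longrightarrow> ((f, g), (f', g')) \<in> r
      \<Longrightarrow> (h, k) \<in> leg_cospans P L X' Y' \<Longrightarrow> ((h, k), (h', k')) \<in> r
      \<Longrightarrow> ((f \<oplus> h, g \<oplus> k), (f' \<oplus> h', g' \<oplus> k')) \<in> r"
begin

section \<open>Well-defined operations on classes\<close>

abbreviation Q where "Q \<equiv> leg_cospan_quotient P L r"

abbreviation cl where "cl c \<equiv> r `` {c}"

lemma cl_eq: "c \<in> leg_cospans P L X Y \<Longrightarrow> (c, c') \<in> r \<Longrightarrow> cl c = cl c'"
  using r_sym r_trans r_closed by (intro set_eqI) (metis Image_singleton_iff)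

lemma cl_eqD: "cl c = cl c' \<Longrightarrow> c' \<in> leg_cospans P L X Y \<Longrightarrow> (c, c') \<in> r"
  using r_refl by blast

lemma cl_image:
  assumes "c \<in> leg_cospans P L X Y" and "c \<in> T" and "\<And>c'. c' \<in> T \<Longrightarrow> (c, c') \<in> r"
  shows "r `` T = cl c"
  using assms r_trans[OF assms(1)] by blast

lemma swap_cospans: "(f, g) \<in> leg_cospans P L X Y \<Longrightarrow> (g, f) \<in> leg_cospans P L Y X"
  unfolding leg_cospans_def by blast

text \<open>The locale varies only the left factor of a composite. Reversing cospans with
  \<open>r_swap\<close> makes the right factor the left one, and the pushout of \<open>g'\<close>
  and \<open>h\<close> is the intermediate stage.\<close>

lemma r_comp_both:
  assumes fg: "(f, g) \<in> leg_cospans P L X Y" and fg': "((f, g), (f', g')) \<in> r"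
    and hk: "(h, k) \<in> leg_cospans P L Y Z" and hk': "((h, k), (h', k')) \<in> r"
    and po: "is_pushout P g h p q" and po': "is_pushout P g' h' p' q'"
  shows "((f \<Zsemi> p, k \<Zsemi> q), (f' \<Zsemi> p', k' \<Zsemi> q')) \<in> r"
proof -
  have c': "(f', g') \<in> leg_cospans P L X Y" using r_closed[OF fg fg'] .
  obtain a b where ab: "is_pushout P g' h a b" using c' hk by (rule leg_cospans_pushout_ex)
  have 1: "((f \<Zsemi> p, k \<Zsemi> q), (f' \<Zsemi> a, k \<Zsemi> b)) \<in> r" using fg fg' hk po ab by (rule r_comp)
  have "((k \<Zsemi> b, f' \<Zsemi> a), (k' \<Zsemi> q', f' \<Zsemi> p')) \<in> r"
    using swap_cospans[OF hk] r_swap[OF hk hk'] swap_cospans[OF c'] pushout_sym[OF ab] pushout_sym[OF po']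
    by (rule r_comp)
  then have "((f' \<Zsemi> a, k \<Zsemi> b), (f' \<Zsemi> p', k' \<Zsemi> q')) \<in> r"
    by (rule r_swap[OF swap_cospans[OF leg_cospans_comp[OF c' hk ab]]])
  with leg_cospans_comp[OF fg hk po] 1 show ?thesis by (rule r_trans)
qed

text \<open>No axiom of the locale relates isomorphic cospans outright. It follows from the freedom
  of pushouts in \<open>r_comp\<close>: the span \<open>(g, idn P Y)\<close> has the trivial pushout
  and also the one transported along \<open>i\<close>.\<close>

lemma r_iso:
  assumes fg: "(f, g) \<in> leg_cospans P L X Y" and f: "f \<in> hom P X N"
    and i: "i \<in> hom P N N'" "i \<in> isos P"
  shows "((f, g), (f \<Zsemi> i, g \<Zsemi> i)) \<in> r"
proof -
  from fg obtain N1 where f1: "f \<in> hom P X N1" and "f \<in> L" and "g \<in> hom P Y N1" and "g \<in> L"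
    by (rule leg_cospansE)
  with hom_disjoint[OF f f1] have g: "g \<in> hom P Y N" by simp
  have idn: "(idn P Y, idn P Y) \<in> leg_cospans P L Y Y" by (rule leg_cospansI[OF idn_hom legs_idn idn_hom legs_idn])
  have eq: "g \<Zsemi> i = idn P Y \<Zsemi> (g \<Zsemi> i)" using idn_comp[OF comp_hom[OF g i(1)]] by simp
  have po: "is_pushout P g (idn P Y) i (g \<Zsemi> i)"
    using g idn_hom isos_idn i comp_hom[OF g i(1)] eq by (rule pushout_of_isos)
  have "((f \<Zsemi> idn P N, idn P Y \<Zsemi> g), (f \<Zsemi> i, idn P Y \<Zsemi> (g \<Zsemi> i))) \<in> r"
    using fg r_refl[OF fg] idn pushout_idn[OF g] po by (rule r_comp)
  then show ?thesis by (simp only: comp_idn[OF f] idn_comp[OF g] eq[symmetric])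
qed

lemma hom_Q: "hom Q X Y = {cl c | c. c \<in> leg_cospans P L X Y}"
  by (auto simp: leg_cospan_quotient_def quotient_def)

lemma hom_QI: "(f, g) \<in> leg_cospans P L X Y \<Longrightarrow> cl (f, g) \<in> hom Q X Y"
  unfolding hom_Q by blast

lemma hom_QE:
  assumes "x \<in> hom Q X Y"
  obtains f g where "x = cl (f, g)" "(f, g) \<in> leg_cospans P L X Y"
  using assms unfolding hom_Q by auto

lemma comp_cl:
  assumes fg: "(f, g) \<in> leg_cospans P L X Y" and hk: "(h, k) \<in> leg_cospans P L Y Z"
    and po: "is_pushout P g h p q"
  shows "cl (f, g) \<Zsemi>\<^bsub>Q\<^esub> cl (h, k) = cl (f \<Zsemi> p, k \<Zsemi> q)"
  unfolding leg_cospan_quotient_def cospan_quotient_def prop_data.simps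
proof (rule cl_image[OF leg_cospans_comp[OF fg hk po]])
  show "(f \<Zsemi> p, k \<Zsemi> q) \<in> {(f' \<Zsemi> p', k' \<Zsemi> q') | f' g' h' k' p' q'.
      (f', g') \<in> cl (f, g) \<and> (h', k') \<in> cl (h, k) \<and> is_pushout P g' h' p' q'}"
    using r_refl[OF fg] r_refl[OF hk] po by blast
qed (use r_comp_both[OF fg _ hk _ po] in auto)

lemma tensor_cl:
  assumes fg: "(f, g) \<in> leg_cospans P L X Y" and hk: "(h, k) \<in> leg_cospans P L X' Y'"
  shows "cl (f, g) \<oplus>\<^bsub>Q\<^esub> cl (h, k) = cl (f \<oplus> h, g \<oplus> k)"
  unfolding leg_cospan_quotient_def cospan_quotient_def prop_data.simps
proof (rule cl_image[OF leg_cospans_tensor[OF fg hk]])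
  show "(f \<oplus> h, g \<oplus> k) \<in> {(f' \<oplus> h', g' \<oplus> k') | f' g' h' k'.
      (f', g') \<in> cl (f, g) \<and> (h', k') \<in> cl (h, k)}"
    using r_refl[OF fg] r_refl[OF hk] by blast
qed (use r_tensor[OF fg _ hk] in auto)

lemma idn_cl: "idn Q X = cl (idn P X, idn P X)"
  by (simp add: leg_cospan_quotient_def cospan_quotient_def)

lemma symm_cl: "symm Q X Y = cl (symm P X Y, idn P (Y + X))"
  by (simp add: leg_cospan_quotient_def cospan_quotient_def)

section \<open>Calculus of forward and backward cospans\<close>

lemma forward_cospan: "f \<in> hom P X Y \<Longrightarrow> f \<in> L \<Longrightarrow> (f, idn P Y) \<in> leg_cospans P L X Y"
  and backward_cospan: "f \<in> hom P X Y \<Longrightarrow> f \<in> L \<Longrightarrow> (idn P Y, f) \<in> leg_cospans P L Y X"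
  by (auto intro: leg_cospansI idn_hom legs_idn)

text \<open>The pushout along an identity is trivial, so a forward arrow is simply absorbed into the
  first leg; \<open>comp_backward\<close> is the mirror image.\<close>

lemma forward_comp:
  assumes f: "f \<in> hom P X Y" "f \<in> L" and hk: "(h, k) \<in> leg_cospans P L Y Z"
  shows "cl (f, idn P Y) \<Zsemi>\<^bsub>Q\<^esub> cl (h, k) = cl (f \<Zsemi> h, k)"
proof -
  from hk obtain N where h: "h \<in> hom P Y N" "k \<in> hom P Z N" by (rule leg_cospansE)
  show ?thesis
    using comp_cl[OF forward_cospan[OF f] hk idn_pushout[OF h(1)]] h(2) by (simp add: comp_idn)
qed

lemma comp_backward:
  assumes fg: "(f, g) \<in> leg_cospans P L X Y" and k: "k \<in> hom P Z Y" "k \<in> L"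
  shows "cl (f, g) \<Zsemi>\<^bsub>Q\<^esub> cl (idn P Y, k) = cl (f, k \<Zsemi> g)"
proof -
  from fg obtain N where g: "f \<in> hom P X N" "g \<in> hom P Y N" by (rule leg_cospansE)
  show ?thesis
    using comp_cl[OF fg backward_cospan[OF k] pushout_idn[OF g(2)]] g(1) by (simp add: comp_idn)
qed

lemma forward_backward:
  assumes "f \<in> hom P X N" "f \<in> L" "g \<in> hom P Y N" "g \<in> L"
  shows "cl (f, idn P N) \<Zsemi>\<^bsub>Q\<^esub> cl (idn P N, g) = cl (f, g)"
  using forward_comp[OF assms(1,2) backward_cospan[OF assms(3,4)]] assms(1) by (simp add: comp_idn)

lemma backward_forward:
  assumes f: "f \<in> hom P Y N" "f \<in> L" and g: "g \<in> hom P Y M" "g \<in> L"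
    and po: "is_pushout P f g p q"
  shows "cl (idn P N, f) \<Zsemi>\<^bsub>Q\<^esub> cl (g, idn P M) = cl (p, q)"
proof -
  from po f(1) g(1) obtain R where "p \<in> hom P N R" "q \<in> hom P M R" by (rule pushout_hom)
  with comp_cl[OF backward_cospan[OF f] forward_cospan[OF g] po] show ?thesis
    by (simp add: idn_comp)
qed

section \<open>The laws of a prop\<close>

lemma idn_cospan: "(idn P X, idn P X) \<in> leg_cospans P L X X"
  by (intro forward_cospan idn_hom legs_idn)

lemma symm_cospan: "(symm P X Y, idn P (Y + X)) \<in> leg_cospans P L (X + Y) (Y + X)"
  by (intro forward_cospan symm_hom legs_symm)

text \<open>\<open>q\<close> and \<open>p'\<close> both leave the apex of the middle cospan. Pasting
  their pushout to either of the two inner pushouts computes one of the bracketings, so both end in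
  the same apex \<open>T\<close>.\<close>

lemma comp_assoc_cl:
  assumes x: "(f, g) \<in> leg_cospans P L W X" and y: "(h, k) \<in> leg_cospans P L X Y"
    and z: "(s, t) \<in> leg_cospans P L Y Z"
  shows "cl (f, g) \<Zsemi>\<^bsub>Q\<^esub> cl (h, k) \<Zsemi>\<^bsub>Q\<^esub> cl (s, t) = cl (f, g) \<Zsemi>\<^bsub>Q\<^esub> (cl (h, k) \<Zsemi>\<^bsub>Q\<^esub> cl (s, t))"
proof -
  from x obtain N1 where f: "f \<in> hom P W N1" "f \<in> L" "g \<in> hom P X N1" "g \<in> L" by (rule leg_cospansE)
  from y obtain N2 where h: "h \<in> hom P X N2" "h \<in> L" "k \<in> hom P Y N2" "k \<in> L" by (rule leg_cospansE)
  from z obtain N3 where s: "s \<in> hom P Y N3" "s \<in> L" "t \<in> hom P Z N3" "t \<in> L" by (rule leg_cospansE)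
  from x y obtain p q where pq: "is_pushout P g h p q" by (rule leg_cospans_pushout_ex)
  from y z obtain p' q' where pq': "is_pushout P k s p' q'" by (rule leg_cospans_pushout_ex)
  from pq f(3) h(1) obtain R where p: "p \<in> hom P N1 R" and q: "q \<in> hom P N2 R" by (rule pushout_hom)
  from pq' h(3) s(1) obtain R' where p': "p' \<in> hom P N2 R'" and q': "q' \<in> hom P N3 R'" by (rule pushout_hom)
  have "p \<in> L" "q \<in> L" "p' \<in> L" "q' \<in> L"
    using legs_pushout[OF pq] legs_pushout[OF pq'] f h s by auto
  with q p' obtain a b where ab: "is_pushout P q p' a b" using legs_pushout_ex by blast
  from ab q p' obtain T where a: "a \<in> hom P R T" and b: "b \<in> hom P R' T" by (rule pushout_hom)
  have left: "is_pushout P (k \<Zsemi> q) s a (q' \<Zsemi> b)" using pq' ab by (rule pushout_paste)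
  have "is_pushout P (h \<Zsemi> p') g b (p \<Zsemi> a)"
    using pushout_sym[OF pq] pushout_sym[OF ab] by (rule pushout_paste)
  then have right: "is_pushout P g (h \<Zsemi> p') (p \<Zsemi> a) b" by (rule pushout_sym)
  have "cl (f, g) \<Zsemi>\<^bsub>Q\<^esub> cl (h, k) \<Zsemi>\<^bsub>Q\<^esub> cl (s, t) = cl (f \<Zsemi> p \<Zsemi> a, t \<Zsemi> (q' \<Zsemi> b))"
    by (simp only: comp_cl[OF x y pq] comp_cl[OF leg_cospans_comp[OF x y pq] z left])
  moreover have "cl (f, g) \<Zsemi>\<^bsub>Q\<^esub> (cl (h, k) \<Zsemi>\<^bsub>Q\<^esub> cl (s, t)) = cl (f \<Zsemi> (p \<Zsemi> a), t \<Zsemi> q' \<Zsemi> b)"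
    by (simp only: comp_cl[OF y z pq'] comp_cl[OF x leg_cospans_comp[OF y z pq'] right])
  ultimately show ?thesis
    by (simp only: comp_assoc[OF f(1) p a] comp_assoc[OF s(3) q' b])
qed

text \<open>Interchange is where preservation of pushouts by \<open>\<oplus>\<close> enters: the
  tensor of the two pushouts used on the left is the pushout needed on the right.\<close>

lemma tensor_comp_cl:
  assumes x: "(f, g) \<in> leg_cospans P L X Y" and y: "(h, k) \<in> leg_cospans P L Y Z"
    and x': "(f', g') \<in> leg_cospans P L X' Y'" and y': "(h', k') \<in> leg_cospans P L Y' Z'"
  shows "(cl (f, g) \<Zsemi>\<^bsub>Q\<^esub> cl (h, k)) \<oplus>\<^bsub>Q\<^esub> (cl (f', g') \<Zsemi>\<^bsub>Q\<^esub> cl (h', k'))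
    = (cl (f, g) \<oplus>\<^bsub>Q\<^esub> cl (f', g')) \<Zsemi>\<^bsub>Q\<^esub> (cl (h, k) \<oplus>\<^bsub>Q\<^esub> cl (h', k'))"
proof -
  from x obtain N where f: "f \<in> hom P X N" "f \<in> L" "g \<in> hom P Y N" "g \<in> L" by (rule leg_cospansE)
  from y obtain M where h: "h \<in> hom P Y M" "h \<in> L" "k \<in> hom P Z M" "k \<in> L" by (rule leg_cospansE)
  from x' obtain N' where f': "f' \<in> hom P X' N'" "f' \<in> L" "g' \<in> hom P Y' N'" "g' \<in> L" by (rule leg_cospansE)
  from y' obtain M' where h': "h' \<in> hom P Y' M'" "h' \<in> L" "k' \<in> hom P Z' M'" "k' \<in> L" by (rule leg_cospansE)
  from x y obtain p q where pq: "is_pushout P g h p q" by (rule leg_cospans_pushout_ex)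
  from x' y' obtain p' q' where pq': "is_pushout P g' h' p' q'" by (rule leg_cospans_pushout_ex)
  from pq f(3) h(1) obtain R where p: "p \<in> hom P N R" and q: "q \<in> hom P M R" by (rule pushout_hom)
  from pq' f'(3) h'(1) obtain R' where p': "p' \<in> hom P N' R'" and q': "q' \<in> hom P M' R'" by (rule pushout_hom)
  have po: "is_pushout P (g \<oplus> g') (h \<oplus> h') (p \<oplus> p') (q \<oplus> q')"
    using legs_tensor_pushout[OF pq pq'] f h f' h' by simp
  show ?thesis
    by (simp only: comp_cl[OF x y pq] comp_cl[OF x' y' pq']
        tensor_cl[OF leg_cospans_comp[OF x y pq] leg_cospans_comp[OF x' y' pq']]
        tensor_cl[OF x x'] tensor_cl[OF y y']
        comp_cl[OF leg_cospans_tensor[OF x x'] leg_cospans_tensor[OF y y'] po]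
        tensor_comp[OF f(1) p f'(1) p'] tensor_comp[OF h(3) q h'(3) q'])
qed

text \<open>The naturality square of the symmetry at \<open>g\<close> and \<open>g'\<close> has two
  opposite invertible sides, so it is the pushout that computes the left-hand composite.\<close>

lemma symm_natural_cl:
  assumes x: "(f, g) \<in> leg_cospans P L X Y" and x': "(f', g') \<in> leg_cospans P L X' Y'"
  shows "(cl (f, g) \<oplus>\<^bsub>Q\<^esub> cl (f', g')) \<Zsemi>\<^bsub>Q\<^esub> symm Q Y Y' = symm Q X X' \<Zsemi>\<^bsub>Q\<^esub> (cl (f', g') \<oplus>\<^bsub>Q\<^esub> cl (f, g))"
proof -
  from x obtain N where f: "f \<in> hom P X N" "f \<in> L" "g \<in> hom P Y N" "g \<in> L" by (rule leg_cospansE)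
  from x' obtain N' where f': "f' \<in> hom P X' N'" "f' \<in> L" "g' \<in> hom P Y' N'" "g' \<in> L" by (rule leg_cospansE)
  have po: "is_pushout P (g \<oplus> g') (symm P Y Y') (symm P N N') (g' \<oplus> g)"
    using f f' by (intro pushout_of_isos[of _ "Y + Y'" "N + N'" _ "Y' + Y" _ "N' + N"])
      (auto intro: tensor_hom symm_hom isos_symm symm_natural)
  have "(cl (f, g) \<oplus>\<^bsub>Q\<^esub> cl (f', g')) \<Zsemi>\<^bsub>Q\<^esub> symm Q Y Y'
      = cl ((f \<oplus> f') \<Zsemi> symm P N N', idn P (Y' + Y) \<Zsemi> (g' \<oplus> g))"
    by (simp only: symm_cl tensor_cl[OF x x'] comp_cl[OF leg_cospans_tensor[OF x x'] symm_cospan po])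
  also have "\<dots> = cl (symm P X X' \<Zsemi> (f' \<oplus> f), g' \<oplus> g)"
    by (simp only: symm_natural[OF f(1) f'(1)] idn_comp[OF tensor_hom[OF f'(3) f(3)]])
  also have "\<dots> = symm Q X X' \<Zsemi>\<^bsub>Q\<^esub> (cl (f', g') \<oplus>\<^bsub>Q\<^esub> cl (f, g))"
    by (simp only: symm_cl tensor_cl[OF x' x]
        forward_comp[OF symm_hom legs_symm leg_cospans_tensor[OF x' x]])
  finally show ?thesis .
qed

lemma is_prop_quotient: "is_prop Q"
proof (unfold_locales, goal_cases)
  case (1 x X Y X' Y')
  from 1(1) obtain f g where fg: "x = cl (f, g)" "(f, g) \<in> leg_cospans P L X Y" by (rule hom_QE)
  from 1(2) obtain h k where hk: "x = cl (h, k)" "(h, k) \<in> leg_cospans P L X' Y'" by (rule hom_QE)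
  \<comment> \<open>A class determines its objects because \<open>r\<close> never leaves the cospans
    between two given objects.\<close>
  have "((f, g), (h, k)) \<in> r" using fg(1) hk by (intro cl_eqD) auto
  with fg(2) have "(h, k) \<in> leg_cospans P L X Y" by (rule r_closed)
  then obtain N where "h \<in> hom P X N" "h \<in> L" "k \<in> hom P Y N" "k \<in> L" by (rule leg_cospansE)
  moreover from hk(2) obtain N' where "h \<in> hom P X' N'" "h \<in> L" "k \<in> hom P Y' N'" "k \<in> L"
    by (rule leg_cospansE)
  ultimately show ?case using hom_disjoint by blast
next
  case (2 X) then show ?case unfolding idn_cl by (intro hom_QI idn_cospan)
next
  case (3 x X Y y Z)
  from 3(1) obtain f g where x: "x = cl (f, g)" "(f, g) \<in> leg_cospans P L X Y" by (rule hom_QE)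
  from 3(2) obtain h k where y: "y = cl (h, k)" "(h, k) \<in> leg_cospans P L Y Z" by (rule hom_QE)
  from x(2) y(2) obtain p q where pq: "is_pushout P g h p q" by (rule leg_cospans_pushout_ex)
  show ?case
    unfolding x(1) y(1) comp_cl[OF x(2) y(2) pq]
    using leg_cospans_comp[OF x(2) y(2) pq] by (rule hom_QI)
next
  case (4 x W X y Y z Z) then show ?case by (elim hom_QE) (simp only: comp_assoc_cl)
next
  case (5 x X Y)
  then obtain f g where x: "x = cl (f, g)" "(f, g) \<in> leg_cospans P L X Y" by (rule hom_QE)
  from x(2) obtain N where f: "f \<in> hom P X N" and "f \<in> L" and g: "g \<in> hom P Y N" and "g \<in> L" by (rule leg_cospansE)
  show ?case unfolding idn_cl x(1) forward_comp[OF idn_hom legs_idn x(2)]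
    by (simp only: idn_comp[OF f] idn_comp[OF g])
next
  case (6 x X Y)
  then obtain f g where x: "x = cl (f, g)" "(f, g) \<in> leg_cospans P L X Y" by (rule hom_QE)
  from x(2) obtain N where f: "f \<in> hom P X N" and "f \<in> L" and g: "g \<in> hom P Y N" and "g \<in> L" by (rule leg_cospansE)
  show ?case unfolding idn_cl x(1) comp_backward[OF x(2) idn_hom legs_idn]
    by (simp only: idn_comp[OF f] idn_comp[OF g])
next
  case (7 x X Y x' X' Y') then show ?case
    by (elim hom_QE) (simp only: tensor_cl hom_QI leg_cospans_tensor)
next
  case (8 X Y) show ?case
    by (simp only: idn_cl tensor_cl[OF idn_cospan idn_cospan] tensor_idn)
next
  case (9 x X Y y Z x' X' Y' y' Z') then show ?case
    by (elim hom_QE) (simp only: tensor_comp_cl)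
next
  case (10 x X Y x' X' Y' x'' X'' Y'')
  from 10(1) obtain f g where x: "x = cl (f, g)" "(f, g) \<in> leg_cospans P L X Y" by (rule hom_QE)
  from 10(2) obtain f' g' where x': "x' = cl (f', g')" "(f', g') \<in> leg_cospans P L X' Y'" by (rule hom_QE)
  from 10(3) obtain f'' g'' where x'': "x'' = cl (f'', g'')" "(f'', g'') \<in> leg_cospans P L X'' Y''" by (rule hom_QE)
  have "f \<oplus> f' \<oplus> f'' = f \<oplus> (f' \<oplus> f'')" "g \<oplus> g' \<oplus> g'' = g \<oplus> (g' \<oplus> g'')"
    using x(2) x'(2) x''(2) by (auto elim!: leg_cospansE intro: tensor_assoc)
  then show ?case
    by (simp only: x(1) x'(1) x''(1) tensor_cl[OF x(2) x'(2)] tensor_cl[OF x'(2) x''(2)]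
        tensor_cl[OF leg_cospans_tensor[OF x(2) x'(2)] x''(2)]
        tensor_cl[OF x(2) leg_cospans_tensor[OF x'(2) x''(2)]])
next
  case (11 x X Y)
  then obtain f g where x: "x = cl (f, g)" "(f, g) \<in> leg_cospans P L X Y" by (rule hom_QE)
  from x(2) obtain N where f: "f \<in> hom P X N" and "f \<in> L" and g: "g \<in> hom P Y N" and "g \<in> L" by (rule leg_cospansE)
  show ?case unfolding idn_cl x(1) tensor_cl[OF idn_cospan x(2)]
    by (simp only: idn0_tensor[OF f] idn0_tensor[OF g])
next
  case (12 x X Y)
  then obtain f g where x: "x = cl (f, g)" "(f, g) \<in> leg_cospans P L X Y" by (rule hom_QE)
  from x(2) obtain N where f: "f \<in> hom P X N" and "f \<in> L" and g: "g \<in> hom P Y N" and "g \<in> L" by (rule leg_cospansE)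
  show ?case unfolding idn_cl x(1) tensor_cl[OF x(2) idn_cospan]
    by (simp only: tensor_idn0[OF f] tensor_idn0[OF g])
next
  case (13 X Y) show ?case unfolding symm_cl by (intro hom_QI symm_cospan)
next
  case (14 x X Y x' X' Y') then show ?case by (elim hom_QE) (simp only: symm_natural_cl)
next
  case (15 X Y)
  show ?case
    by (simp only: symm_cl idn_cl forward_comp[OF symm_hom legs_symm symm_cospan] symm_inverse)
next
  case (16 X Y Z)
  have h: "symm P X Y \<oplus> idn P Z \<in> hom P (X + Y + Z) (Y + X + Z)"
    and h': "(idn P Y \<oplus> symm P X Z, idn P (Y + Z + X)) \<in> leg_cospans P L (Y + X + Z) (Y + Z + X)"
    using tensor_hom[OF symm_hom idn_hom]
      leg_cospans_tensor[OF idn_cospan[of Y] symm_cospan[of X Z]]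
    by (auto simp: add.assoc tensor_idn)
  have "(symm Q X Y \<oplus>\<^bsub>Q\<^esub> idn Q Z) \<Zsemi>\<^bsub>Q\<^esub> (idn Q Y \<oplus>\<^bsub>Q\<^esub> symm Q X Z)
      = cl (symm P X Y \<oplus> idn P Z, idn P (Y + X + Z)) \<Zsemi>\<^bsub>Q\<^esub> cl (idn P Y \<oplus> symm P X Z, idn P (Y + Z + X))"
    by (simp only: symm_cl idn_cl tensor_cl[OF symm_cospan idn_cospan] tensor_cl[OF idn_cospan symm_cospan]
        tensor_idn add.assoc)
  also have "\<dots> = symm Q X (Y + Z)"
    by (simp only: symm_cl forward_comp[OF h legs_tensor[OF legs_symm legs_idn] h'] symm_hexagon)
  finally show ?case by simp
qed

text \<open>\<open>B\<close> is kept apart from \<open>L\<close>: in \<open>Cospan C\<close> all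
  arrows may be legs, but the generators come from \<open>A\<close>.\<close>

lemma prop_morphism_forward:
  assumes B: "B \<subseteq> L"
  shows "prop_morphism (restrict_prop P B) Q (\<lambda>f. cl (f, idn P (cod_of P f)))"
  unfolding prop_morphism_def
proof (intro conjI allI ballI, goal_cases)
  case (1 X Y f)
  then have f: "f \<in> hom P X Y" "f \<in> L" using B by (auto simp: restrict_prop_def)
  then show ?case by (simp add: restrict_prop_def cod_of_eq hom_QI[OF forward_cospan])
next
  case (2 X) show ?case by (simp add: restrict_prop_def cod_of_eq[OF idn_hom] idn_cl)
next
  case (3 X Y Z f g)
  then have f: "f \<in> hom P X Y" "f \<in> L" and g: "g \<in> hom P Y Z" "g \<in> L"
    using B by (auto simp: restrict_prop_def)
  show ?case
    using forward_comp[OF f forward_cospan[OF g]]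
    by (simp add: restrict_prop_def cod_of_eq[OF f(1)] cod_of_eq[OF g(1)] cod_of_eq[OF comp_hom[OF f(1) g(1)]])
next
  case (4 f g)
  then obtain X Y X' Y' where h: "f \<in> hom P X Y" "f \<in> B" "g \<in> hom P X' Y'" "g \<in> B"
    by (auto simp: restrict_prop_def arrows_def)
  then have f: "f \<in> hom P X Y" "f \<in> L" and g: "g \<in> hom P X' Y'" "g \<in> L" using B by auto
  show ?case
    using tensor_cl[OF forward_cospan[OF f] forward_cospan[OF g]]
    by (simp add: restrict_prop_def cod_of_eq[OF f(1)] cod_of_eq[OF g(1)]
        cod_of_eq[OF tensor_hom[OF f(1) g(1)]] tensor_idn)
next
  case (5 X Y) show ?case by (simp add: restrict_prop_def cod_of_eq[OF symm_hom] symm_cl)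
qed

lemma prop_morphism_backward:
  assumes B: "B \<subseteq> L"
  shows "prop_morphism (opposite (restrict_prop P B)) Q (\<lambda>g. cl (idn P (cod_of P g), g))"
  unfolding prop_morphism_def
proof (intro conjI allI ballI, goal_cases)
  case (1 X Y f)
  then have f: "f \<in> hom P Y X" "f \<in> L" using B by (auto simp: opposite_def restrict_prop_def)
  then show ?case by (simp add: opposite_def restrict_prop_def cod_of_eq hom_QI[OF backward_cospan])
next
  case (2 X) show ?case by (simp add: opposite_def restrict_prop_def cod_of_eq[OF idn_hom] idn_cl)
next
  case (3 X Y Z f g)
  then have f: "f \<in> hom P Y X" "f \<in> L" and g: "g \<in> hom P Z Y" "g \<in> L"
    using B by (auto simp: opposite_def restrict_prop_def)
  show ?case
    using comp_backward[OF backward_cospan[OF f] g]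
    by (simp add: opposite_def restrict_prop_def cod_of_eq[OF f(1)] cod_of_eq[OF g(1)]
        cod_of_eq[OF comp_hom[OF g(1) f(1)]])
next
  case (4 f g)
  then obtain X Y X' Y' where h: "f \<in> hom P X Y" "f \<in> B" "g \<in> hom P X' Y'" "g \<in> B"
    by (auto simp: opposite_def restrict_prop_def arrows_def)
  then have f: "f \<in> hom P X Y" "f \<in> L" and g: "g \<in> hom P X' Y'" "g \<in> L" using B by auto
  show ?case
    using tensor_cl[OF backward_cospan[OF f] backward_cospan[OF g]]
    by (simp add: opposite_def restrict_prop_def cod_of_eq[OF f(1)] cod_of_eq[OF g(1)]
        cod_of_eq[OF tensor_hom[OF f(1) g(1)]] tensor_idn)
next
  case (5 X Y)
  \<comment> \<open>The opposite prop sends its symmetry to a backward arrow, whereas the symmetry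
    of \<open>Q\<close> is a forward one. Following both legs with \<open>symm P X Y\<close> is an
    isomorphism between these cospans.\<close>
  have "((idn P (X + Y), symm P Y X), (idn P (X + Y) \<Zsemi> symm P X Y, symm P Y X \<Zsemi> symm P X Y)) \<in> r"
    using backward_cospan[OF symm_hom legs_symm] idn_hom symm_hom isos_symm by (rule r_iso)
  with backward_cospan[OF symm_hom legs_symm]
  have "cl (idn P (X + Y), symm P Y X) = cl (idn P (X + Y) \<Zsemi> symm P X Y, symm P Y X \<Zsemi> symm P X Y)"
    by (rule cl_eq)
  then have "cl (idn P (X + Y), symm P Y X) = cl (symm P X Y, idn P (Y + X))"
    by (simp only: idn_comp[OF symm_hom] symm_inverse)
  then show ?case
    by (simp add: opposite_def restrict_prop_def cod_of_eq[OF symm_hom] symm_cl)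
qed

end

text \<open>The axioms see the relation only at cospans with legs in \<open>L\<close>. Relations
  that differ elsewhere, such as one reflexive on all pairs and one confined to cospans, can thus
  share a proof.\<close>

lemma cospan_congruence_agree:
  assumes "cospan_congruence P L r"
    and agree: "\<And>X Y c c'. c \<in> leg_cospans P L X Y \<Longrightarrow> (c, c') \<in> r' \<longleftrightarrow> (c, c') \<in> r"
  shows "cospan_congruence P L r'"
proof -
  interpret cospan_congruence P L r by fact
  show ?thesis
  proof (unfold_locales, goal_cases)
    case (1 c X Y c') then show ?case using agree r_sym r_closed by metis
  next
    case (2 c X Y c' c'') then show ?case using agree r_trans r_closed by metis
  next
    case (3 c X Y) then show ?case using agree r_refl by metis
  next
    case (4 c X Y c') then show ?case using agree r_closed by metis
  next
    case (5 f g X Y f' g') then show ?case using agree r_swap swap_cospans by metis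
  next
    case (6 f g X Y f' g' h k Z p q p' q')
    have "((f, g), (f', g')) \<in> r" using 6(1,2) agree by simp
    with 6(1) have "((f \<Zsemi>\<^bsub>P\<^esub> p, k \<Zsemi>\<^bsub>P\<^esub> q), (f' \<Zsemi>\<^bsub>P\<^esub> p', k \<Zsemi>\<^bsub>P\<^esub> q')) \<in> r"
      using 6(3-5) by (rule r_comp)
    with leg_cospans_comp[OF 6(1,3,4)] agree show ?case by simp
  next
    case (7 f g X Y f' g' h k X' Y' h' k')
    have "((f, g), (f', g')) \<in> r" "((h, k), (h', k')) \<in> r" using 7 agree by simp_all
    then have "((f \<oplus>\<^bsub>P\<^esub> h, g \<oplus>\<^bsub>P\<^esub> k), (f' \<oplus>\<^bsub>P\<^esub> h', g' \<oplus>\<^bsub>P\<^esub> k')) \<in> r"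
      using r_tensor 7(1,3) by blast
    with leg_cospans_tensor[OF 7(1,3)] agree show ?case by simp
  qed
qed

text \<open>The same pushout of representatives computes composition in both quotients, so
  coarsening the classes preserves all operations. This is how \<open>\<Gamma>\<close> becomes a
  morphism.\<close>

lemma prop_morphism_coarser_congruence:
  assumes "cospan_congruence P L r" and "cospan_congruence P L r'" and sub: "r \<subseteq> r'"
  shows "prop_morphism (leg_cospan_quotient P L r) (leg_cospan_quotient P L r') (\<lambda>x. r' `` x)"
    and "c \<in> leg_cospans P L X Y \<Longrightarrow> r' `` (r `` {c}) = r' `` {c}"
proof -
  interpret A: cospan_congruence P L r by fact
  interpret B: cospan_congruence P L r' by fact
  have img: "r' `` (r `` {c}) = r' `` {c}" if "c \<in> leg_cospans P L X Y" for c X Y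
    using that A.r_refl[OF that] sub by (intro B.cl_image) auto
  then show "c \<in> leg_cospans P L X Y \<Longrightarrow> r' `` (r `` {c}) = r' `` {c}" .
  show "prop_morphism A.Q B.Q (\<lambda>x. r' `` x)"
    unfolding prop_morphism_def
  proof (intro conjI allI ballI, goal_cases)
    case (1 X Y x)
    then obtain f g where "x = A.cl (f, g)" "(f, g) \<in> leg_cospans P L X Y" by (rule A.hom_QE)
    then show ?case using img B.hom_QI by simp
  next
    case (2 X) show ?case unfolding A.idn_cl B.idn_cl by (rule img[OF A.idn_cospan])
  next
    case (3 X Y Z x y)
    from 3(1) obtain f g where x: "x = A.cl (f, g)" "(f, g) \<in> leg_cospans P L X Y" by (rule A.hom_QE)
    from 3(2) obtain h k where y: "y = A.cl (h, k)" "(h, k) \<in> leg_cospans P L Y Z" by (rule A.hom_QE)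
    from x(2) y(2) obtain p q where pq: "is_pushout P g h p q" by (rule A.leg_cospans_pushout_ex)
    show ?case
      by (simp only: x(1) y(1) A.comp_cl[OF x(2) y(2) pq] img[OF x(2)] img[OF y(2)]
          img[OF A.leg_cospans_comp[OF x(2) y(2) pq]] B.comp_cl[OF x(2) y(2) pq])
  next
    case (4 x y)
    then obtain X Y X' Y' where "x \<in> hom A.Q X Y" "y \<in> hom A.Q X' Y'" by (auto simp: arrows_def)
    then obtain f g h k where x: "x = A.cl (f, g)" "(f, g) \<in> leg_cospans P L X Y"
      and y: "y = A.cl (h, k)" "(h, k) \<in> leg_cospans P L X' Y'" by (elim A.hom_QE)
    show ?case
      by (simp only: x(1) y(1) A.tensor_cl[OF x(2) y(2)] img[OF x(2)] img[OF y(2)]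
          img[OF A.leg_cospans_tensor[OF x(2) y(2)]] B.tensor_cl[OF x(2) y(2)])
  next
    case (5 X Y) show ?case unfolding A.symm_cl B.symm_cl by (rule img[OF A.symm_cospan])
  qed
qed


section \<open>Cospans modulo a stable class of arrows\<close>

text \<open>Covers both \<open>S = isos P\<close> and \<open>S = M\<close>. \<open>S_pushout\<close>
  is costability; \<open>S_cancel\<close> keeps the legs in \<open>L\<close> when a step of a zigzag
  is taken backwards, where a leg \<open>f \<Zsemi> m\<close> is replaced by
  \<open>f\<close>.\<close>

locale stable_class = pushout_legs P L for P :: "'a prop_data" (structure) and L +
  fixes S :: "'a set"
  assumes S_isos: "isos P \<subseteq> S" and S_legs: "S \<subseteq> L"
    and S_comp: "m \<in> S \<Longrightarrow> n \<in> S \<Longrightarrow> m \<in> hom P X Y \<Longrightarrow> n \<in> hom P Y Z \<Longrightarrow> m \<Zsemi> n \<in> S"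
    and S_tensor: "m \<in> S \<Longrightarrow> n \<in> S \<Longrightarrow> m \<in> hom P X Y \<Longrightarrow> n \<in> hom P X' Y' \<Longrightarrow> m \<oplus> n \<in> S"
    and S_pushout: "is_pushout P f g p q \<Longrightarrow> f \<in> S \<Longrightarrow> q \<in> S"
    and S_cancel: "f \<in> hom P X Y \<Longrightarrow> m \<in> hom P Y Z \<Longrightarrow> m \<in> S \<Longrightarrow> f \<Zsemi> m \<in> L \<Longrightarrow> f \<in> L"
begin

lemma cospan_mapI:
  "f \<in> hom P X N \<Longrightarrow> g \<in> hom P Y N \<Longrightarrow> m \<in> hom P N N' \<Longrightarrow> m \<in> S
    \<Longrightarrow> cospan_map P S (f, g) (f \<Zsemi> m, g \<Zsemi> m)"
  unfolding cospan_map_def by blast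

lemma cospan_mapE:
  assumes "cospan_map P S (f, g) c"
  obtains X Y N N' m where "f \<in> hom P X N" "g \<in> hom P Y N" "m \<in> hom P N N'" "m \<in> S"
    "c = (f \<Zsemi> m, g \<Zsemi> m)"
  using assms unfolding cospan_map_def by auto

lemma cospan_map_leg:
  assumes "cospan_map P S c c'"
  shows "c \<in> leg_cospans P L X Y \<longleftrightarrow> c' \<in> leg_cospans P L X Y"
proof -
  obtain f g where c: "c = (f, g)" by (cases c)
  from assms[unfolded c] obtain X1 Y1 N N' m where f: "f \<in> hom P X1 N" and g: "g \<in> hom P Y1 N"
    and m: "m \<in> hom P N N'" "m \<in> S" and c': "c' = (f \<Zsemi> m, g \<Zsemi> m)"
    by (rule cospan_mapE)
  note fm = comp_hom[OF f m(1)] and gm = comp_hom[OF g m(1)]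
  have mL: "m \<in> L" using m(2) S_legs by blast
  show ?thesis unfolding c c'
  proof
    assume "(f, g) \<in> leg_cospans P L X Y"
    then obtain N1 where h: "f \<in> hom P X N1" "f \<in> L" "g \<in> hom P Y N1" "g \<in> L" by (rule leg_cospansE)
    have "X1 = X" "Y1 = Y" using hom_disjoint[OF f h(1)] hom_disjoint[OF g h(3)] by auto
    then show "(f \<Zsemi> m, g \<Zsemi> m) \<in> leg_cospans P L X Y"
      using fm gm legs_comp[OF h(2) mL f m(1)] legs_comp[OF h(4) mL g m(1)] by (intro leg_cospansI) auto
  next
    assume "(f \<Zsemi> m, g \<Zsemi> m) \<in> leg_cospans P L X Y"
    then obtain N1 where h: "f \<Zsemi> m \<in> hom P X N1" "f \<Zsemi> m \<in> L" "g \<Zsemi> m \<in> hom P Y N1" "g \<Zsemi> m \<in> L"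
      by (rule leg_cospansE)
    have "X1 = X" "Y1 = Y" using hom_disjoint[OF fm h(1)] hom_disjoint[OF gm h(3)] by auto
    then show "(f, g) \<in> leg_cospans P L X Y"
      using f g S_cancel[OF f m h(2)] S_cancel[OF g m h(4)] by (intro leg_cospansI) auto
  qed
qed

lemma corel_leg:
  "(c, c') \<in> corel_equiv P S \<Longrightarrow> c \<in> leg_cospans P L X Y \<Longrightarrow> c' \<in> leg_cospans P L X Y"
  unfolding corel_equiv_def mem_Collect_eq prod.case
  by (induction rule: equivclp_induct) (use cospan_map_leg in blast)+

lemma cospan_map_corel: "cospan_map P S c c' \<Longrightarrow> (c, c') \<in> corel_equiv P S"
  unfolding corel_equiv_def by (simp add: r_into_equivclp)

lemma corel_refl: "(c, c) \<in> corel_equiv P S"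
  and corel_sym: "(c, c') \<in> corel_equiv P S \<Longrightarrow> (c', c) \<in> corel_equiv P S"
  and corel_trans: "(c, c') \<in> corel_equiv P S \<Longrightarrow> (c', c'') \<in> corel_equiv P S \<Longrightarrow> (c, c'') \<in> corel_equiv P S"
  unfolding corel_equiv_def by (auto intro: equivclp_sym equivclp_trans)

text \<open>Induction along a zigzag that also records the typing of the intermediate cospans, which
  \<open>equivclp_induct\<close> would lose.\<close>

lemma corel_induct [consumes 2, case_names base step]:
  assumes "(c, d) \<in> corel_equiv P S" and "c \<in> leg_cospans P L X Y"
    and "R c"
    and "\<And>d d'. (c, d) \<in> corel_equiv P S \<Longrightarrow> d \<in> leg_cospans P L X Y \<Longrightarrow> d' \<in> leg_cospans P L X Y
      \<Longrightarrow> cospan_map P S d d' \<or> cospan_map P S d' d \<Longrightarrow> R d \<Longrightarrow> R d'"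
  shows "R d"
proof -
  have "equivclp (cospan_map P S) c d" using assms(1) by (simp add: corel_equiv_def)
  then show ?thesis
  proof (induction rule: equivclp_induct)
    case base show ?case by (rule assms(3))
  next
    case (step d d')
    have cd: "(c, d) \<in> corel_equiv P S" using step.hyps(1) by (simp add: corel_equiv_def)
    have d: "d \<in> leg_cospans P L X Y" using cd assms(2) by (rule corel_leg)
    then have "d' \<in> leg_cospans P L X Y" using cospan_map_leg step.hyps(2) by blast
    with cd d step show ?case by (intro assms(4)[of d d']) auto
  qed
qed

text \<open>
  Both pushouts are compared through the pushout of \<open>m\<close> along \<open>p\<close>, which pastes to one of
  \<open>g \<Zsemi> m\<close> and \<open>h\<close>.
\<close>

lemma cospan_map_comp:
  assumes fg: "(f, g) \<in> leg_cospans P L X Y" and hk: "(h, k) \<in> leg_cospans P L Y Z"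
    and step: "cospan_map P S (f, g) (f', g')"
    and po: "is_pushout P g h p q" and po': "is_pushout P g' h p' q'"
  shows "cospan_map P S (f \<Zsemi> p, k \<Zsemi> q) (f' \<Zsemi> p', k \<Zsemi> q')"
proof -
  from step obtain X1 Y1 N N' m where f: "f \<in> hom P X1 N" and g: "g \<in> hom P Y1 N"
    and m: "m \<in> hom P N N'" "m \<in> S" and c': "(f', g') = (f \<Zsemi> m, g \<Zsemi> m)"
    by (rule cospan_mapE)
  from fg obtain N1 where legs: "f \<in> hom P X N1" "f \<in> L" "g \<in> hom P Y N1" "g \<in> L" by (rule leg_cospansE)
  from hk obtain M where h: "h \<in> hom P Y M" "h \<in> L" "k \<in> hom P Z M" "k \<in> L" by (rule leg_cospansE)
  from po g h(1) obtain Q where p: "p \<in> hom P N Q" and q: "q \<in> hom P M Q" by (rule pushout_hom)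
  have "p \<in> L" using legs_pushout[OF po legs(4) h(2)] by blast
  with m p S_legs obtain a b where ab: "is_pushout P m p a b" using legs_pushout_ex by blast
  from ab m(1) p obtain T where a: "a \<in> hom P N' T" and b: "b \<in> hom P Q T" and eq: "m \<Zsemi> a = p \<Zsemi> b"
    by (rule pushout_hom)
  have po'': "is_pushout P (g \<Zsemi> m) h a (q \<Zsemi> b)" using po ab by (rule pushout_paste)
  moreover have "is_pushout P (g \<Zsemi> m) h p' q'" using po' c' by simp
  ultimately obtain i T' where i: "i \<in> hom P T T'" "i \<in> isos P" "a \<Zsemi> i = p'" "q \<Zsemi> b \<Zsemi> i = q'"
    using a comp_hom[OF q b] by (rule pushout_unique)
  \<comment> \<open>The given pushout differs from the pasted one by \<open>i\<close>, so the map
    between the two composites is \<open>b\<close> corrected by \<open>i\<close>.\<close>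
  have bi: "b \<Zsemi> i \<in> hom P Q T'" "b \<Zsemi> i \<in> S"
    using b i(1,2) S_pushout[OF ab m(2)] S_isos S_comp comp_hom by blast+
  have "f' \<Zsemi> p' = f \<Zsemi> m \<Zsemi> (a \<Zsemi> i)" using c' i(3) by simp
  also have "\<dots> = f \<Zsemi> (m \<Zsemi> a \<Zsemi> i)"
    by (simp only: comp_assoc[OF f m(1) comp_hom[OF a i(1)]] comp_assoc[OF m(1) a i(1)])
  also have "\<dots> = f \<Zsemi> p \<Zsemi> (b \<Zsemi> i)"
    by (simp only: eq comp_assoc[OF p b i(1)] comp_assoc[OF f p bi(1)])
  finally have 1: "f' \<Zsemi> p' = f \<Zsemi> p \<Zsemi> (b \<Zsemi> i)" .
  have 2: "k \<Zsemi> q' = k \<Zsemi> q \<Zsemi> (b \<Zsemi> i)"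
    by (simp only: i(4)[symmetric] comp_assoc[OF q b i(1)] comp_assoc[OF h(3) q bi(1)])
  show ?thesis unfolding 1 2 using comp_hom[OF f p] comp_hom[OF h(3) q] bi by (rule cospan_mapI)
qed

text \<open>Tensoring \<open>m\<close> with the identity of the other apex stays in
  \<open>S\<close>. One-sided steps suffice, since two zigzags can be run one after the
  other.\<close>

lemma cospan_map_tensor:
  assumes "cospan_map P S (f, g) (f', g')" and "h \<in> hom P X N" and "k \<in> hom P Y N"
  shows "cospan_map P S (f \<oplus> h, g \<oplus> k) (f' \<oplus> h, g' \<oplus> k)"
    and "cospan_map P S (h \<oplus> f, k \<oplus> g) (h \<oplus> f', k \<oplus> g')"
proof -
  from assms(1) obtain X1 Y1 N1 N' m where f: "f \<in> hom P X1 N1" and g: "g \<in> hom P Y1 N1"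
    and m: "m \<in> hom P N1 N'" "m \<in> S" and c': "(f', g') = (f \<Zsemi> m, g \<Zsemi> m)"
    by (rule cospan_mapE)
  note h = assms(2) and k = assms(3)
  have idn: "idn P N \<in> S" using isos_idn S_isos by blast
  have eq: "f' \<oplus> h = (f \<oplus> h) \<Zsemi> (m \<oplus> idn P N)" "g' \<oplus> k = (g \<oplus> k) \<Zsemi> (m \<oplus> idn P N)"
    "h \<oplus> f' = (h \<oplus> f) \<Zsemi> (idn P N \<oplus> m)" "k \<oplus> g' = (k \<oplus> g) \<Zsemi> (idn P N \<oplus> m)"
    using c' tensor_comp[OF f m(1) h idn_hom] tensor_comp[OF g m(1) k idn_hom]
      tensor_comp[OF h idn_hom f m(1)] tensor_comp[OF k idn_hom g m(1)]
    by (simp_all add: comp_idn[OF h] comp_idn[OF k])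
  show "cospan_map P S (f \<oplus> h, g \<oplus> k) (f' \<oplus> h, g' \<oplus> k)"
    unfolding eq using tensor_hom[OF f h] tensor_hom[OF g k] tensor_hom[OF m(1) idn_hom]
      S_tensor[OF m(2) idn m(1) idn_hom] by (rule cospan_mapI)
  show "cospan_map P S (h \<oplus> f, k \<oplus> g) (h \<oplus> f', k \<oplus> g')"
    unfolding eq using tensor_hom[OF h f] tensor_hom[OF k g] tensor_hom[OF idn_hom m(1)]
      S_tensor[OF idn m(2) idn_hom m(1)] by (rule cospan_mapI)
qed

lemma cospan_map_swap: "cospan_map P S (f, g) (f', g') \<Longrightarrow> cospan_map P S (g, f) (g', f')"
  unfolding cospan_map_def by blast

lemma corel_of_steps:
  "cospan_map P S d d' \<or> cospan_map P S d' d \<Longrightarrow> (c, d) \<in> corel_equiv P S \<Longrightarrow> (c, d') \<in> corel_equiv P S"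
  using cospan_map_corel corel_sym corel_trans by blast

lemma corel_swap:
  assumes "((f, g), (f', g')) \<in> corel_equiv P S" and "(f, g) \<in> leg_cospans P L X Y"
  shows "((g, f), (g', f')) \<in> corel_equiv P S"
proof -
  \<comment> \<open>The projections present the goal as a property of the pair at the end of the
    zigzag, the form that the induction needs.\<close>
  have "((g, f), (snd (f', g'), fst (f', g'))) \<in> corel_equiv P S"
    using assms
  proof (induction rule: corel_induct)
    case base show ?case by (simp add: corel_refl)
  next
    case (step d d')
    show ?case
      by (rule corel_of_steps[OF _ step.IH]) (use step(4) cospan_map_swap in \<open>cases d; cases d'; auto\<close>)
  qed
  then show ?thesis by simp
qed

lemma corel_comp:
  assumes fg: "(f, g) \<in> leg_cospans P L X Y" and fg': "((f, g), (f', g')) \<in> corel_equiv P S"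
    and hk: "(h, k) \<in> leg_cospans P L Y Z"
    and po: "is_pushout P g h p q" and po': "is_pushout P g' h p' q'"
  shows "((f \<Zsemi> p, k \<Zsemi> q), (f' \<Zsemi> p', k \<Zsemi> q')) \<in> corel_equiv P S"
proof -
  \<comment> \<open>The base case must still compare two pushouts of one span. Viewing the cospan as
    mapped to itself by an identity makes \<open>cospan_map_comp\<close> do this.\<close>
  have self: "cospan_map P S d d" if d: "d \<in> leg_cospans P L X Y" for d
  proof (cases d)
    case (Pair f g)
    from d[unfolded Pair] obtain N where f: "f \<in> hom P X N" and "f \<in> L" and g: "g \<in> hom P Y N" and "g \<in> L"
      by (rule leg_cospansE)
    have "idn P N \<in> S" using isos_idn S_isos by blast
    from cospan_mapI[OF f g idn_hom this] show ?thesis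
      by (simp only: Pair comp_idn[OF f] comp_idn[OF g])
  qed
  \<comment> \<open>The pushout is generalised because it changes with every step of the
    zigzag.\<close>
  have "\<forall>p' q'. is_pushout P (snd (f', g')) h p' q'
      \<longrightarrow> ((f \<Zsemi> p, k \<Zsemi> q), (fst (f', g') \<Zsemi> p', k \<Zsemi> q')) \<in> corel_equiv P S"
    using fg' fg
  proof (induction rule: corel_induct)
    case base
    show ?case using cospan_map_comp[OF fg hk self[OF fg] po] cospan_map_corel by simp
  next
    case (step d d')
    obtain f1 g1 f2 g2 where d: "d = (f1, g1)" and d': "d' = (f2, g2)" by (cases d, cases d')
    have fg1: "(f1, g1) \<in> leg_cospans P L X Y" and fg2: "(f2, g2) \<in> leg_cospans P L X Y"
      using step(2,3) d d' by simp_all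
    obtain p1 q1 where po1: "is_pushout P g1 h p1 q1" using fg1 hk by (rule leg_cospans_pushout_ex)
    have IH: "((f \<Zsemi> p, k \<Zsemi> q), (f1 \<Zsemi> p1, k \<Zsemi> q1)) \<in> corel_equiv P S" using step.IH d po1 by simp
    show ?case
    proof (intro allI impI)
      fix p2 q2 assume "is_pushout P (snd d') h p2 q2"
      then have po2: "is_pushout P g2 h p2 q2" using d' by simp
      have "cospan_map P S (f1 \<Zsemi> p1, k \<Zsemi> q1) (f2 \<Zsemi> p2, k \<Zsemi> q2)
          \<or> cospan_map P S (f2 \<Zsemi> p2, k \<Zsemi> q2) (f1 \<Zsemi> p1, k \<Zsemi> q1)"
        using step(4) d d' cospan_map_comp[OF fg1 hk _ po1 po2] cospan_map_comp[OF fg2 hk _ po2 po1] by blast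
      from corel_of_steps[OF this IH]
      show "((f \<Zsemi> p, k \<Zsemi> q), (fst d' \<Zsemi> p2, k \<Zsemi> q2)) \<in> corel_equiv P S" using d' by simp
    qed
  qed
  with po' show ?thesis by simp
qed

lemma corel_tensor:
  assumes fg: "(f, g) \<in> leg_cospans P L X Y" and fg': "((f, g), (f', g')) \<in> corel_equiv P S"
    and hk: "(h, k) \<in> leg_cospans P L X' Y'" and hk': "((h, k), (h', k')) \<in> corel_equiv P S"
  shows "((f \<oplus> h, g \<oplus> k), (f' \<oplus> h', g' \<oplus> k')) \<in> corel_equiv P S"
proof -
  from hk obtain N where h: "h \<in> hom P X' N" "h \<in> L" "k \<in> hom P Y' N" "k \<in> L" by (rule leg_cospansE)
  have "((f \<oplus> h, g \<oplus> k), (fst (f', g') \<oplus> h, snd (f', g') \<oplus> k)) \<in> corel_equiv P S"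
    using fg' fg
  proof (induction rule: corel_induct)
    case base show ?case by (simp add: corel_refl)
  next
    case (step d d')
    show ?case
      by (rule corel_of_steps[OF _ step.IH])
        (use step(4) cospan_map_tensor(1)[OF _ h(1,3)] in \<open>cases d; cases d'; auto\<close>)
  qed
  then have 1: "((f \<oplus> h, g \<oplus> k), (f' \<oplus> h, g' \<oplus> k)) \<in> corel_equiv P S" by simp
  have "(f', g') \<in> leg_cospans P L X Y" using fg' fg by (rule corel_leg)
  then obtain N' where f': "f' \<in> hom P X N'" "f' \<in> L" "g' \<in> hom P Y N'" "g' \<in> L" by (rule leg_cospansE)
  have "((f' \<oplus> h, g' \<oplus> k), (f' \<oplus> fst (h', k'), g' \<oplus> snd (h', k'))) \<in> corel_equiv P S"
    using hk' hk
  proof (induction rule: corel_induct)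
    case base show ?case by (simp add: corel_refl)
  next
    case (step d d')
    show ?case
      by (rule corel_of_steps[OF _ step.IH])
        (use step(4) cospan_map_tensor(2)[OF _ f'(1,3)] in \<open>cases d; cases d'; auto\<close>)
  qed
  with 1 show ?thesis using corel_trans by simp
qed

lemma cospan_congruence_corel: "cospan_congruence P L (corel_equiv P S)"
proof (unfold_locales, goal_cases)
  case (1 c X Y c') show ?case using 1(2) by (rule corel_sym)
next
  case (2 c X Y c' c'') show ?case using 2(2,3) by (rule corel_trans)
next
  case (3 c X Y) show ?case by (rule corel_refl)
next
  case (4 c X Y c') show ?case using 4(2,1) by (rule corel_leg)
next
  case (5 f g X Y f' g') show ?case using 5(2,1) by (rule corel_swap)
next
  case (6 f g X Y f' g' h k Z p q p' q') then show ?case by (rule corel_comp)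
next
  case (7 f g X Y f' g' h k X' Y' h' k') then show ?case by (rule corel_tensor)
qed

end

section \<open>Isomorphism as the smallest stable class\<close>

context pushout_legs
begin

lemma stable_class_isos: "stable_class P L (isos P)"
proof (unfold_locales, goal_cases)
  case 2 show ?case by (rule legs_isos)
next
  case (3 m n X Y Z) then show ?case using isos_comp by blast
next
  case (4 m n X Y X' Y') then show ?case using isos_tensor by blast
next
  case (5 f g p q) then show ?case by (rule pushout_isos)
next
  case (6 f X Y m Z)
  obtain j where j: "j \<in> hom P Z Y" "m \<Zsemi> j = idn P Y" "j \<Zsemi> m = idn P Z" "j \<in> isos P"
    using 6(3,2) by (rule isosE)
  \<comment> \<open>Composing with the inverse of \<open>m\<close> recovers \<open>f\<close>, and
    this inverse is itself an admissible leg.\<close>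
  have "f \<Zsemi> m \<Zsemi> j \<in> L" using 6 j legs_isos comp_hom legs_comp by blast
  then show ?case by (simp only: comp_assoc[OF 6(1,2) j(1)] j(2) comp_idn[OF 6(1)])
qed simp

text \<open>Isomorphisms compose and invert, so a zigzag of them collapses to a single one. Thus the
  one-step relation is already the generated equivalence on these cospans.\<close>

lemma corel_equiv_isos:
  assumes c: "(f, g) \<in> leg_cospans P L X Y"
  shows "((f, g), c') \<in> corel_equiv P (isos P) \<longleftrightarrow> cospan_map P (isos P) (f, g) c'"
proof -
  interpret stable_class P L "isos P" by (rule stable_class_isos)
  from c obtain N where f: "f \<in> hom P X N" "f \<in> L" and g: "g \<in> hom P Y N" "g \<in> L" by (rule leg_cospansE)
  have "cospan_map P (isos P) (f, g) c'" if "((f, g), c') \<in> corel_equiv P (isos P)"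
    using that c
  proof (induction rule: corel_induct)
    case base
    show ?case using cospan_mapI[OF f(1) g(1) idn_hom isos_idn] by (simp add: comp_idn[OF f(1)] comp_idn[OF g(1)])
  next
    case (step d d')
    obtain X1 Y1 N1 N' i where 1: "f \<in> hom P X1 N1" "g \<in> hom P Y1 N1" and i: "i \<in> hom P N1 N'" "i \<in> isos P"
      and d: "d = (f \<Zsemi> i, g \<Zsemi> i)" using step.IH by (rule cospan_mapE)
    have "N1 = N" using hom_disjoint[OF f(1) 1(1)] by simp
    note i = i[unfolded this]
    from step(4) show ?case
    proof
      assume "cospan_map P (isos P) d d'"
      then obtain X2 Y2 N2 N'' i' where 2: "f \<Zsemi> i \<in> hom P X2 N2" "g \<Zsemi> i \<in> hom P Y2 N2"
        and i': "i' \<in> hom P N2 N''" "i' \<in> isos P" and d': "d' = (f \<Zsemi> i \<Zsemi> i', g \<Zsemi> i \<Zsemi> i')"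
        unfolding d by (rule cospan_mapE)
      have "N2 = N'" using hom_disjoint[OF 2(1) comp_hom[OF f(1) i(1)]] by simp
      note i' = i'[unfolded this]
      have eq: "d' = (f \<Zsemi> (i \<Zsemi> i'), g \<Zsemi> (i \<Zsemi> i'))"
        by (simp only: d' comp_assoc[OF f(1) i(1) i'(1)] comp_assoc[OF g(1) i(1) i'(1)])
      show ?thesis unfolding eq
        using f(1) g(1) comp_hom[OF i(1) i'(1)] isos_comp[OF i(2,1) i'(2,1)] by (rule cospan_mapI)
    next
      obtain h k where hk: "d' = (h, k)" by (cases d')
      assume "cospan_map P (isos P) d' d"
      then obtain X2 Y2 N2 N'' i' where 2: "h \<in> hom P X2 N2" "k \<in> hom P Y2 N2"
        and i': "i' \<in> hom P N2 N''" "i' \<in> isos P" and d': "d = (h \<Zsemi> i', k \<Zsemi> i')"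
        unfolding hk by (rule cospan_mapE)
      have eq: "f \<Zsemi> i = h \<Zsemi> i'" "g \<Zsemi> i = k \<Zsemi> i'" using d d' by simp_all
      have "f \<Zsemi> i \<in> hom P X2 N''" unfolding eq using 2(1) i'(1) by (rule comp_hom)
      then have "N'' = N'" using hom_disjoint[OF _ comp_hom[OF f(1) i(1)]] by blast
      note i' = i'[unfolded this]
      obtain j where j: "j \<in> hom P N' N2" "i' \<Zsemi> j = idn P N2" "j \<Zsemi> i' = idn P N'" "j \<in> isos P"
        using i'(2,1) by (rule isosE)
      have "f \<Zsemi> (i \<Zsemi> j) = h"
        by (simp only: comp_assoc[OF f(1) i(1) j(1), symmetric] eq comp_assoc[OF 2(1) i'(1) j(1)] j(2) comp_idn[OF 2(1)])
      moreover have "g \<Zsemi> (i \<Zsemi> j) = k"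
        by (simp only: comp_assoc[OF g(1) i(1) j(1), symmetric] eq comp_assoc[OF 2(2) i'(1) j(1)] j(2) comp_idn[OF 2(2)])
      ultimately show ?thesis unfolding hk
        using cospan_mapI[OF f(1) g(1) comp_hom[OF i(1) j(1)] isos_comp[OF i(2,1) j(4,1)]] by simp
    qed
  qed
  then show ?thesis using cospan_map_corel by blast
qed

lemma cospan_congruence_isos:
  assumes "\<And>f g X Y c'. (f, g) \<in> leg_cospans P L X Y \<Longrightarrow> ((f, g), c') \<in> r \<longleftrightarrow> cospan_map P (isos P) (f, g) c'"
  shows "cospan_congruence P L r"
proof (rule cospan_congruence_agree)
  show "cospan_congruence P L (corel_equiv P (isos P))"
    using stable_class_isos by (rule stable_class.cospan_congruence_corel)
  fix X Y c c' assume "c \<in> leg_cospans P L X Y"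
  then show "(c, c') \<in> r \<longleftrightarrow> (c, c') \<in> corel_equiv P (isos P)"
    using assms corel_equiv_isos by (cases c) blast
qed

end


section \<open>Spans as cospans in the opposite prop\<close>

lemma opposite_simps [simp]:
  "hom (opposite P) X Y = hom P Y X" "cmp (opposite P) f g = g \<Zsemi>\<^bsub>P\<^esub> f"
  "idn (opposite P) = idn P" "tensor (opposite P) = tensor P" "symm (opposite P) X Y = symm P Y X"
  by (simp_all add: opposite_def)

lemma arrows_opposite [simp]: "arrows (opposite P) = arrows P"
  unfolding arrows_def by auto

lemma isos_opposite [simp]: "isos (opposite P) = isos P"
  unfolding isos_def by auto

lemma opposite_opposite: "opposite (opposite P) = P"
  by (cases P) (simp add: opposite_def)

lemma opposite_restrict: "restrict_prop (opposite P) A = opposite (restrict_prop P A)"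
  by (simp add: opposite_def restrict_prop_def)

lemma is_pushout_opposite: "is_pushout (opposite P) f g p q \<longleftrightarrow> is_pullback P f g p q"
  unfolding is_pushout_def is_pullback_def by simp

lemma dom_of_opposite: "cod_of (opposite P) f = dom_of P f"
  unfolding cod_of_def dom_of_def by simp

lemma (in is_prop) is_prop_opposite: "is_prop (opposite P)"
proof (unfold_locales, goal_cases)
  case (1 f X Y X' Y') then show ?case using hom_disjoint by auto
next
  case (4 f W X g Y h Z) then show ?case using comp_assoc by simp
next
  case (9 f X Y g Z f' X' Y' g' Z') then show ?case using tensor_comp by simp
next
  case (10 f X Y f' X' Y' f'' X'' Y'') then show ?case using tensor_assoc by simp
next
  case (14 f X Y f' X' Y') then show ?case using symm_natural by simp
next
  \<comment> \<open>This is the other hexagon of \<open>P\<close>. Both \<open>?s\<close> and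
    \<open>b' \<Zsemi> a'\<close> are inverse to \<open>a \<Zsemi> b\<close>, which the given
    hexagon identifies with a symmetry, so they coincide.\<close>
  case (16 X Y Z)
  define a b a' b' where ab: "a = symm P X Y \<oplus> idn P Z" "b = idn P Y \<oplus> symm P X Z"
    "a' = symm P Y X \<oplus> idn P Z" "b' = idn P Y \<oplus> symm P Z X"
  let ?s = "symm P (Y + Z) X"
  have s: "?s \<in> hom P (Y + Z + X) (X + Y + Z)" using symm_hom[of "Y + Z" X] by (simp add: add.assoc)
  have a: "a \<in> hom P (X + Y + Z) (Y + X + Z)" "a' \<in> hom P (Y + X + Z) (X + Y + Z)"
    unfolding ab by (intro tensor_hom symm_hom idn_hom)+
  have b: "b \<in> hom P (Y + X + Z) (Y + Z + X)" "b' \<in> hom P (Y + Z + X) (Y + X + Z)"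
    unfolding ab using tensor_hom[OF idn_hom symm_hom] by (simp_all add: add.assoc)
  have aa: "a \<Zsemi> a' = idn P (X + Y + Z)"
    unfolding ab using tensor_comp[OF symm_hom symm_hom idn_hom idn_hom, of X Y Z]
    by (simp add: symm_inverse idn_comp[OF idn_hom] tensor_idn)
  have bb: "b \<Zsemi> b' = idn P (Y + X + Z)"
    unfolding ab using tensor_comp[OF idn_hom idn_hom symm_hom symm_hom, of Y X Z]
    by (simp add: symm_inverse idn_comp[OF idn_hom] tensor_idn add.assoc)
  have sab: "?s \<Zsemi> (a \<Zsemi> b) = idn P (Y + Z + X)"
    unfolding ab symm_hexagon[symmetric] by (rule symm_inverse)
  have "a \<Zsemi> b \<Zsemi> (b' \<Zsemi> a') = a \<Zsemi> (b \<Zsemi> b' \<Zsemi> a')"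
    by (simp only: comp_assoc[OF a(1) b(1) comp_hom[OF b(2) a(2)]] comp_assoc[OF b(1) b(2) a(2)])
  then have inv: "a \<Zsemi> b \<Zsemi> (b' \<Zsemi> a') = idn P (X + Y + Z)" by (simp only: bb idn_comp[OF a(2)] aa)
  have "?s = ?s \<Zsemi> (a \<Zsemi> b \<Zsemi> (b' \<Zsemi> a'))" by (simp only: inv comp_idn[OF s])
  also have "\<dots> = ?s \<Zsemi> (a \<Zsemi> b) \<Zsemi> (b' \<Zsemi> a')"
    by (rule comp_assoc[OF s comp_hom[OF a(1) b(1)] comp_hom[OF b(2) a(2)], symmetric])
  also have "\<dots> = b' \<Zsemi> a'" by (simp only: sab idn_comp[OF comp_hom[OF b(2) a(2)]])
  finally show ?case by (simp add: ab)
qed (auto intro: idn_hom comp_hom tensor_hom symm_hom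
      simp: idn_comp comp_idn tensor_idn idn0_tensor tensor_idn0 symm_inverse)

lemma (in is_prop) is_prop_restrict:
  assumes "sub_prop P B"
  shows "is_prop (restrict_prop P B)"
proof -
  have B: "idn P X \<in> B" "symm P X Y \<in> B"
    "f \<in> hom P X Y \<Longrightarrow> g \<in> hom P Y Z \<Longrightarrow> f \<in> B \<Longrightarrow> g \<in> B \<Longrightarrow> f \<Zsemi> g \<in> B"
    "f \<in> B \<Longrightarrow> g \<in> B \<Longrightarrow> f \<oplus> g \<in> B" for X Y Z f g
    using assms unfolding sub_prop_def by blast+
  show ?thesis
    unfolding restrict_prop_def
  proof (unfold_locales, goal_cases)
    case (1 f X Y X' Y') then show ?case using hom_disjoint by auto
  next
    case (3 f X Y g Z) then show ?case using comp_hom B(3) by auto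
  next
    case (4 f W X g Y h Z) then show ?case using comp_assoc by auto
  next
    case (7 f X Y f' X' Y') then show ?case using tensor_hom B(4) by auto
  next
    case (9 f X Y g Z f' X' Y' g' Z') then show ?case using tensor_comp by auto
  next
    case (10 f X Y f' X' Y' f'' X'' Y'') then show ?case using tensor_assoc by auto
  next
    case (14 f X Y f' X' Y') then show ?case using symm_natural by auto
  next
    case (16 X Y Z) show ?case using symm_hexagon by simp
  qed (auto intro: idn_hom symm_hom B simp: idn_comp comp_idn tensor_idn idn0_tensor tensor_idn0 symm_inverse)
qed

section \<open>Composing and factoring morphisms of props\<close>

lemma prop_morphism_compose:
  assumes F: "prop_morphism P Q F" and G: "prop_morphism Q R G"
  shows "prop_morphism P R (\<lambda>x. G (F x))"
  unfolding prop_morphism_def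
proof (intro conjI allI ballI, goal_cases)
  case (1 X Y f) then show ?case by (intro prop_morphismD(1)[OF G] prop_morphismD(1)[OF F])
next
  case (2 X) show ?case by (simp only: prop_morphismD(2)[OF F] prop_morphismD(2)[OF G])
next
  case (3 X Y Z f g)
  show ?case
    by (simp only: prop_morphismD(3)[OF F 3]
        prop_morphismD(3)[OF G prop_morphismD(1)[OF F 3(1)] prop_morphismD(1)[OF F 3(2)]])
next
  case (4 f g)
  then obtain X Y X' Y' where f: "f \<in> hom P X Y" and g: "g \<in> hom P X' Y'" by (auto simp: arrows_def)
  show ?case
    by (simp only: prop_morphismD(4)[OF F f g]
        prop_morphismD(4)[OF G prop_morphismD(1)[OF F f] prop_morphismD(1)[OF F g]])
next
  case (5 X Y) show ?case by (simp only: prop_morphismD(5)[OF F] prop_morphismD(5)[OF G])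
qed

text \<open>Lifts along \<open>G\<close> stay in the same hom-set, so composable arrows lift to
  composable ones and every law for \<open>W\<close> is inherited from \<open>V\<close>.\<close>

lemma prop_morphism_factor:
  assumes G: "prop_morphism P Q G" and V: "prop_morphism P D V"
    and surj: "\<And>X Y x. x \<in> hom Q X Y \<Longrightarrow> \<exists>y \<in> hom P X Y. G y = x"
    and W: "\<And>X Y y. y \<in> hom P X Y \<Longrightarrow> W (G y) = V y"
    and idn: "\<And>X. idn P X \<in> hom P X X" and symm: "\<And>X Y. symm P X Y \<in> hom P (X + Y) (Y + X)"
    and comp: "\<And>X Y Z f g. f \<in> hom P X Y \<Longrightarrow> g \<in> hom P Y Z \<Longrightarrow> f \<Zsemi>\<^bsub>P\<^esub> g \<in> hom P X Z"
    and tensor: "\<And>X Y X' Y' f g. f \<in> hom P X Y \<Longrightarrow> g \<in> hom P X' Y'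
      \<Longrightarrow> f \<oplus>\<^bsub>P\<^esub> g \<in> hom P (X + X') (Y + Y')"
  shows "prop_morphism Q D W"
  unfolding prop_morphism_def
proof (intro conjI allI ballI, goal_cases)
  case (1 X Y x)
  then obtain y where y: "y \<in> hom P X Y" "G y = x" using surj by blast
  show ?case using prop_morphismD(1)[OF V y(1)] W[OF y(1)] y(2) by simp
next
  case (2 X)
  show ?case using W[OF idn] prop_morphismD(2)[OF G] prop_morphismD(2)[OF V] by metis
next
  case (3 X Y Z x x')
  from 3(1) obtain y where y: "y \<in> hom P X Y" "G y = x" using surj by blast
  from 3(2) obtain y' where y': "y' \<in> hom P Y Z" "G y' = x'" using surj by blast
  show ?case
    by (simp only: y(2)[symmetric] y'(2)[symmetric] prop_morphismD(3)[OF G y(1) y'(1), symmetric]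
        W[OF comp[OF y(1) y'(1)]] W[OF y(1)] W[OF y'(1)] prop_morphismD(3)[OF V y(1) y'(1)])
next
  case (4 x x')
  then obtain X Y X' Y' where x: "x \<in> hom Q X Y" "x' \<in> hom Q X' Y'" by (auto simp: arrows_def)
  from x(1) obtain y where y: "y \<in> hom P X Y" "G y = x" using surj by blast
  from x(2) obtain y' where y': "y' \<in> hom P X' Y'" "G y' = x'" using surj by blast
  show ?case
    by (simp only: y(2)[symmetric] y'(2)[symmetric] prop_morphismD(4)[OF G y(1) y'(1), symmetric]
        W[OF tensor[OF y(1) y'(1)]] W[OF y(1)] W[OF y'(1)] prop_morphismD(4)[OF V y(1) y'(1)])
next
  case (5 X Y)
  show ?case using W[OF symm] prop_morphismD(5)[OF G] prop_morphismD(5)[OF V] by metis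
qed


section \<open>The square\<close>

text \<open>\<open>comparison\<close> needs no chosen canonical map: as \<open>(i, j)\<close> is a
  pushout, the two equations determine \<open>u\<close>.\<close>

locale corel_square = is_prop C for C :: "'c prop_data" (structure) +
  fixes A M :: "'c set"
  assumes A_sub: "sub_prop C A"
    and pushouts: "has_pushouts C" and pullbacks: "has_pullbacks C"
    and M_sub: "subcategory_with_isos C M"
    and M_stable: "stable_under_pushout C M"
    and M_mono: "m \<in> M \<Longrightarrow> is_mono C m"
    and M_A: "M \<subseteq> A"
    and A_stable: "stable_under_pullback C A"
    and comparison: "\<And>X Y Z P f g p q i j u. f \<in> hom C X Z \<inter> A \<Longrightarrow> g \<in> hom C Y Z \<inter> A
      \<Longrightarrow> is_pullback C f g p q \<Longrightarrow> is_pushout C p q i j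
      \<Longrightarrow> i \<in> hom C X P \<Longrightarrow> j \<in> hom C Y P
      \<Longrightarrow> u \<in> hom C P Z \<Longrightarrow> i \<Zsemi> u = f \<Longrightarrow> j \<Zsemi> u = g \<Longrightarrow> u \<in> M"
    and tensor_pushouts: "tensor_preserves_pushouts C"
    and tensor_pullbacks: "tensor_preserves_pullbacks_in C A"
    and M_tensor: "f \<in> M \<Longrightarrow> g \<in> M \<Longrightarrow> f \<oplus> g \<in> M"
begin

section \<open>The hypotheses as leg classes and congruences\<close>

lemma A_arrows: "A \<subseteq> arrows C" using A_sub unfolding sub_prop_def by blast

lemma M_arrows: "M \<subseteq> arrows C" and isos_M: "isos C \<subseteq> M"
  and M_comp: "f \<in> M \<Longrightarrow> g \<in> M \<Longrightarrow> f \<in> hom C X Y \<Longrightarrow> g \<in> hom C Y Z \<Longrightarrow> f \<Zsemi> g \<in> M"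
  using M_sub unfolding subcategory_with_isos_def by blast+

lemma pushout_ex: "f \<in> hom C Y N \<Longrightarrow> g \<in> hom C Y K \<Longrightarrow> \<exists>p q. is_pushout C f g p q"
  using pushouts unfolding has_pushouts_def by blast

lemma pushout_legs_arrows: "pushout_legs C (arrows C)"
proof (unfold_locales, goal_cases)
  case 1
  show ?case
    unfolding sub_prop_def
  proof (intro conjI allI ballI subset_refl)
    show "idn C X \<in> arrows C" for X using idn_hom by (rule arrowsI)
    show "symm C X Y \<in> arrows C" for X Y using symm_hom by (rule arrowsI)
    show "f \<Zsemi> g \<in> arrows C" if "f \<in> hom C X Y \<inter> arrows C" "g \<in> hom C Y Z \<inter> arrows C" for X Y Z f g
      using comp_hom[OF IntD1[OF that(1)] IntD1[OF that(2)]] by (rule arrowsI)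
    fix f g assume "f \<in> arrows C" "g \<in> arrows C"
    then obtain X Y X' Y' where "f \<in> hom C X Y" "g \<in> hom C X' Y'" by (auto simp: arrows_def)
    then have "f \<oplus> g \<in> hom C (X + X') (Y + Y')" by (rule tensor_hom)
    then show "f \<oplus> g \<in> arrows C" by (rule arrowsI)
  qed
next
  case 2 show ?case using isos_M M_arrows by blast
next
  case (3 f Y N g K) then show ?case using pushout_ex by blast
next
  case (4 f g p q)
  from 4(1) show ?case by (rule pushout_typing) (simp add: arrowsI)
next
  case (5 f g p q f' g' p' q')
  with tensor_pushouts[unfolded tensor_preserves_pushouts_def, rule_format, of f g p q f' g' p' q']
  show ?case by simp
qed

lemma cospan_congruence_Cospan: "cospan_congruence C (arrows C) (cospan_iso C)"
  by (rule pushout_legs.cospan_congruence_isos[OF pushout_legs_arrows]) (simp add: cospan_iso_def)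

lemma stable_class_M: "stable_class C (arrows C) M"
proof -
  interpret pushout_legs C "arrows C" by (rule pushout_legs_arrows)
  show ?thesis
  proof (unfold_locales, goal_cases)
    case 1 show ?case by (rule isos_M)
  next
    case 2 show ?case by (rule M_arrows)
  next
    case (3 m n X Y Z) then show ?case by (rule M_comp)
  next
    case (4 m n X Y X' Y') then show ?case by (intro M_tensor)
  next
    case (5 f g p q)
    with M_stable[unfolded stable_under_pushout_def, rule_format, of f g p q] show ?case by simp
  next
    case (6 f X Y m Z) then show ?case by (intro arrowsI)
  qed
qed

lemma cospan_congruence_Corel: "cospan_congruence C (arrows C) (corel_equiv C M)"
  using stable_class_M by (rule stable_class.cospan_congruence_corel)

text \<open>Reversing arrows turns existence of pullbacks, stability of \<open>A\<close> and
  preservation of pullbacks in \<open>A\<close> into the pushout axioms; isomorphisms lie in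
  \<open>A\<close> because they lie in \<open>M\<close>.\<close>

lemma pushout_legs_opposite: "pushout_legs (opposite C) A"
proof -
  interpret op: is_prop "opposite C" by (rule is_prop_opposite)
  show ?thesis
  proof (unfold_locales, goal_cases)
    case 1 show ?case using A_sub unfolding sub_prop_def arrows_opposite opposite_simps by blast
  next
    case 2 show ?case using isos_M M_A by auto
  next
    case (3 f Y N g K) then show ?case
      using pullbacks unfolding has_pullbacks_def is_pushout_opposite by auto
  next
    case (4 f g p q)
    with A_stable[unfolded stable_under_pullback_def, rule_format, of f g p q]
    show ?case by (simp add: is_pushout_opposite)
  next
    case (5 f g p q f' g' p' q')
    with tensor_pullbacks[unfolded tensor_preserves_pullbacks_in_def, rule_format, of f g f' g' p q p' q']
    show ?case by (simp add: is_pushout_opposite)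
  qed
qed

text \<open>A map of spans in \<open>span_iso\<close> runs from the first apex to the second, and a
  map of cospans in the opposite prop the other way, so each direction inverts the
  isomorphism.\<close>

lemma cospan_congruence_Span: "cospan_congruence (opposite C) A (span_iso C A)"
proof (rule pushout_legs.cospan_congruence_isos[OF pushout_legs_opposite])
  interpret op: pushout_legs "opposite C" A by (rule pushout_legs_opposite)
  fix f g X Y and c' :: "'c \<times> 'c"
  assume "(f, g) \<in> leg_cospans (opposite C) A X Y"
  then obtain N where f: "f \<in> hom C N X" "f \<in> A" and g: "g \<in> hom C N Y" "g \<in> A"
    by (auto elim: op.leg_cospansE)
  obtain f' g' where c': "c' = (f', g')" by (cases c')
  show "((f, g), c') \<in> span_iso C A \<longleftrightarrow> cospan_map (opposite C) (isos (opposite C)) (f, g) c'"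
    unfolding c'
  proof
    assume "((f, g), (f', g')) \<in> span_iso C A"
    then obtain X' Y' N1 N' i where f': "f' \<in> hom C N' X'" and g': "g' \<in> hom C N' Y'"
      and i: "i \<in> hom C N1 N'" "i \<in> isos C" and eq: "i \<Zsemi> f' = f" "i \<Zsemi> g' = g"
      unfolding span_iso_def by blast
    obtain j where j: "j \<in> hom C N' N1" "i \<Zsemi> j = idn C N1" "j \<Zsemi> i = idn C N'" "j \<in> isos C"
      using i(2,1) by (rule isosE)
    have ff: "f \<in> hom C N1 X'" "g \<in> hom C N1 Y'"
      unfolding eq[symmetric] using comp_hom[OF i(1) f'] comp_hom[OF i(1) g'] by auto
    have "j \<Zsemi> f = f'" "j \<Zsemi> g = g'"
      unfolding eq[symmetric]
      by (simp_all only: comp_assoc[OF j(1) i(1) f', symmetric] comp_assoc[OF j(1) i(1) g', symmetric]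
          j(3) idn_comp[OF f'] idn_comp[OF g'])
    then show "cospan_map (opposite C) (isos (opposite C)) (f, g) (f', g')"
      unfolding cospan_map_def prod.case opposite_simps isos_opposite using ff j(1,4) by blast
  next
    assume "cospan_map (opposite C) (isos (opposite C)) (f, g) (f', g')"
    then obtain X' Y' N1 N' i where f1: "f \<in> hom C N1 X'" and g1: "g \<in> hom C N1 Y'"
      and i: "i \<in> hom C N' N1" "i \<in> isos C" and eq: "i \<Zsemi> f = f'" "i \<Zsemi> g = g'"
      unfolding cospan_map_def by auto
    obtain j where j: "j \<in> hom C N1 N'" "i \<Zsemi> j = idn C N'" "j \<Zsemi> i = idn C N1" "j \<in> isos C"
      using i(2,1) by (rule isosE)
    \<comment> \<open>\<open>span_iso\<close> also demands that the new legs lie in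
      \<open>A\<close>; they do, being composites of the old ones with an isomorphism.\<close>
    have iA: "i \<in> A" using i(2) isos_M M_A by blast
    have A_comp: "f \<in> A \<Longrightarrow> g \<in> A \<Longrightarrow> f \<in> hom C X Y \<Longrightarrow> g \<in> hom C Y Z \<Longrightarrow> f \<Zsemi> g \<in> A" for f g X Y Z
      using A_sub unfolding sub_prop_def by blast
    have f': "f' \<in> hom C N' X'" "f' \<in> A" and g': "g' \<in> hom C N' Y'" "g' \<in> A"
      unfolding eq[symmetric] using comp_hom[OF i(1) f1] comp_hom[OF i(1) g1]
        A_comp[OF iA f(2) i(1) f1] A_comp[OF iA g(2) i(1) g1] by auto
    have "j \<Zsemi> f' = f" "j \<Zsemi> g' = g"
      unfolding eq[symmetric]
      by (simp_all only: comp_assoc[OF j(1) i(1) f1, symmetric] comp_assoc[OF j(1) i(1) g1, symmetric]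
          j(3) idn_comp[OF f1] idn_comp[OF g1])
    then show "((f, g), (f', g')) \<in> span_iso C A"
      unfolding span_iso_def using f(2) g(2) f' g' j(1,4) by blast
  qed
qed

sublocale Cos: cospan_congruence C "arrows C" "cospan_iso C" by (rule cospan_congruence_Cospan)
sublocale Cor: cospan_congruence C "arrows C" "corel_equiv C M" by (rule cospan_congruence_Corel)
sublocale Sp: cospan_congruence "opposite C" A "span_iso C A" by (rule cospan_congruence_Span)

lemma leg_cospans_arrows: "leg_cospans C (arrows C) = cospans C"
  unfolding leg_cospans_def cospans_def by (intro ext) (auto intro: arrowsI)

lemma Cospan_eq: "Cospan C = Cos.Q" and Corel_eq: "Corel C M = Cor.Q"
  unfolding Cospan_def Corel_def leg_cospan_quotient_def leg_cospans_arrows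
  by (simp_all add: cospan_quotient_def)

text \<open>The descriptions differ only in the symmetry: the quotient over the opposite prop puts
  it on the left leg and \<open>Span\<close> on the right leg. The symmetry is itself an isomorphism
  between these spans.\<close>

lemma Span_eq: "Span C A = Sp.Q"
proof -
  have "Sp.cl (symm C Y X, idn C (Y + X)) = Sp.cl (idn C (X + Y), symm C X Y)" for X Y
  proof -
    have c: "(symm C Y X, idn C (Y + X)) \<in> leg_cospans (opposite C) A (X + Y) (Y + X)"
      using Sp.symm_cospan[of X Y] by simp
    have "((symm C Y X, idn C (Y + X)),
        (symm C Y X \<Zsemi>\<^bsub>opposite C\<^esub> symm C X Y, idn C (Y + X) \<Zsemi>\<^bsub>opposite C\<^esub> symm C X Y)) \<in> span_iso C A"
      using c by (rule Sp.r_iso[where N = "Y + X" and N' = "X + Y"]) (simp_all add: symm_hom isos_symm)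
    with c show ?thesis
      by (intro Sp.cl_eq) (simp_all add: symm_inverse comp_idn[OF symm_hom])
  qed
  then show ?thesis
    unfolding Span_def leg_cospan_quotient_def cospan_quotient_def
    by (simp add: is_pushout_opposite leg_cospans_def spans_def)
qed

lemma is_prop_Span: "is_prop (Span C A)" and is_prop_Cospan: "is_prop (Cospan C)"
  and is_prop_Corel: "is_prop (Corel C M)"
  unfolding Span_eq Cospan_eq Corel_eq
  by (rule Sp.is_prop_quotient, rule Cos.is_prop_quotient, rule Cor.is_prop_quotient)

section \<open>The functor \<open>Gamma_functor\<close>\<close>

lemma iso_corel: "cospan_iso C \<subseteq> corel_equiv C M"
proof -
  have "cospan_map C M c c'" if "cospan_map C (isos C) c c'" for c c'
    using that isos_M unfolding cospan_map_def by (cases c, cases c') blast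
  then show ?thesis unfolding cospan_iso_def corel_equiv_def by (auto intro: r_into_equivclp)
qed

lemma prop_morphism_Gamma: "prop_morphism (Cospan C) (Corel C M) (Gamma_functor C M)"
  unfolding Cospan_eq Corel_eq Gamma_functor_def
  by (rule prop_morphism_coarser_congruence(1)[OF cospan_congruence_Cospan cospan_congruence_Corel iso_corel])

lemma Gamma_cl: "c \<in> leg_cospans C (arrows C) X Y \<Longrightarrow> Gamma_functor C M (Cos.cl c) = Cor.cl c"
  unfolding Gamma_functor_def
  by (rule prop_morphism_coarser_congruence(2)[OF cospan_congruence_Cospan cospan_congruence_Corel iso_corel])

section \<open>The functor \<open>Pi_functor\<close>\<close>

lemma span_legs: "(f, g) \<in> leg_cospans (opposite C) A X Y
    \<Longrightarrow> \<exists>N. f \<in> hom C N X \<and> f \<in> A \<and> g \<in> hom C N Y \<and> g \<in> A"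
  unfolding leg_cospans_def by auto

lemma spanE:
  assumes "x \<in> hom (Span C A) X Y"
  obtains f g N where "x = Sp.cl (f, g)" "(f, g) \<in> leg_cospans (opposite C) A X Y"
    "f \<in> hom C N X" "f \<in> A" "g \<in> hom C N Y" "g \<in> A"
proof -
  from assms obtain f g where "x = Sp.cl (f, g)" and c: "(f, g) \<in> leg_cospans (opposite C) A X Y"
    unfolding Span_eq by (rule Sp.hom_QE)
  with span_legs[OF c] that show thesis by blast
qed

text \<open>Pushouts of an isomorphic span are pushouts of the given one by
  \<open>pushout_iso_source\<close>, and two pushouts of one span are isomorphic, hence identified
  by \<open>Cor.r_iso\<close>.\<close>

lemma Pi_cl:
  assumes f: "f \<in> hom C N X" and g: "g \<in> hom C N Y" and c: "f \<in> A" "g \<in> A"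
    and po: "is_pushout C f g p q"
  shows "Pi_functor C M (Sp.cl (f, g)) = Cor.cl (p, q)"
  unfolding Pi_functor_def
proof (rule Cor.cl_image)
  from po f g obtain Q where p: "p \<in> hom C X Q" and q: "q \<in> hom C Y Q" by (rule pushout_hom)
  show pq: "(p, q) \<in> leg_cospans C (arrows C) X Y"
    using p arrowsI[OF p] q arrowsI[OF q] by (rule Cos.leg_cospansI)
  have fg: "(f, g) \<in> leg_cospans (opposite C) A X Y"
    using f g c by (intro Sp.leg_cospansI[where N = N]) simp_all
  show "(p, q) \<in> {(p, q) | p q f' g'. (f', g') \<in> Sp.cl (f, g) \<and> is_pushout C f' g' p q}"
    using Sp.r_refl[OF fg] po by blast
  fix c' assume "c' \<in> {(p, q) | p q f' g'. (f', g') \<in> Sp.cl (f, g) \<and> is_pushout C f' g' p q}"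
  then obtain p' q' f' g' where c': "c' = (p', q')" and r: "((f, g), (f', g')) \<in> span_iso C A"
    and po': "is_pushout C f' g' p' q'" by auto
  from r obtain X' Y' N1 N' i where f': "f' \<in> hom C N' X'" and g': "g' \<in> hom C N' Y'"
    and i: "i \<in> hom C N1 N'" "i \<in> isos C" and eq: "i \<Zsemi> f' = f" "i \<Zsemi> g' = g"
    unfolding span_iso_def by blast
  from pushout_iso_source[OF po' f' g' i] have po'': "is_pushout C f g p' q'" unfolding eq .
  from po po'' p q obtain j Q' where j: "j \<in> hom C Q Q'" "j \<in> isos C" "p \<Zsemi> j = p'" "q \<Zsemi> j = q'"
    by (rule pushout_unique)
  from Cor.r_iso[OF pq p j(1,2)] show "((p, q), c') \<in> corel_equiv C M" unfolding c' j(3,4) .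
qed

lemma Pi_split:
  assumes f: "f \<in> hom C N X" "f \<in> A" and g: "g \<in> hom C N Y" "g \<in> A"
  shows "Pi_functor C M (Sp.cl (f, g)) = Cor.cl (idn C X, f) \<Zsemi>\<^bsub>Cor.Q\<^esub> Cor.cl (g, idn C Y)"
proof -
  obtain p q where po: "is_pushout C f g p q" using pushout_ex[OF f(1) g(1)] by blast
  show ?thesis
    using Pi_cl[OF f(1) g(1) f(2) g(2) po] Cor.backward_forward[OF f(1) arrowsI[OF f(1)] g(1) arrowsI[OF g(1)] po]
    by simp
qed

lemma pullback_exchange:
  assumes g: "g \<in> hom C N Y" "g \<in> A" and h: "h \<in> hom C K Y" "h \<in> A"
    and pb: "is_pullback C g h p q" and p: "p \<in> hom C R N" and q: "q \<in> hom C R K"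
  shows "Cor.cl (idn C N, p) \<Zsemi>\<^bsub>Cor.Q\<^esub> Cor.cl (q, idn C K) = Cor.cl (g, idn C Y) \<Zsemi>\<^bsub>Cor.Q\<^esub> Cor.cl (idn C Y, h)"
proof -
  obtain i j where po: "is_pushout C p q i j" using pushout_ex[OF p q] by blast
  from po p q obtain T where i: "i \<in> hom C N T" and j: "j \<in> hom C K T" by (rule pushout_hom)
  have comm: "p \<Zsemi> g = q \<Zsemi> h" using pb unfolding is_pullback_def by blast
  from po i j g(1) h(1) comm obtain u where u: "u \<in> hom C T Y" "i \<Zsemi> u = g" "j \<Zsemi> u = h"
    by (rule pushout_lift)
  have uM: "u \<in> M" using comparison[OF _ _ pb po i j u] g h by simp
  have ij: "(i, j) \<in> leg_cospans C (arrows C) N K"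
    using i arrowsI[OF i] j arrowsI[OF j] by (rule Cos.leg_cospansI)
  have "cospan_map C M (i, j) (g, h)" unfolding cospan_map_def using i j u uM by blast
  then have "((i, j), (g, h)) \<in> corel_equiv C M" unfolding corel_equiv_def by (simp add: r_into_equivclp)
  with ij have "Cor.cl (i, j) = Cor.cl (g, h)" by (rule Cor.cl_eq)
  then show ?thesis
    by (simp only: Cor.backward_forward[OF p arrowsI[OF p] q arrowsI[OF q] po]
        Cor.forward_backward[OF g(1) arrowsI[OF g(1)] h(1) arrowsI[OF h(1)]])
qed

text \<open>Splitting the composite span gives four one-legged corelations in a row. Exchanging the
  middle two regroups them as the product of the two values.\<close>

lemma Pi_comp:
  assumes x: "x \<in> hom (Span C A) X Y" and y: "y \<in> hom (Span C A) Y Z"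
  shows "Pi_functor C M (x \<Zsemi>\<^bsub>Span C A\<^esub> y) = Pi_functor C M x \<Zsemi>\<^bsub>Corel C M\<^esub> Pi_functor C M y"
proof -
  interpret CorP: is_prop Cor.Q by (rule Cor.is_prop_quotient)
  from x obtain f g N where xf: "x = Sp.cl (f, g)" "(f, g) \<in> leg_cospans (opposite C) A X Y"
    and f: "f \<in> hom C N X" "f \<in> A" and g: "g \<in> hom C N Y" "g \<in> A" by (rule spanE)
  from y obtain h k K where yh: "y = Sp.cl (h, k)" "(h, k) \<in> leg_cospans (opposite C) A Y Z"
    and h: "h \<in> hom C K Y" "h \<in> A" and k: "k \<in> hom C K Z" "k \<in> A" by (rule spanE)
  from xf(2) yh(2) obtain p q where po: "is_pushout (opposite C) g h p q" by (rule Sp.leg_cospans_pushout_ex)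
  then have pb: "is_pullback C g h p q" by (simp add: is_pushout_opposite)
  from Sp.pushout_hom[OF po, of Y N Y K] g h obtain R where p: "p \<in> hom C R N" and q: "q \<in> hom C R K"
    by auto
  have pq: "p \<in> A" "q \<in> A" using Sp.legs_pushout[OF po] g h by auto
  have A_comp: "a \<in> A \<Longrightarrow> b \<in> A \<Longrightarrow> a \<in> hom C X Y \<Longrightarrow> b \<in> hom C Y Z \<Longrightarrow> a \<Zsemi> b \<in> A" for a b X Y Z
    using Sp.legs_comp[of b a Z Y X] by simp
  let ?d = "\<lambda>X a. Cor.cl (idn C X, a)" and ?u = "\<lambda>a Y. Cor.cl (a, idn C Y)"
  let ?c = "cmp Cor.Q"
  have d: "?d X f \<in> hom Cor.Q X N" "?d N p \<in> hom Cor.Q N R" "?d Y h \<in> hom Cor.Q Y K"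
    using f(1) p h(1) by (auto intro!: Cor.hom_QI Cor.backward_cospan arrowsI)
  have u: "?u q K \<in> hom Cor.Q R K" "?u k Z \<in> hom Cor.Q K Z" "?u g Y \<in> hom Cor.Q N Y"
    using q k(1) g(1) by (auto intro!: Cor.hom_QI Cor.forward_cospan arrowsI)
  have "x \<Zsemi>\<^bsub>Span C A\<^esub> y = Sp.cl (p \<Zsemi> f, q \<Zsemi> k)"
    using Sp.comp_cl[OF xf(2) yh(2) po] by (simp add: Span_eq xf(1) yh(1))
  then have "Pi_functor C M (x \<Zsemi>\<^bsub>Span C A\<^esub> y) = ?c (?d X (p \<Zsemi> f)) (?u (q \<Zsemi> k) Z)"
    using Pi_split[OF comp_hom[OF p f(1)] A_comp[OF pq(1) f(2) p f(1)]
        comp_hom[OF q k(1)] A_comp[OF pq(2) k(2) q k(1)]] by simp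
  also have "?d X (p \<Zsemi> f) = ?c (?d X f) (?d N p)"
    using Cor.comp_backward[OF Cor.backward_cospan[OF f(1) arrowsI[OF f(1)]] p arrowsI[OF p]] by simp
  also have "?u (q \<Zsemi> k) Z = ?c (?u q K) (?u k Z)"
    using Cor.forward_comp[OF q arrowsI[OF q] Cor.forward_cospan[OF k(1) arrowsI[OF k(1)]]] by simp
  also have "?c (?c (?d X f) (?d N p)) (?c (?u q K) (?u k Z)) = ?c (?d X f) (?c (?c (?d N p) (?u q K)) (?u k Z))"
    by (simp only: CorP.comp_assoc[OF d(1) d(2) CorP.comp_hom[OF u(1) u(2)]]
        CorP.comp_assoc[OF d(2) u(1) u(2)])
  also have "?c (?d N p) (?u q K) = ?c (?u g Y) (?d Y h)"
    using g h pb p q by (rule pullback_exchange)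
  also have "?c (?d X f) (?c (?c (?u g Y) (?d Y h)) (?u k Z)) = ?c (?c (?d X f) (?u g Y)) (?c (?d Y h) (?u k Z))"
    by (simp only: CorP.comp_assoc[OF d(1) u(3) CorP.comp_hom[OF d(3) u(2)]]
        CorP.comp_assoc[OF u(3) d(3) u(2)])
  finally show ?thesis
    by (simp only: Corel_eq xf(1) yh(1) Pi_split[OF f g] Pi_split[OF h k])
qed

lemma prop_morphism_Pi: "prop_morphism (Span C A) (Corel C M) (Pi_functor C M)"
  unfolding prop_morphism_def
proof (intro conjI allI ballI, goal_cases)
  case (1 X Y x)
  then obtain f g N where x: "x = Sp.cl (f, g)" and f: "f \<in> hom C N X" "f \<in> A" and g: "g \<in> hom C N Y" "g \<in> A"
    by (rule spanE)
  obtain p q where po: "is_pushout C f g p q" using pushout_ex[OF f(1) g(1)] by blast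
  from po f(1) g(1) obtain Q where p: "p \<in> hom C X Q" and q: "q \<in> hom C Y Q" by (rule pushout_hom)
  show ?case
    unfolding x Pi_cl[OF f(1) g(1) f(2) g(2) po] Corel_eq
    by (rule Cor.hom_QI[OF Cos.leg_cospansI[OF p arrowsI[OF p] q arrowsI[OF q]]])
next
  case (2 X)
  have "idn C X \<in> A" using Sp.legs_idn by simp
  with Pi_cl[OF idn_hom idn_hom _ _ idn_pushout[OF idn_hom]]
  show ?case unfolding Span_eq Corel_eq Sp.idn_cl Cor.idn_cl by simp
next
  case (3 X Y Z x y) then show ?case by (rule Pi_comp)
next
  case (4 x y)
  then obtain X Y X' Y' where xy: "x \<in> hom (Span C A) X Y" "y \<in> hom (Span C A) X' Y'" by (auto simp: arrows_def)
  from xy(1) obtain f g N where x: "x = Sp.cl (f, g)" "(f, g) \<in> leg_cospans (opposite C) A X Y"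
    and f: "f \<in> hom C N X" "f \<in> A" and g: "g \<in> hom C N Y" "g \<in> A" by (rule spanE)
  from xy(2) obtain h k K where y: "y = Sp.cl (h, k)" "(h, k) \<in> leg_cospans (opposite C) A X' Y'"
    and h: "h \<in> hom C K X'" "h \<in> A" and k: "k \<in> hom C K Y'" "k \<in> A" by (rule spanE)
  obtain p q where po: "is_pushout C f g p q" using pushout_ex[OF f(1) g(1)] by blast
  obtain p' q' where po': "is_pushout C h k p' q'" using pushout_ex[OF h(1) k(1)] by blast
  from po f(1) g(1) obtain Q where p: "p \<in> hom C X Q" and q: "q \<in> hom C Y Q" by (rule pushout_hom)
  from po' h(1) k(1) obtain Q' where p': "p' \<in> hom C X' Q'" and q': "q' \<in> hom C Y' Q'" by (rule pushout_hom)
  have tpo: "is_pushout C (f \<oplus> h) (g \<oplus> k) (p \<oplus> p') (q \<oplus> q')"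
    using po po' arrowsI[OF f(1)] arrowsI[OF g(1)] arrowsI[OF h(1)] arrowsI[OF k(1)]
    by (rule Cos.legs_tensor_pushout)
  have tA: "f \<oplus> h \<in> A" "g \<oplus> k \<in> A"
    using Sp.legs_tensor[OF f(2) h(2)] Sp.legs_tensor[OF g(2) k(2)] by simp_all
  have "x \<oplus>\<^bsub>Span C A\<^esub> y = Sp.cl (f \<oplus> h, g \<oplus> k)"
    using Sp.tensor_cl[OF x(2) y(2)] by (simp add: Span_eq x(1) y(1))
  then show ?case
    using Pi_cl[OF tensor_hom[OF f(1) h(1)] tensor_hom[OF g(1) k(1)] tA tpo]
      Cor.tensor_cl[OF Cos.leg_cospansI[OF p arrowsI[OF p] q arrowsI[OF q]]
        Cos.leg_cospansI[OF p' arrowsI[OF p'] q' arrowsI[OF q']]]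
    by (simp add: x(1) y(1) Pi_cl[OF f(1) g(1) f(2) g(2) po] Pi_cl[OF h(1) k(1) h(2) k(2) po'] Corel_eq)
next
  case (5 X Y)
  \<comment> \<open>In this form the pushout is one along an identity, and its cospan is literally
    the symmetry of \<open>Corel C M\<close>.\<close>
  have "symm (Span C A) X Y = Sp.cl (idn C (X + Y), symm C X Y)" by (simp add: Span_def)
  moreover have "idn C (X + Y) \<in> A" "symm C X Y \<in> A" using Sp.legs_idn Sp.legs_symm[of Y X] by simp_all
  ultimately show ?case
    using Pi_cl[OF idn_hom symm_hom _ _ idn_pushout[OF symm_hom]]
    by (simp add: Corel_eq Cor.symm_cl)
qed

section \<open>The maps out of \<open>A_plus_Aop C A\<close> and commutativity\<close>

lemma generators_to_Span:
  "prop_morphism (restrict_prop C A) (Span C A) (\<lambda>f. Sp.cl (idn C (dom_of C f), f))"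
  "prop_morphism (opposite (restrict_prop C A)) (Span C A) (\<lambda>g. Sp.cl (g, idn C (dom_of C g)))"
  \<comment> \<open>The roles cross: an arrow of \<open>A\<close> is a backward cospan in the
    opposite prop, and its reverse a forward one.\<close>
  using Sp.prop_morphism_backward[OF subset_refl] Sp.prop_morphism_forward[OF subset_refl]
  by (simp_all add: opposite_restrict opposite_opposite dom_of_opposite Span_eq)

lemma generators_to_Cospan:
  "prop_morphism (restrict_prop C A) (Cospan C) (\<lambda>f. Cos.cl (f, idn C (cod_of C f)))"
  "prop_morphism (opposite (restrict_prop C A)) (Cospan C) (\<lambda>g. Cos.cl (idn C (cod_of C g), g))"
  using Cos.prop_morphism_forward[OF A_arrows] Cos.prop_morphism_backward[OF A_arrows]
  by (simp_all add: Cospan_eq)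

lemma generators_to_Corel:
  "prop_morphism (restrict_prop C A) (Corel C M) (\<lambda>f. Cor.cl (f, idn C (cod_of C f)))"
  "prop_morphism (opposite (restrict_prop C A)) (Corel C M) (\<lambda>g. Cor.cl (idn C (cod_of C g), g))"
  using Cor.prop_morphism_forward[OF A_arrows] Cor.prop_morphism_backward[OF A_arrows]
  by (simp_all add: Corel_eq)

sublocale two_props "restrict_prop C A" "opposite (restrict_prop C A)"
  using is_prop_restrict[OF A_sub] is_prop.is_prop_opposite[OF is_prop_restrict[OF A_sub]]
  by (rule two_props.intro)

lemma prop_morphism_to_Span: "prop_morphism (A_plus_Aop C A) (Span C A) (to_Span C A)"
  unfolding A_plus_Aop_def to_Span_def using is_prop_Span generators_to_Span by (rule prop_morphism_copair)

lemma prop_morphism_to_Cospan: "prop_morphism (A_plus_Aop C A) (Cospan C) (to_Cospan C)"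
  unfolding A_plus_Aop_def to_Cospan_def using is_prop_Cospan generators_to_Cospan by (rule prop_morphism_copair)

lemma generatorE:
  assumes "a \<in> arrows (restrict_prop C A) \<or> a \<in> arrows (opposite (restrict_prop C A))"
  obtains X Y where "a \<in> hom C X Y" "a \<in> A"
  using assms by (auto simp: arrows_def restrict_prop_def)

lemma to_Span_generators:
  assumes "a \<in> hom C X Y" and "a \<in> A"
  shows "to_Span C A (inj_A (restrict_prop C A) (opposite (restrict_prop C A)) a) = Sp.cl (idn C X, a)"
    and "to_Span C A (inj_B (restrict_prop C A) (opposite (restrict_prop C A)) a) = Sp.cl (a, idn C X)"
proof -
  have a: "a \<in> arrows (restrict_prop C A)" using assms by (auto simp: arrows_def restrict_prop_def)
  show "to_Span C A (inj_A (restrict_prop C A) (opposite (restrict_prop C A)) a) = Sp.cl (idn C X, a)"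
    unfolding to_Span_def
    using copair_inj_A[OF is_prop_Span generators_to_Span a] by (simp add: dom_of_eq[OF assms(1)])
  show "to_Span C A (inj_B (restrict_prop C A) (opposite (restrict_prop C A)) a) = Sp.cl (a, idn C X)"
    unfolding to_Span_def
    using copair_inj_B[OF is_prop_Span generators_to_Span] a by (simp add: dom_of_eq[OF assms(1)])
qed

lemma to_Cospan_generators:
  assumes "a \<in> hom C X Y" and "a \<in> A"
  shows "to_Cospan C (inj_A (restrict_prop C A) (opposite (restrict_prop C A)) a) = Cos.cl (a, idn C Y)"
    and "to_Cospan C (inj_B (restrict_prop C A) (opposite (restrict_prop C A)) a) = Cos.cl (idn C Y, a)"
proof -
  have a: "a \<in> arrows (restrict_prop C A)" using assms by (auto simp: arrows_def restrict_prop_def)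
  show "to_Cospan C (inj_A (restrict_prop C A) (opposite (restrict_prop C A)) a) = Cos.cl (a, idn C Y)"
    unfolding to_Cospan_def
    using copair_inj_A[OF is_prop_Cospan generators_to_Cospan a] by (simp add: cod_of_eq[OF assms(1)])
  show "to_Cospan C (inj_B (restrict_prop C A) (opposite (restrict_prop C A)) a) = Cos.cl (idn C Y, a)"
    unfolding to_Cospan_def
    using copair_inj_B[OF is_prop_Cospan generators_to_Cospan] a by (simp add: cod_of_eq[OF assms(1)])
qed

text \<open>By uniqueness of copairing it is enough to compare generators. There the pushouts are
  along identities, so both composites equal the inclusions of \<open>A\<close> and its opposite in
  \<open>Corel C M\<close>.\<close>

lemma square_commutes:
  assumes x: "x \<in> arrows (A_plus_Aop C A)"
  shows "Pi_functor C M (to_Span C A x) = Gamma_functor C M (to_Cospan C x)"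
proof -
  note x = x[unfolded A_plus_Aop_def]
  note sp = prop_morphism_compose[OF prop_morphism_to_Span prop_morphism_Pi, unfolded A_plus_Aop_def]
  note cos = prop_morphism_compose[OF prop_morphism_to_Cospan prop_morphism_Gamma, unfolded A_plus_Aop_def]
  have idn: "idn C X \<in> A" for X using Sp.legs_idn by simp
  have "Pi_functor C M (to_Span C A x) = copair (Corel C M)
      (\<lambda>f. Cor.cl (f, idn C (cod_of C f))) (\<lambda>g. Cor.cl (idn C (cod_of C g), g)) x"
  proof (rule copair_unique[OF is_prop_Corel generators_to_Corel sp _ _ x])
    fix a assume "a \<in> arrows (restrict_prop C A)"
    then obtain X Y where a: "a \<in> hom C X Y" "a \<in> A" using generatorE by blast
    show "Pi_functor C M (to_Span C A (inj_A (restrict_prop C A) (opposite (restrict_prop C A)) a))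
        = Cor.cl (a, idn C (cod_of C a))"
      by (simp only: to_Span_generators(1)[OF a] cod_of_eq[OF a(1)] Pi_cl[OF idn_hom a(1) idn a(2) idn_pushout[OF a(1)]])
  next
    fix a assume "a \<in> arrows (opposite (restrict_prop C A))"
    then obtain X Y where a: "a \<in> hom C X Y" "a \<in> A" using generatorE by blast
    show "Pi_functor C M (to_Span C A (inj_B (restrict_prop C A) (opposite (restrict_prop C A)) a))
        = Cor.cl (idn C (cod_of C a), a)"
      by (simp only: to_Span_generators(2)[OF a] cod_of_eq[OF a(1)] Pi_cl[OF a(1) idn_hom a(2) idn pushout_idn[OF a(1)]])
  qed
  moreover have "Gamma_functor C M (to_Cospan C x) = copair (Corel C M)
      (\<lambda>f. Cor.cl (f, idn C (cod_of C f))) (\<lambda>g. Cor.cl (idn C (cod_of C g), g)) x"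
  proof (rule copair_unique[OF is_prop_Corel generators_to_Corel cos _ _ x])
    fix a assume "a \<in> arrows (restrict_prop C A)"
    then obtain X Y where a: "a \<in> hom C X Y" "a \<in> A" using generatorE by blast
    show "Gamma_functor C M (to_Cospan C (inj_A (restrict_prop C A) (opposite (restrict_prop C A)) a))
        = Cor.cl (a, idn C (cod_of C a))"
      by (simp only: to_Cospan_generators(1)[OF a] cod_of_eq[OF a(1)] Gamma_cl[OF Cos.forward_cospan[OF a(1) arrowsI[OF a(1)]]])
  next
    fix a assume "a \<in> arrows (opposite (restrict_prop C A))"
    then obtain X Y where a: "a \<in> hom C X Y" "a \<in> A" using generatorE by blast
    show "Gamma_functor C M (to_Cospan C (inj_B (restrict_prop C A) (opposite (restrict_prop C A)) a))
        = Cor.cl (idn C (cod_of C a), a)"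
      by (simp only: to_Cospan_generators(2)[OF a] cod_of_eq[OF a(1)] Gamma_cl[OF Cos.backward_cospan[OF a(1) arrowsI[OF a(1)]]])
  qed
  ultimately show ?thesis by simp
qed

section \<open>The universal property\<close>

lemma M_pullback:
  assumes m: "m \<in> M" "m \<in> hom C N N'"
  shows "is_pullback C m m (idn C N) (idn C N)"
proof -
  from M_mono[OF m(1)] obtain X Y where h: "m \<in> hom C X Y"
    and mono: "\<And>W f g. f \<in> hom C W X \<Longrightarrow> g \<in> hom C W X \<Longrightarrow> f \<Zsemi> m = g \<Zsemi> m \<Longrightarrow> f = g"
    unfolding is_mono_def by blast
  have "X = N" using hom_disjoint[OF h m(2)] by simp
  have "\<exists>!w. w \<in> hom C R N \<and> w \<Zsemi> idn C N = u \<and> w \<Zsemi> idn C N = v"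
    if uv: "u \<in> hom C R N" "v \<in> hom C R N" "u \<Zsemi> m = v \<Zsemi> m" for R u v
  proof -
    have "u = v" using mono[unfolded \<open>X = N\<close>, OF uv] .
    show ?thesis
    proof (rule ex1I[of _ u])
      show "u \<in> hom C R N \<and> u \<Zsemi> idn C N = u \<and> u \<Zsemi> idn C N = v"
        using uv(1) \<open>u = v\<close> comp_idn[OF uv(1)] by simp
      show "w = u" if "w \<in> hom C R N \<and> w \<Zsemi> idn C N = u \<and> w \<Zsemi> idn C N = v" for w
        using that comp_idn[of w R N] by simp
    qed
  qed
  then show ?thesis
    unfolding is_pullback_def using m(2) idn_hom[of N]
    by (intro exI[of _ N'] exI[of _ N] exI[of _ N] exI[of _ N]) simp
qed

context
  fixes D :: "'d prop_data" and U V
  assumes D: "is_prop D" and U: "prop_morphism (Span C A) D U" and V: "prop_morphism (Cospan C) D V"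
    and UV: "\<And>x. x \<in> arrows (A_plus_Aop C A) \<Longrightarrow> U (to_Span C A x) = V (to_Cospan C x)"
begin

interpretation D: is_prop D by (rule D)

text \<open>The cocone condition at the two injections: every later passage between \<open>U\<close>
  and \<open>V\<close> goes through these two equations.\<close>

lemma UV_generators:
  assumes a: "a \<in> hom C X Y" "a \<in> A"
  shows "U (Sp.cl (idn C X, a)) = V (Cos.cl (a, idn C Y))"
    and "U (Sp.cl (a, idn C X)) = V (Cos.cl (idn C Y, a))"
proof -
  have a': "a \<in> hom (restrict_prop C A) X Y" "a \<in> hom (opposite (restrict_prop C A)) Y X"
    using a by (simp_all add: restrict_prop_def)
  show "U (Sp.cl (idn C X, a)) = V (Cos.cl (a, idn C Y))"
    using UV[OF arrowsI, unfolded A_plus_Aop_def, OF prop_morphismD(1)[OF prop_morphism_inj_A a'(1)]]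
    by (simp add: to_Span_generators[OF a] to_Cospan_generators[OF a])
  show "U (Sp.cl (a, idn C X)) = V (Cos.cl (idn C Y, a))"
    using UV[OF arrowsI, unfolded A_plus_Aop_def, OF prop_morphismD(1)[OF prop_morphism_inj_B a'(2)]]
    by (simp add: to_Span_generators[OF a] to_Cospan_generators[OF a])
qed

lemmas U_comp = prop_morphismD(3)[OF U, unfolded Span_eq]
  and V_comp = prop_morphismD(3)[OF V, unfolded Cospan_eq]
  and V_hom = prop_morphismD(1)[OF V, unfolded Cospan_eq]

lemma forward_Cos: "f \<in> hom C X Y \<Longrightarrow> Cos.cl (f, idn C Y) \<in> hom Cos.Q X Y"
  and backward_Cos: "f \<in> hom C X Y \<Longrightarrow> Cos.cl (idn C Y, f) \<in> hom Cos.Q Y X"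
  by (auto intro!: Cos.hom_QI Cos.forward_cospan Cos.backward_cospan arrowsI)

lemma V_split:
  assumes f: "f \<in> hom C X N" and g: "g \<in> hom C Y N"
  shows "V (Cos.cl (f, g)) = V (Cos.cl (f, idn C N)) \<Zsemi>\<^bsub>D\<^esub> V (Cos.cl (idn C N, g))"
  using V_comp[OF forward_Cos[OF f] backward_Cos[OF g]]
  by (simp add: Cos.forward_backward[OF f arrowsI[OF f] g arrowsI[OF g]])

text \<open>
  Since \<open>m\<close> is a monomorphism, \<open>(idn, idn)\<close> is a pullback of \<open>(m, m)\<close>; hence the cospan
  \<open>(m, m)\<close> is already an identity in \<open>D\<close>.
\<close>

lemma V_kernel_pair:
  assumes m: "m \<in> M" "m \<in> hom C N N'"
  shows "V (Cos.cl (m, m)) = idn D N"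
proof -
  have mA: "m \<in> A" using m(1) M_A by blast
  have idn: "idn C N \<in> A" using Sp.legs_idn by simp
  have sp: "Sp.cl (idn C N, m) \<in> hom Sp.Q N N'" "Sp.cl (m, idn C N) \<in> hom Sp.Q N' N"
    using Sp.backward_cospan[of m N' N] Sp.forward_cospan[of m N' N] m(2) mA by (auto intro!: Sp.hom_QI)
  have po: "is_pushout (opposite C) m m (idn C N) (idn C N)"
    using M_pullback[OF m] by (simp add: is_pushout_opposite)
  have "V (Cos.cl (m, m)) = U (Sp.cl (idn C N, m)) \<Zsemi>\<^bsub>D\<^esub> U (Sp.cl (m, idn C N))"
    by (simp only: V_split[OF m(2) m(2)] UV_generators[OF m(2) mA])
  also have "\<dots> = U (Sp.cl (idn C N, m) \<Zsemi>\<^bsub>Sp.Q\<^esub> Sp.cl (m, idn C N))"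
    by (rule U_comp[OF sp, symmetric])
  also have "Sp.cl (idn C N, m) \<Zsemi>\<^bsub>Sp.Q\<^esub> Sp.cl (m, idn C N) = Sp.cl (idn C N, idn C N)"
    using Sp.backward_forward[OF _ mA _ mA po, of N' N N] m(2) by simp
  also have "U \<dots> = idn D N"
    using prop_morphismD(2)[OF U, of N] by (simp add: Span_eq Sp.idn_cl)
  finally show ?thesis .
qed

text \<open>Inserting \<open>[m, m]\<close> between the two halves of \<open>[f, g]\<close> yields
  \<open>[f \<Zsemi> m, g \<Zsemi> m]\<close>, and \<open>V\<close> does not see the
  insertion.\<close>

lemma V_cospan_map:
  assumes "cospan_map C M c c'"
  shows "V (Cos.cl c) = V (Cos.cl c')"
proof -
  obtain f g where c: "c = (f, g)" by (cases c)
  with assms obtain X Y N N' m where f: "f \<in> hom C X N" and g: "g \<in> hom C Y N"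
    and m: "m \<in> hom C N N'" "m \<in> M" and c': "c' = (f \<Zsemi> m, g \<Zsemi> m)"
    unfolding cospan_map_def by auto
  let ?f = "Cos.cl (f, idn C N)" and ?g = "Cos.cl (idn C N, g)" and ?m = "Cos.cl (m, m)"
  have mm: "(m, m) \<in> leg_cospans C (arrows C) N N"
    using m(1) arrowsI[OF m(1)] m(1) arrowsI[OF m(1)] by (rule Cos.leg_cospansI)
  have fm: "(f \<Zsemi> m, m) \<in> leg_cospans C (arrows C) X N"
    using comp_hom[OF f m(1)] arrowsI[OF comp_hom[OF f m(1)]] m(1) arrowsI[OF m(1)] by (rule Cos.leg_cospansI)
  have "Cos.cl c' = ?f \<Zsemi>\<^bsub>Cos.Q\<^esub> ?m \<Zsemi>\<^bsub>Cos.Q\<^esub> ?g"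
    by (simp only: c' Cos.forward_comp[OF f arrowsI[OF f] mm] Cos.comp_backward[OF fm g arrowsI[OF g]])
  then have "V (Cos.cl c') = V (?f \<Zsemi>\<^bsub>Cos.Q\<^esub> ?m) \<Zsemi>\<^bsub>D\<^esub> V ?g"
    using V_comp[of "?f \<Zsemi>\<^bsub>Cos.Q\<^esub> ?m" X N ?g Y] Cos.hom_QI[OF fm] backward_Cos[OF g]
    by (simp add: Cos.forward_comp[OF f arrowsI[OF f] mm])
  also have "V (?f \<Zsemi>\<^bsub>Cos.Q\<^esub> ?m) = V ?f \<Zsemi>\<^bsub>D\<^esub> idn D N"
    using V_comp[OF forward_Cos[OF f] Cos.hom_QI[OF mm]] V_kernel_pair[OF m(2,1)] by simp
  also have "\<dots> = V ?f" using V_hom[OF forward_Cos[OF f]] by (rule D.comp_idn)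
  also have "V ?f \<Zsemi>\<^bsub>D\<^esub> V ?g = V (Cos.cl c)" unfolding c by (rule V_split[OF f g, symmetric])
  finally show ?thesis ..
qed

lemma V_corel:
  assumes "(c, c') \<in> corel_equiv C M" and "c \<in> leg_cospans C (arrows C) X Y"
  shows "V (Cos.cl c) = V (Cos.cl c')"
proof -
  interpret stable_class C "arrows C" M by (rule stable_class_M)
  from assms show ?thesis
  proof (induction rule: corel_induct)
    case base show ?case ..
  next
    case (step d d')
    have "V (Cos.cl d) = V (Cos.cl d')"
      using step(4) V_cospan_map[of d d'] V_cospan_map[of d' d] by auto
    with step.IH show ?case by simp
  qed
qed

text \<open>An arbitrary representative is chosen; by \<open>V_corel\<close> the value is the same
  for all of them.\<close>

definition W where "W s = V (Cos.cl (SOME c. c \<in> s))"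

lemma W_cl:
  assumes c: "c \<in> leg_cospans C (arrows C) X Y"
  shows "W (Cor.cl c) = V (Cos.cl c)"
proof -
  have "c \<in> Cor.cl c" using Cor.r_refl[OF c] by blast
  then have "(SOME c'. c' \<in> Cor.cl c) \<in> Cor.cl c" by (rule someI)
  then have "(c, SOME c'. c' \<in> Cor.cl c) \<in> corel_equiv C M" by blast
  from V_corel[OF this c] show ?thesis unfolding W_def by simp
qed

lemma W_Gamma: "y \<in> hom (Cospan C) X Y \<Longrightarrow> W (Gamma_functor C M y) = V y"
  unfolding Cospan_eq by (elim Cos.hom_QE) (simp only: Gamma_cl W_cl)

lemma Gamma_surj:
  assumes "x \<in> hom (Corel C M) X Y"
  shows "\<exists>y \<in> hom (Cospan C) X Y. Gamma_functor C M y = x"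
proof -
  from assms obtain f g where x: "x = Cor.cl (f, g)" and c: "(f, g) \<in> leg_cospans C (arrows C) X Y"
    unfolding Corel_eq by (rule Cor.hom_QE)
  show ?thesis unfolding x Cospan_eq using Cos.hom_QI[OF c] Gamma_cl[OF c] by blast
qed

text \<open>The pushout cospan of \<open>(f, g)\<close> is a backward arrow followed by a forward
  one in \<open>Cospan C\<close>. The cocone equations turn these factors into the two halves of the
  span, which recompose in \<open>Span C A\<close>.\<close>

lemma W_Pi:
  assumes "z \<in> hom (Span C A) X Y"
  shows "W (Pi_functor C M z) = U z"
proof -
  from assms obtain f g N where z: "z = Sp.cl (f, g)" "(f, g) \<in> leg_cospans (opposite C) A X Y"
    and f: "f \<in> hom C N X" "f \<in> A" and g: "g \<in> hom C N Y" "g \<in> A" by (rule spanE)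
  obtain p q where po: "is_pushout C f g p q" using pushout_ex[OF f(1) g(1)] by blast
  from po f(1) g(1) obtain Q where p: "p \<in> hom C X Q" and q: "q \<in> hom C Y Q" by (rule pushout_hom)
  have pq: "(p, q) \<in> leg_cospans C (arrows C) X Y"
    using p arrowsI[OF p] q arrowsI[OF q] by (rule Cos.leg_cospansI)
  have sp: "Sp.cl (f, idn C N) \<in> hom Sp.Q X N" "Sp.cl (idn C N, g) \<in> hom Sp.Q N Y"
    using Sp.forward_cospan[of f X N] Sp.backward_cospan[of g Y N] f g by (auto intro!: Sp.hom_QI)
  have "W (Pi_functor C M z) = V (Cos.cl (p, q))"
    by (simp only: z(1) Pi_cl[OF f(1) g(1) f(2) g(2) po] W_cl[OF pq])
  also have "\<dots> = V (Cos.cl (idn C X, f)) \<Zsemi>\<^bsub>D\<^esub> V (Cos.cl (g, idn C Y))"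
    using V_comp[OF backward_Cos[OF f(1)] forward_Cos[OF g(1)]]
    by (simp only: Cos.backward_forward[OF f(1) arrowsI[OF f(1)] g(1) arrowsI[OF g(1)] po])
  also have "\<dots> = U (Sp.cl (f, idn C N)) \<Zsemi>\<^bsub>D\<^esub> U (Sp.cl (idn C N, g))"
    by (simp only: UV_generators[OF f] UV_generators[OF g])
  also have "\<dots> = U (Sp.cl (f, idn C N) \<Zsemi>\<^bsub>Sp.Q\<^esub> Sp.cl (idn C N, g))"
    by (rule U_comp[OF sp, symmetric])
  also have "\<dots> = U z"
    using Sp.forward_backward[of f X N g Y] f g by (simp add: z(1))
  finally show ?thesis .
qed

lemma prop_morphism_W: "prop_morphism (Corel C M) D W"
proof -
  interpret Q: is_prop "Cospan C" by (rule is_prop_Cospan)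
  show ?thesis
    using prop_morphism_Gamma V Gamma_surj W_Gamma Q.idn_hom Q.symm_hom Q.comp_hom Q.tensor_hom
    by (rule prop_morphism_factor)
qed

lemma pushout_universal:
  "\<exists>W. prop_morphism (Corel C M) D W \<and>
     (\<forall>y \<in> arrows (Span C A). W (Pi_functor C M y) = U y) \<and>
     (\<forall>z \<in> arrows (Cospan C). W (Gamma_functor C M z) = V z) \<and>
     (\<forall>W'. prop_morphism (Corel C M) D W' \<and>
        (\<forall>y \<in> arrows (Span C A). W' (Pi_functor C M y) = U y) \<and>
        (\<forall>z \<in> arrows (Cospan C). W' (Gamma_functor C M z) = V z) \<longrightarrow>
        (\<forall>s \<in> arrows (Corel C M). W' s = W s))"
proof (intro exI[of _ W] conjI allI impI ballI)
  show "prop_morphism (Corel C M) D W" by (rule prop_morphism_W)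
  show "W (Pi_functor C M y) = U y" if "y \<in> arrows (Span C A)" for y
    using that W_Pi by (auto simp: arrows_def)
  show "W (Gamma_functor C M z) = V z" if "z \<in> arrows (Cospan C)" for z
    using that W_Gamma by (auto simp: arrows_def)
  fix W' s
  assume W': "prop_morphism (Corel C M) D W' \<and>
        (\<forall>y \<in> arrows (Span C A). W' (Pi_functor C M y) = U y) \<and>
        (\<forall>z \<in> arrows (Cospan C). W' (Gamma_functor C M z) = V z)"
    and "s \<in> arrows (Corel C M)"
  then obtain X Y where "s \<in> hom (Corel C M) X Y" by (auto simp: arrows_def)
  then obtain y where y: "y \<in> hom (Cospan C) X Y" "Gamma_functor C M y = s" using Gamma_surj by blast
  have "W' (Gamma_functor C M y) = V y" using W' arrowsI[OF y(1)] by blast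
  then show "W' s = W s" using W_Gamma[OF y(1)] y(2) by simp
qed

end

theorem square_is_pushout:
  "is_PROP_pushout TYPE('d) (A_plus_Aop C A) (Span C A) (Cospan C) (Corel C M)
      (to_Span C A) (to_Cospan C) (Pi_functor C M) (Gamma_functor C M)"
proof -
  have "is_prop (A_plus_Aop C A)" unfolding A_plus_Aop_def by (rule is_prop_coproduct)
  then show ?thesis
    unfolding is_PROP_pushout_def
  proof (intro conjI is_prop_Span is_prop_Cospan is_prop_Corel prop_morphism_to_Span
        prop_morphism_to_Cospan prop_morphism_Pi prop_morphism_Gamma ballI square_commutes)
    show "\<forall>(D :: 'd prop_data) U V.
        is_prop D \<and> prop_morphism (Span C A) D U \<and> prop_morphism (Cospan C) D V \<and>
        (\<forall>x \<in> arrows (A_plus_Aop C A). U (to_Span C A x) = V (to_Cospan C x)) \<longrightarrow>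
        (\<exists>W. prop_morphism (Corel C M) D W \<and>
          (\<forall>y \<in> arrows (Span C A). W (Pi_functor C M y) = U y) \<and>
          (\<forall>z \<in> arrows (Cospan C). W (Gamma_functor C M z) = V z) \<and>
          (\<forall>W'. prop_morphism (Corel C M) D W' \<and>
            (\<forall>y \<in> arrows (Span C A). W' (Pi_functor C M y) = U y) \<and>
            (\<forall>z \<in> arrows (Cospan C). W' (Gamma_functor C M z) = V z) \<longrightarrow>
            (\<forall>s \<in> arrows (Corel C M). W' s = W s)))"
    proof (intro allI impI)
      fix D :: "'d prop_data" and U V
      assume h: "is_prop D \<and> prop_morphism (Span C A) D U \<and> prop_morphism (Cospan C) D V \<and>
        (\<forall>x \<in> arrows (A_plus_Aop C A). U (to_Span C A x) = V (to_Cospan C x))"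
      show "\<exists>W. prop_morphism (Corel C M) D W \<and>
          (\<forall>y \<in> arrows (Span C A). W (Pi_functor C M y) = U y) \<and>
          (\<forall>z \<in> arrows (Cospan C). W (Gamma_functor C M z) = V z) \<and>
          (\<forall>W'. prop_morphism (Corel C M) D W' \<and>
            (\<forall>y \<in> arrows (Span C A). W' (Pi_functor C M y) = U y) \<and>
            (\<forall>z \<in> arrows (Cospan C). W' (Gamma_functor C M z) = V z) \<longrightarrow>
            (\<forall>s \<in> arrows (Corel C M). W' s = W s))"
        by (rule pushout_universal) (use h in blast)+
    qed
  qed
qed

end

theorem theorem3p9:
  fixes C :: "'c prop_data" and A E M :: "'c set"
  assumes "is_prop C"
    and "sub_prop C A"
    and "has_pushouts C"
    and "has_pullbacks C"
    and "factorisation_system C E M"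
    and "stable_under_pushout C M"
    and "\<forall>m \<in> M. is_mono C m"
    and "M \<subseteq> A"
    and "stable_under_pullback C A"
    and "\<forall>X Y Z P f g p q i j u.
           f \<in> hom C X Z \<inter> A \<and> g \<in> hom C Y Z \<inter> A \<and>
           is_pullback C f g p q \<and> is_pushout C p q i j \<and>
           i \<in> hom C X P \<and> j \<in> hom C Y P \<and>
           u \<in> hom C P Z \<and> i \<Zsemi>\<^bsub>C\<^esub> u = f \<and> j \<Zsemi>\<^bsub>C\<^esub> u = g \<longrightarrow> u \<in> M"
    and "tensor_preserves_pushouts C"
    and "tensor_preserves_pullbacks_in C A"
    and "\<forall>f \<in> M. \<forall>g \<in> M. f \<oplus>\<^bsub>C\<^esub> g \<in> M"
  shows "is_prop (Span C A) \<and> is_prop (Cospan C) \<and> is_prop (Corel C M) \<and>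
    is_PROP_pushout TYPE('d) (A_plus_Aop C A) (Span C A) (Cospan C) (Corel C M)
      (to_Span C A) (to_Cospan C) (Pi_functor C M) (Gamma_functor C M)"
proof -
  interpret corel_square C A M
  proof (rule corel_square.intro[OF assms(1)], unfold_locales, goal_cases)
    case 4 show ?case using assms(5) unfolding factorisation_system_def by blast
  next
    case (9 X Y Z P f g p q i j u)
    with assms(10)[rule_format, of f X Z g Y p q i j P u] show ?case by simp
  qed (use assms in simp_all)
  show ?thesis
    using is_prop_Span is_prop_Cospan is_prop_Corel square_is_pushout by simp
qed

end
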